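(* Let $\lambda$ be a nonempty partition and $\mu$ a partition. Then $$K_{\lambda,\mu}(\mathbf t,\mathbf w)=\sum_{\alpha}\sum_{\beta} f_{\lambda,\mu}^{(\alpha,\beta)}\,\mathbf w^{\alpha}\mathbf t^{\beta},$$ where $\alpha,\beta$ range over finitely supported sequences of nonnegative integers and $$f_{\lambda,\mu}^{(\alpha,\beta)}=\#\{S\in \mathrm{OS}^{\ell(\lambda)}(\lambda\to\mu):\ \mathrm{wt}(S)=\mathbf w^{\alpha}\mathbf t^{\beta}\}.$$
   Context: A partition is a weakly decreasing sequence $\lambda=(\lambda_1,\lambda_2,\ldots)$ of nonnegative integers with finitely many nonzero parts, identified with its Young diagram (box $(i,j)$ in row $i$, column $j$); $\ell(\lambda)$ is the number of nonzero parts, $|\lambda|=\sum_i\lambda_i$, and $\mu\subseteq\lambda$ means $\mu_i\le\lambda_i$ for all $i$. A skew shape $\lambda/\mu$ is a horizontal (resp. vertical) strip if no two of its boxes lie in the same column (resp. row); the empty shape is allowed. $\mathbf x,\mathbf t,\mathbf w$ are countable sequences of variables and $\mathbf y^{\alpha}=y_1^{\alpha_1}y_2^{\alpha_2}\cdots$. Hybrid Grothendieck polynomials. For nonempty finite sets $A,B\subset\mathbb Z_{>0}$ write $A\le B$ if $\max A\le\min B$. A set-valued reverse plane partition $T$ of shape $\lambda$ fills each box $(i,j)$ of $\lambda$ with a nonempty finite set $T(i,j)$ of positive integers, weakly increasing (for $\le$) along each row and down each column; $\mathrm{SVRPP}(\lambda)$ is the set of these. For such $T$: $\mathrm{ircont}(T)=(r_1,r_2,\ldots)$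 with $r_i$ the number of columns containing a box whose set contains $i$; $\mathrm{ceq}(T)=(c_1,c_2,\ldots)$ with $c_i$ the number of boxes $(i,j)$ in row $i$ such that $(i+1,j)\in\lambda$ and $\max T(i,j)=\min T(i+1,j)$; $\mathrm{ex}(T)=(e_1,e_2,\ldots)$ with $e_i=\sum_{j:(i,j)\in\lambda}(\#T(i,j)-1)$. Put $$H_\lambda(\mathbf x;\mathbf t,\mathbf w)=\sum_{T\in\mathrm{SVRPP}(\lambda)}\mathbf x^{\mathrm{ircont}(T)}\mathbf t^{\mathrm{ceq}(T)}\mathbf w^{\mathrm{ex}(T)},$$ which is known to be symmetric in $\mathbf x$. The coefficients $K_{\lambda,\mu}(\mathbf t,\mathbf w)$ are defined by the Schur expansion $H_\lambda(\mathbf x;\mathbf t,\mathbf w)=\sum_\mu K_{\lambda,\mu}(\mathbf t,\mathbf w)\,s_\mu(\mathbf x)$ (a formal, possibly infinite, sum). Oscillating sequences. A pair of partitions $(\lambda,\mu)$ is a $k$-falling pair if $\lambda\supseteq\mu$, $\lambda_i=\mu_i$ for all $i\le k$, and $\lambda/\mu$ is a horizontal strip. It is a $k$-rising pair if $\lambda\subseteq\mu$, $\lambda_i=\mu_i$ for all $i\le k$, and $\mu/\lambda$ is a vertical strip. For $l\ge1$, an $l$-oscillating sequence from $\lambda$ to $\mu$ is a sequence of partitions $S=(\lambda^0,\lambda^1,\ldots,\lambda^{2l-1})$ with $\lambda^0=\lambda$, $\lambda^{2l-1}=\mu$, such that $(\lambda^{2i-2},\lambda^{2i-1})$ is an $(l-i+1)$-rising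 pair for each $1\le i\le l$ and $(\lambda^{2j-1},\lambda^{2j})$ is an $(l-j)$-falling pair for each $1\le j\le l-1$. $\mathrm{OS}^l(\lambda\to\mu)$ is the set of these (a finite set). The weight of $S$ is $$\mathrm{wt}(S)=\prod_{1\le i\le l}w_{l-i+1}^{a_i}\prod_{1\le j\le l-1}t_{l-j}^{b_j},\qquad a_i=|\lambda^{2i-1}/\lambda^{2i-2}|,\quad b_j=|\lambda^{2j-1}/\lambda^{2j}|,$$ where $|\rho/\sigma|$ is the number of boxes of $\rho/\sigma$. *)

theory Defs
  imports "HOL-Library.FuncSet" "HOL-Library.Poly_Mapping"
begin

text \<open>All sequences of the form \<open>(a\<^sub>1, a\<^sub>2, \<dots>)\<close> (partitions, exponents, families of variables) are
  indexed by the positive natural numbers; index 0 is never used.\<close>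

subsection \<open>Partitions and skew shapes\<close>

typedef integer_partition =
  "{f :: nat \<Rightarrow> nat. f 0 = 0 \<and> (\<forall>i\<ge>1. f (Suc i) \<le> f i) \<and> finite {i. f i \<noteq> 0}}"
  morphisms part Abs_integer_partition
  by (rule exI[of _ "\<lambda>_. 0"]) simp

definition diagram :: "integer_partition \<Rightarrow> (nat \<times> nat) set" where
  "diagram lam = {(i, j). 1 \<le> i \<and> 1 \<le> j \<and> j \<le> part lam i}"

definition num_parts :: "integer_partition \<Rightarrow> nat" where
  "num_parts lam = card {i. part lam i \<noteq> 0}"

definition contained :: "integer_partition \<Rightarrow> integer_partition \<Rightarrow> bool" where
  "contained mu lam \<longleftrightarrow> (\<forall>i. part mu i \<le> part lam i)"

definition skew :: "integer_partition \<Rightarrow> integer_partition \<Rightarrow> (nat \<times> nat) set" where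
  "skew lam mu = diagram lam - diagram mu"

definition horizontal_strip :: "(nat \<times> nat) set \<Rightarrow> bool" where
  "horizontal_strip D \<longleftrightarrow> (\<forall>i i' j. (i, j) \<in> D \<and> (i', j) \<in> D \<longrightarrow> i = i')"

definition vertical_strip :: "(nat \<times> nat) set \<Rightarrow> bool" where
  "vertical_strip D \<longleftrightarrow> (\<forall>i j j'. (i, j) \<in> D \<and> (i, j') \<in> D \<longrightarrow> j = j')"

subsection \<open>The coefficient ring \<open>\<int>[t, w]\<close> and formal power series in \<open>x\<close>\<close>

datatype tw_var = T_var nat | W_var nat

text \<open>Polynomials over \<open>\<int>\<close>, as finitely supported functions on monomials, which are in turn
  finitely supported functions on variables; multiplication is convolution.\<close>
type_synonym tw_poly = "(tw_var \<Rightarrow>\<^sub>0 nat) \<Rightarrow>\<^sub>0 int"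

definition tvar :: "nat \<Rightarrow> tw_poly" where
  "tvar i = Poly_Mapping.single (Poly_Mapping.single (T_var i) 1) 1"

definition wvar :: "nat \<Rightarrow> tw_poly" where
  "wvar i = Poly_Mapping.single (Poly_Mapping.single (W_var i) 1) 1"

text \<open>\<open>mon y a\<close> is \<open>y\<^sup>a\<close>, for finitely supported \<open>a\<close> only (otherwise \<open>Prod_any\<close> returns 1).\<close>
definition mon :: "(nat \<Rightarrow> tw_poly) \<Rightarrow> (nat \<Rightarrow> nat) \<Rightarrow> tw_poly" where
  "mon y a = Prod_any (\<lambda>i. y i ^ a i)"

text \<open>A power series in \<open>x\<close> is given by its coefficients: its value at \<open>g\<close> is the
  coefficient of \<open>x\<^sup>g\<close>.\<close>
type_synonym x_series = "(nat \<Rightarrow>\<^sub>0 nat) \<Rightarrow> tw_poly"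

subsection \<open>Hybrid Grothendieck polynomials\<close>

text \<open>For finite nonempty sets; not reflexive except on singletons.\<close>
definition set_le :: "nat set \<Rightarrow> nat set \<Rightarrow> bool" where
  "set_le A B \<longleftrightarrow> Max A \<le> Min B"

definition SVRPP :: "integer_partition \<Rightarrow> (nat \<times> nat \<Rightarrow> nat set) set" where
  "SVRPP lam = {T \<in> diagram lam \<rightarrow>\<^sub>E {A. finite A \<and> A \<noteq> {} \<and> A \<subseteq> {1..}}.
     (\<forall>i j j'. (i, j) \<in> diagram lam \<and> (i, j') \<in> diagram lam \<and> j < j' \<longrightarrow> set_le (T (i, j)) (T (i, j'))) \<and>
     (\<forall>i i' j. (i, j) \<in> diagram lam \<and> (i', j) \<in> diagram lam \<and> i < i' \<longrightarrow> set_le (T (i, j)) (T (i', j)))}"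

definition ircont :: "integer_partition \<Rightarrow> (nat \<times> nat \<Rightarrow> nat set) \<Rightarrow> nat \<Rightarrow> nat" where
  "ircont lam T k = card {j. \<exists>i. (i, j) \<in> diagram lam \<and> k \<in> T (i, j)}"

definition ceq :: "integer_partition \<Rightarrow> (nat \<times> nat \<Rightarrow> nat set) \<Rightarrow> nat \<Rightarrow> nat" where
  "ceq lam T i = card {j. (i, j) \<in> diagram lam \<and> (i + 1, j) \<in> diagram lam \<and>
                          Max (T (i, j)) = Min (T (i + 1, j))}"

definition excess :: "integer_partition \<Rightarrow> (nat \<times> nat \<Rightarrow> nat set) \<Rightarrow> nat \<Rightarrow> nat" where
  "excess lam T i = (\<Sum>j \<in> {j. (i, j) \<in> diagram lam}. (card (T (i, j)) - 1))"

text \<open>Only finitely many tableaux contribute to the coefficient of a given \<open>x\<^sup>g\<close>, since their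
  entries lie in the support of \<open>g\<close>.\<close>
definition hybrid_groth :: "integer_partition \<Rightarrow> x_series" where
  "hybrid_groth lam g =
     (\<Sum>T \<in> {T \<in> SVRPP lam. ircont lam T = Poly_Mapping.lookup g}.
        mon tvar (ceq lam T) * mon wvar (excess lam T))"

subsection \<open>Schur functions and the Schur expansion\<close>

definition SSYT :: "integer_partition \<Rightarrow> (nat \<times> nat \<Rightarrow> nat) set" where
  "SSYT mu = {T \<in> diagram mu \<rightarrow>\<^sub>E {1..}.
     (\<forall>i j j'. (i, j) \<in> diagram mu \<and> (i, j') \<in> diagram mu \<and> j < j' \<longrightarrow> T (i, j) \<le> T (i, j')) \<and>
     (\<forall>i i' j. (i, j) \<in> diagram mu \<and> (i', j) \<in> diagram mu \<and> i < i' \<longrightarrow> T (i, j) < T (i', j))}"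

definition ssyt_content :: "integer_partition \<Rightarrow> (nat \<times> nat \<Rightarrow> nat) \<Rightarrow> nat \<Rightarrow> nat" where
  "ssyt_content mu T k = card {b \<in> diagram mu. T b = k}"

definition schur :: "integer_partition \<Rightarrow> x_series" where
  "schur mu g = of_nat (card {T \<in> SSYT mu. ssyt_content mu T = Poly_Mapping.lookup g})"

text \<open>The formal sum over all partitions is taken coefficientwise in \<open>x\<close>. For each \<open>g\<close> only the
  finitely many \<open>mu\<close> with as many boxes as the degree of \<open>x\<^sup>g\<close> have \<open>schur mu g \<noteq> 0\<close>, so
  \<open>Sum_any\<close> is always a genuine finite sum here.\<close>
definition schur_expansion :: "x_series \<Rightarrow> (integer_partition \<Rightarrow> tw_poly) \<Rightarrow> bool" where
  "schur_expansion F c \<longleftrightarrow> (\<forall>g. F g = Sum_any (\<lambda>mu. c mu * schur mu g))"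

text \<open>The Schur expansion exists because the hybrid Grothendieck polynomials are symmetric in \<open>x\<close>,
  and is unique because Schur functions are linearly independent.\<close>
definition K_coeff :: "integer_partition \<Rightarrow> integer_partition \<Rightarrow> tw_poly" where
  "K_coeff lam = (THE c. schur_expansion (hybrid_groth lam) c)"

subsection \<open>Oscillating sequences\<close>

definition falling_pair :: "nat \<Rightarrow> integer_partition \<Rightarrow> integer_partition \<Rightarrow> bool" where
  "falling_pair k lam mu \<longleftrightarrow>
     contained mu lam \<and> (\<forall>i\<le>k. part lam i = part mu i) \<and> horizontal_strip (skew lam mu)"

definition rising_pair :: "nat \<Rightarrow> integer_partition \<Rightarrow> integer_partition \<Rightarrow> bool" where
  "rising_pair k lam mu \<longleftrightarrow>
     contained lam mu \<and> (\<forall>i\<le>k. part lam i = part mu i) \<and> vertical_strip (skew mu lam)"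

text \<open>The entry \<open>S ! i\<close> is the \<open>i\<close>-th partition of the sequence, counted from 0; \<open>l \<ge> 1\<close> is intended.\<close>
definition OS :: "nat \<Rightarrow> integer_partition \<Rightarrow> integer_partition \<Rightarrow> integer_partition list set" where
  "OS l lam mu = {S. length S = 2 * l \<and> S ! 0 = lam \<and> S ! (2 * l - 1) = mu \<and>
     (\<forall>i \<in> {1..l}. rising_pair (l - i + 1) (S ! (2 * i - 2)) (S ! (2 * i - 1))) \<and>
     (\<forall>j \<in> {1..l - 1}. falling_pair (l - j) (S ! (2 * j - 1)) (S ! (2 * j)))}"

definition wt :: "nat \<Rightarrow> integer_partition list \<Rightarrow> tw_poly" where
  "wt l S = (\<Prod>i \<in> {1..l}. wvar (l - i + 1) ^ card (skew (S ! (2 * i - 1)) (S ! (2 * i - 2)))) *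
            (\<Prod>j \<in> {1..l - 1}. tvar (l - j) ^ card (skew (S ! (2 * j - 1)) (S ! (2 * j))))"

definition f_coeff :: "integer_partition \<Rightarrow> integer_partition \<Rightarrow> (nat \<Rightarrow>\<^sub>0 nat) \<Rightarrow> (nat \<Rightarrow>\<^sub>0 nat) \<Rightarrow> nat" where
  "f_coeff lam mu a b = card {S \<in> OS (num_parts lam) lam mu.
     wt (num_parts lam) S = mon wvar (Poly_Mapping.lookup a) * mon tvar (Poly_Mapping.lookup b)}"

end

theory Submission
  imports Defs "HOL-Computational_Algebra.Polynomial"
begin

text \<open>
  Both families of power series are governed by what happens when the largest letter of a tableau is
  removed. Write \<open>h(x)\<close> for the matrix on partitions with entry \<open>x^|\<mu>/\<nu>|\<close> at \<open>(\<mu>, \<nu>)\<close> when \<open>\<mu>/\<nu>\<close> is a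
  horizontal strip, and \<open>v(w)\<close> for the one with entry \<open>w^|\<nu>/\<mu>|\<close> when \<open>\<nu>/\<mu>\<close> is a vertical strip.
  Removing the letter \<open>n\<close> from a semistandard tableau gives the branching rule
  \<open>s\<^sub>\<mu>(x\<^sub>1..x\<^sub>n) = \<Sum>\<nu>. h(x\<^sub>n) \<mu> \<nu> * s\<^sub>\<nu>(x\<^sub>1..x\<^bsub>n-1\<^esub>)\<close>. In a set-valued reverse plane partition of shape
  \<open>\<lambda>\<close>, the boxes holding some letter other than \<open>n\<close> form a partition \<open>\<alpha> \<subseteq> \<lambda>\<close>, and among the boxes
  of \<open>\<alpha>\<close> only removable corners can hold \<open>n\<close>; any set of corners may occur. Hence
  \<open>H\<^sub>\<lambda>(x\<^sub>1..x\<^sub>n) = \<Sum>\<alpha>. L(x\<^sub>n) \<lambda> \<alpha> * H\<^sub>\<alpha>(x\<^sub>1..x\<^bsub>n-1\<^esub>)\<close> with a matrix \<open>L(x)\<close> whose entries are products of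
  one factor per row (\<open>svrpps_branching\<close>, from the bijection \<open>bij_add_letter\<close>).

  Let \<open>K \<lambda> \<mu>\<close> be the total weight of the oscillating sequences from \<open>\<lambda>\<close> to \<open>\<mu>\<close>. By induction on
  the number of variables, \<open>H\<^sub>\<lambda> = \<Sum>\<mu>. K \<lambda> \<mu> * s\<^sub>\<mu>\<close> follows from the matrix identity \<open>K h(x) = L(x) K\<close>,
  which is \<open>osc_sum_branching\<close>. It is proved by induction on the number of rows of \<open>\<lambda>\<close>. No step of an
  oscillating sequence changes the first row, so removing it leaves an oscillating sequence for
  the remaining rows (with all variables shifted), followed by \<open>h(t\<^sub>1)\<close> and \<open>v(w\<^sub>1)\<close>. For the
  rows below the first, \<open>K h(x)\<close> therefore ends in \<open>h(t\<^sub>1) v(w\<^sub>1) h(x)\<close>, where the first row of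
  the shape between \<open>v(w\<^sub>1)\<close> and \<open>h(x)\<close> is bounded because it lies below another row.
  Two facts move \<open>h(x)\<close> to the front: \<open>v(w) h(x) = (1 + w x) h(x) v(w)\<close>, where the bound removes the
  factor \<open>1 + w x\<close> exactly when the bound is attained (\<open>vstep_hstep_commute\<close>), and the Bender-Knuth
  symmetry of \<open>h(x) h(y)\<close>, which survives a bound on the intermediate shape up to a monomial
  (\<open>two_hsteps_swap\<close>). The factors and monomials left over are the first-row factor of \<open>L(x)\<close>, and the
  induction hypothesis commutes \<open>h(x)\<close> past the sequence for the lower rows.

  Finally, a Schur expansion determines its coefficients, since the Kostka matrix is unitriangular
  (\<open>schur_expansion_unique\<close>), and grouping the oscillating sequences by weight turns \<open>K\<close> into the
  sum over exponents.
\<close>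


section \<open>Partitions in a box\<close>

text \<open>The length of the first row; the empty list stands for the empty partition.\<close>
fun hd0 :: "nat list \<Rightarrow> nat" where
  "hd0 [] = 0"
| "hd0 (a # _) = a"

text \<open>Partitions with at most \<open>n\<close> parts, all at most \<open>q\<close>, as weakly decreasing lists of length
  exactly \<open>n\<close> padded with zeros. The recursion peels off the first row, which is how all sums
  below are evaluated.\<close>
fun boxed :: "nat \<Rightarrow> nat \<Rightarrow> nat list set" where
  "boxed q 0 = {[]}"
| "boxed q (Suc n) = (\<Union>m\<in>{..q}. (#) m ` boxed m n)"

lemma finite_boxed [simp]: "finite (boxed q n)"
  by (induction n arbitrary: q) auto

lemma length_boxed: "xs \<in> boxed q n \<Longrightarrow> length xs = n"
  by (induction n arbitrary: q xs) auto

lemma hd0_boxed: "xs \<in> boxed q n \<Longrightarrow> hd0 xs \<le> q"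
  by (cases n) auto

lemma boxed_mono: "p \<le> q \<Longrightarrow> boxed p n \<subseteq> boxed q n"
proof (cases n)
  case (Suc n')
  assume "p \<le> q"
  then show ?thesis unfolding Suc boxed.simps by (intro UN_mono) auto
qed simp

lemma boxed_hd0: "xs \<in> boxed q n \<Longrightarrow> hd0 xs \<le> p \<Longrightarrow> xs \<in> boxed p n"
  by (cases n) auto

lemma boxed_SucE:
  assumes "xs \<in> boxed q (Suc n)"
  obtains a ys where "xs = a # ys" "a \<le> q" "ys \<in> boxed a n"
  using assms by auto

lemma sum_boxed_Suc:
  "(\<Sum>xs\<in>boxed q (Suc n). f xs) = (\<Sum>m\<le>q. \<Sum>xs\<in>boxed m n. f (m # xs))"
proof -
  have "(\<Sum>xs\<in>boxed q (Suc n). f xs) = (\<Sum>m\<le>q. \<Sum>xs\<in>(#) m ` boxed m n. f xs)"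
    by (simp, subst sum.UNION_disjoint) auto
  also have "\<dots> = (\<Sum>m\<le>q. \<Sum>xs\<in>boxed m n. f (m # xs))"
    by (rule sum.cong[OF refl], subst sum.reindex) auto
  finally show ?thesis .
qed

lemma sum_boxed_shrink:
  assumes "\<And>xs. xs \<in> boxed q n \<Longrightarrow> p < hd0 xs \<Longrightarrow> f xs = 0" "p \<le> q"
  shows "(\<Sum>xs\<in>boxed q n. f xs) = (\<Sum>xs\<in>boxed p n. f xs)"
proof (rule sum.mono_neutral_right)
  show "boxed p n \<subseteq> boxed q n" using assms(2) by (rule boxed_mono)
  show "\<forall>i\<in>boxed q n - boxed p n. f i = 0"
    using assms(1) boxed_hd0 by (metis Diff_iff leI)
qed simp

lemma sum_boxed_if:
  "(\<Sum>xs\<in>boxed q n. if hd0 xs \<le> p then f xs else 0) = (\<Sum>xs\<in>boxed (min p q) n. f xs)"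
proof -
  have "(\<Sum>xs\<in>boxed q n. if hd0 xs \<le> p then f xs else 0)
      = (\<Sum>xs\<in>boxed (min p q) n. if hd0 xs \<le> p then f xs else 0)"
    by (rule sum_boxed_shrink) (use hd0_boxed in force)+
  also have "\<dots> = (\<Sum>xs\<in>boxed (min p q) n. f xs)"
    by (rule sum.cong) (use hd0_boxed in force)+
  finally show ?thesis .
qed

section \<open>Horizontal and vertical strips as matrices\<close>

text \<open>The entry of the matrix \<open>h(x)\<close>. If \<open>n\<close> rows are left after removing a horizontal
  strip, there were at most \<open>n + 1\<close> rows before, so the first list is one longer than the second.
  With this convention every intermediate sum over lists of fixed length runs over all relevant
  partitions.\<close>
fun hstep :: "'a::comm_ring_1 \<Rightarrow> nat list \<Rightarrow> nat list \<Rightarrow> 'a" where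
  "hstep x [m] [] = x ^ m"
| "hstep x (m # m' # xs) (k # ys) =
     (if m' \<le> k \<and> k \<le> m then x ^ (m - k) * hstep x (m' # xs) ys else 0)"
| "hstep x _ _ = 0"

text \<open>The entry of the matrix \<open>v(w)\<close>, from the smaller to the larger partition.\<close>
fun vstep :: "'a::comm_ring_1 \<Rightarrow> nat list \<Rightarrow> nat list \<Rightarrow> 'a" where
  "vstep w [] [] = 1"
| "vstep w (a # xs) (b # ys) = (if b = a then 1 else if b = Suc a then w else 0) * vstep w xs ys"
| "vstep w _ _ = 0"

lemma hstep_Cons:
  "xs \<noteq> [] \<Longrightarrow> hstep x (m # xs) (k # ys) =
     (if hd0 xs \<le> k \<and> k \<le> m then x ^ (m - k) * hstep x xs ys else 0)"
  by (cases xs) auto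

lemma hstep_eq_0: "hd0 xs < hd0 ys \<Longrightarrow> hstep x xs ys = 0"
  by (cases "(x, xs, ys)" rule: hstep.cases) auto

lemma vstep_eq_0: "hd0 ys < hd0 xs \<Longrightarrow> vstep w xs ys = 0"
  by (cases "(w, xs, ys)" rule: vstep.cases) auto

lemma boxed_Suc_neq_Nil: "xs \<in> boxed q (Suc n) \<Longrightarrow> xs \<noteq> []"
  by auto

section \<open>Commuting a vertical strip with a horizontal strip\<close>

text \<open>The contribution of the first row to \<open>vstep_hstep_commute\<close>: here \<open>a\<close> and \<open>k\<close> are the first rows of the
  two end points and \<open>a'\<close> is the second row of the starting point. If \<open>k \<le> a\<close>, each of the
  two sums is \<open>x^(a - k)\<close> times the factor found on the other side; if \<open>k = a + 1\<close>, both sums are \<open>w\<close> and both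
  factors are \<open>1 + w x\<close>; otherwise both sums vanish.\<close>
lemma vstep_hstep_row:
  fixes w x :: "'a::comm_ring_1"
  assumes "a' \<le> k" "a' \<le> a" "a \<le> m" "k \<le> m"
  shows "(\<Sum>u\<le>m. if k \<le> u then (if u = a then 1 else if u = Suc a then w else 0) * x ^ (u - k) else 0)
      * (1 + (if a' < k then w * x else 0))
    = (1 + (if a < m then w * x else 0))
      * (\<Sum>r\<le>m. if a' \<le> r \<and> r \<le> a then x ^ (a - r) * (if k = r then 1 else if k = Suc r then w else 0) else 0)"
proof -
  have l: "(\<Sum>u\<le>m. if k \<le> u then (if u = a then 1 else if u = Suc a then w else 0) * x ^ (u - k) else 0)
     = (if k \<le> a then x ^ (a - k) else 0) + (if a < m \<and> k \<le> Suc a then w * x ^ (Suc a - k) else 0)"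
  proof -
    have "(\<Sum>u\<le>m. if k \<le> u then (if u = a then 1 else if u = Suc a then w else 0) * x ^ (u - k) else 0)
      = (\<Sum>u\<le>m. (if u = a then (if k \<le> a then x ^ (a - k) else 0) else 0)
           + (if u = Suc a then (if k \<le> Suc a then w * x ^ (Suc a - k) else 0) else 0))"
      by (rule sum.cong) auto
    then show ?thesis using assms by (simp add: sum.distrib Suc_le_eq)
  qed
  have r: "(\<Sum>r\<le>m. if a' \<le> r \<and> r \<le> a then x ^ (a - r) * (if k = r then 1 else if k = Suc r then w else 0) else 0)
     = (if k \<le> a then x ^ (a - k) else 0)
        + (if a' < k \<and> k \<le> Suc a then x ^ (Suc a - k) * w else 0)"
  proof -
    have "(\<Sum>r\<le>m. if a' \<le> r \<and> r \<le> a then x ^ (a - r) * (if k = r then 1 else if k = Suc r then w else 0) else 0)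
      = (\<Sum>r\<le>m. (if r = k then (if k \<le> a then x ^ (a - k) else 0) else 0)
           + (if r = k - 1 then (if a' < k \<and> k \<le> Suc a then x ^ (Suc a - k) * w else 0) else 0))"
      using assms by (intro sum.cong refl) (auto simp: le_Suc_eq)
    moreover have "k - 1 \<le> m" using assms by simp
    ultimately show ?thesis by (simp add: sum.distrib assms)
  qed
  show ?thesis
    unfolding l r using assms
    by (cases "k \<le> a"; cases "k = Suc a") (auto simp: algebra_simps Suc_diff_le)
qed

text \<open>Adding a vertical strip and then removing a horizontal one is, up to a factor \<open>1 + w x\<close>, the
  same as proceeding in the opposite order. The intermediate shape on the left has first row at
  most \<open>m\<close>; if \<open>xs\<close> already attains this bound, its first row cannot grow, and the factor
  disappears. Given the end points, the rows of the intermediate shape vary independently, so the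
  two sides can be compared row by row: the truncation at row \<open>i\<close> is caused by row \<open>i - 1\<close> of \<open>zs\<close>,
  and the factor \<open>1 + w x\<close> lost or gained is handed from each row to the next.\<close>
lemma vstep_hstep_commute:
  fixes w x :: "'a::comm_ring_1"
  assumes "xs \<in> boxed m (Suc n)" "zs \<in> boxed m n"
  shows "(\<Sum>ys\<in>boxed m (Suc n). vstep w xs ys * hstep x ys zs)
    = (1 + (if hd0 xs < m then w * x else 0)) * (\<Sum>ys\<in>boxed m n. hstep x xs ys * vstep w ys zs)"
  using assms
proof (induction n arbitrary: m xs zs)
  case 0
  then obtain a where xs: "xs = [a]" "a \<le> m" by auto
  have zs: "zs = []" using 0 by simp
  have "(\<Sum>ys\<in>boxed m (Suc 0). vstep w xs ys * hstep x ys zs)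
     = (\<Sum>u\<le>m. (if u = a then x ^ a else 0) + (if u = Suc a then w * x ^ Suc a else 0))"
    unfolding sum_boxed_Suc by (rule sum.cong) (auto simp: xs zs)
  then show ?case using xs zs by (simp add: sum.distrib algebra_simps)
next
  case (Suc n)
  obtain a xs' where xs: "xs = a # xs'" "a \<le> m" "xs' \<in> boxed a (Suc n)"
    using Suc.prems(1) by (rule boxed_SucE)
  obtain k zs' where zs: "zs = k # zs'" "k \<le> m" "zs' \<in> boxed k n"
    using Suc.prems(2) by (rule boxed_SucE)
  define a' where "a' = hd0 xs'"
  have a': "a' \<le> a" unfolding a'_def using xs(3) by (rule hd0_boxed)
  have ne: "xs' \<noteq> []" using xs(3) by (rule boxed_Suc_neq_Nil)
  define S where "S = (\<Sum>ys\<in>boxed a' n. hstep x xs' ys * vstep w ys zs')"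
  have S: "(\<Sum>ys\<in>boxed r n. hstep x xs' ys * vstep w ys zs') = S" if "a' \<le> r" for r
    unfolding S_def using that
    by (intro sum_boxed_shrink) (simp_all add: a'_def hstep_eq_0)
  have lhs: "(\<Sum>ys\<in>boxed m (Suc (Suc n)). vstep w xs ys * hstep x ys zs)
    = (\<Sum>u\<le>m. if k \<le> u then (if u = a then 1 else if u = Suc a then w else 0) * x ^ (u - k) else 0)
       * (\<Sum>ys\<in>boxed k (Suc n). vstep w xs' ys * hstep x ys zs')"
    unfolding sum_boxed_Suc[of _ m] sum_distrib_right
  proof (rule sum.cong[OF refl])
    fix u assume "u \<in> {..m}"
    let ?v = "if u = a then 1 else if u = Suc a then w else (0::'a)"
    \<comment> \<open>the first row \<open>k\<close> of the end point bounds the second row of the intermediate shape\<close>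
    have "(\<Sum>ys\<in>boxed u (Suc n). vstep w xs (u # ys) * hstep x (u # ys) zs)
      = (\<Sum>ys\<in>boxed u (Suc n). if hd0 ys \<le> k then
            (if k \<le> u then ?v * x ^ (u - k) * (vstep w xs' ys * hstep x ys zs') else 0) else 0)"
      by (rule sum.cong[OF refl], drule boxed_Suc_neq_Nil)
         (simp add: xs zs hstep_Cons mult_ac)
    also have "\<dots> = (\<Sum>ys\<in>boxed (min k u) (Suc n).
            (if k \<le> u then ?v * x ^ (u - k) * (vstep w xs' ys * hstep x ys zs') else 0))"
      by (rule sum_boxed_if)
    also have "\<dots> = (if k \<le> u then ?v * x ^ (u - k) else 0)
         * (\<Sum>ys\<in>boxed k (Suc n). vstep w xs' ys * hstep x ys zs')"
      by (simp add: sum_distrib_left min_def del: boxed.simps)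
    finally show "(\<Sum>ys\<in>boxed u (Suc n). vstep w xs (u # ys) * hstep x (u # ys) zs)
      = (if k \<le> u then ?v * x ^ (u - k) else 0)
         * (\<Sum>ys\<in>boxed k (Suc n). vstep w xs' ys * hstep x ys zs')" .
  qed
  have rhs: "(\<Sum>ys\<in>boxed m (Suc n). hstep x xs ys * vstep w ys zs)
    = (\<Sum>r\<le>m. if a' \<le> r \<and> r \<le> a then x ^ (a - r) * (if k = r then 1 else if k = Suc r then w else 0) else 0) * S"
    unfolding sum_boxed_Suc sum_distrib_right
  proof (rule sum.cong[OF refl])
    fix r assume "r \<in> {..m}"
    let ?v = "if k = r then 1 else if k = Suc r then w else (0::'a)"
    have "(\<Sum>ys\<in>boxed r n. hstep x xs (r # ys) * vstep w (r # ys) zs)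
      = (if a' \<le> r \<and> r \<le> a then x ^ (a - r) * ?v else 0) * (\<Sum>ys\<in>boxed r n. hstep x xs' ys * vstep w ys zs')"
      by (auto simp: xs zs ne hstep_Cons sum_distrib_left a'_def mult_ac intro!: sum.cong)
    then show "(\<Sum>ys\<in>boxed r n. hstep x xs (r # ys) * vstep w (r # ys) zs)
      = (if a' \<le> r \<and> r \<le> a then x ^ (a - r) * ?v else 0) * S"
      using S[of r] by simp
  qed
  show ?case
  proof (cases "a' \<le> k")
    case True
    then have "xs' \<in> boxed k (Suc n)" using xs(3) boxed_hd0 a'_def by blast
    from Suc.IH[OF this zs(3)] S[OF True]
    have IH: "(\<Sum>ys\<in>boxed k (Suc n). vstep w xs' ys * hstep x ys zs')
       = (1 + (if a' < k then w * x else 0)) * S"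
      unfolding a'_def by simp
    show ?thesis
      unfolding lhs rhs IH using vstep_hstep_row[OF True a' xs(2) zs(2), of w x]
      by (simp add: xs(1) mult.assoc[symmetric])
  next
    case False
    have "(\<Sum>ys\<in>boxed k (Suc n). vstep w xs' ys * hstep x ys zs') = 0"
    proof (intro sum.neutral ballI)
      fix ys assume "ys \<in> boxed k (Suc n)"
      then have "hd0 ys \<le> k" by (rule hd0_boxed)
      then show "vstep w xs' ys * hstep x ys zs' = 0"
        using False by (simp add: a'_def vstep_eq_0)
    qed
    moreover have "(\<Sum>r\<le>m. if a' \<le> r \<and> r \<le> a then x ^ (a - r) * (if k = r then 1 else if k = Suc r then w else 0) else 0) = 0"
      using False by (intro sum.neutral) auto
    ultimately show ?thesis unfolding lhs rhs by simp
  qed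
qed

section \<open>Exchanging two horizontal strips\<close>

text \<open>The product \<open>h(x) h(y)\<close>, restricted to intermediate partitions with first row at most \<open>m\<close>.\<close>
definition two_hsteps :: "'a::comm_ring_1 \<Rightarrow> 'a \<Rightarrow> nat \<Rightarrow> nat list \<Rightarrow> nat list \<Rightarrow> 'a" where
  "two_hsteps x y m xs zs = (\<Sum>ys\<in>boxed m (Suc (length zs)). hstep x xs ys * hstep y ys zs)"

lemma complete_sum_swap:
  fixes x y :: "'a::comm_ring_1"
  shows "(\<Sum>k\<in>{a..b::nat}. x ^ (b - k) * y ^ (k - a)) = (\<Sum>k\<in>{a..b}. y ^ (b - k) * x ^ (k - a))"
  by (rule sum.reindex_bij_witness[of _ "\<lambda>k. a + b - k" "\<lambda>k. a + b - k"])
     (auto simp: mult.commute)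

text \<open>The contribution of one row to the Bender-Knuth symmetry: in \<open>h(x) h(y)\<close> the length \<open>k\<close> of a
  given row of the intermediate shape ranges over an interval, and the sum over \<open>k\<close> is a complete
  homogeneous polynomial in \<open>x\<close> and \<open>y\<close> times a monomial, which is balanced by the prefactor.\<close>
lemma two_hsteps_swap_row:
  fixes x y :: "'a::comm_ring_1"
  assumes "b \<le> q"
  shows "y ^ (q - b) * (\<Sum>k\<in>{a..b}. x ^ (q - k) * y ^ (k - a))
       = x ^ (q - b) * (\<Sum>k\<in>{a..b}. y ^ (q - k) * x ^ (k - a))"
proof -
  have 1: "(\<Sum>k\<in>{a..b}. u ^ (q - k) * v ^ (k - a)) = u ^ (q - b) * (\<Sum>k\<in>{a..b}. u ^ (b - k) * v ^ (k - a))"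
    for u v :: 'a
    using assms by (auto simp: sum_distrib_left mult.assoc[symmetric] power_add[symmetric] intro!: sum.cong)
  show ?thesis unfolding 1 complete_sum_swap[of x b y a] by (simp add: mult_ac)
qed

text \<open>Without a bound on the intermediate shape (\<open>m \<ge> q\<close>) this is the commutation of \<open>h(x)\<close> and \<open>h(y)\<close>.
  With a bound, the first row is forced to lose \<open>q - m\<close> boxes in the first step, which
  contributes \<open>x^(q - m)\<close> on one side and \<open>y^(q - m)\<close> on the other.\<close>
lemma two_hsteps_swap:
  fixes x y :: "'a::comm_ring_1"
  assumes "xs \<in> boxed q (Suc (Suc (length zs)))" "hd0 xs = q"
  shows "y ^ (q - m) * two_hsteps x y m xs zs = x ^ (q - m) * two_hsteps y x m xs zs"
  using assms
proof (induction zs arbitrary: q m xs)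
  case Nil
  then obtain q' where xs: "xs = [q, q']" "q' \<le> q" by auto
  have hh_eq: "two_hsteps u v m xs [] = (u * v) ^ q' * (\<Sum>k\<in>{q'..min m q}. u ^ (q - k) * v ^ (k - q'))" for u v :: 'a
  proof -
    have "two_hsteps u v m xs [] = (\<Sum>k\<le>m. if q' \<le> k \<and> k \<le> q then u ^ (q - k) * u ^ q' * v ^ k else 0)"
      unfolding two_hsteps_def by (simp only: list.size sum_boxed_Suc) (auto simp: xs intro!: sum.cong)
    also have "\<dots> = (\<Sum>k\<in>{q'..min m q}. u ^ (q - k) * u ^ q' * v ^ k)"
      by (rule sum.mono_neutral_cong_right) auto
    also have "\<dots> = (\<Sum>k\<in>{q'..min m q}. (u * v) ^ q' * (u ^ (q - k) * v ^ (k - q')))"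
    proof (rule sum.cong[OF refl])
      fix k assume "k \<in> {q'..min m q}"
      then have "v ^ k = v ^ q' * v ^ (k - q')" by (simp add: power_add[symmetric])
      then show "u ^ (q - k) * u ^ q' * v ^ k = (u * v) ^ q' * (u ^ (q - k) * v ^ (k - q'))"
        by (simp add: power_mult_distrib mult_ac)
    qed
    finally show ?thesis by (simp add: sum_distrib_left)
  qed
  have "q - m = q - min m q" by simp
  then show ?case unfolding hh_eq using two_hsteps_swap_row[of "min m q" q y x q']
    by (simp add: mult_ac)
next
  case (Cons p zs)
  obtain xs' where xs: "xs = q # xs'" "xs' \<in> boxed q (Suc (Suc (length zs)))"
    using Cons.prems(1) unfolding length_Cons by (rule boxed_SucE) (use Cons.prems(2) in auto)
  define q' where "q' = hd0 xs'"
  have xs': "xs' \<in> boxed q' (Suc (Suc (length zs)))" using xs(2) boxed_hd0 q'_def by blast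
  have ne: "xs' \<noteq> []" using xs(2) by (rule boxed_Suc_neq_Nil)
  \<comment> \<open>the first row of the intermediate shape ranges over \<open>a..b\<close>, and \<open>a - p = q' - p\<close> is the exponent
    of the prefactor in the induction hypothesis\<close>
  define a where "a = max q' p"
  define b where "b = min m q"
  have hh_eq: "two_hsteps u v m xs (p # zs) = (\<Sum>k\<in>{a..b}. u ^ (q - k) * v ^ (k - a)) * (v ^ (q' - p) * two_hsteps u v p xs' zs)" for u v :: 'a
  proof -
    have "two_hsteps u v m xs (p # zs) = (\<Sum>k\<le>m. \<Sum>ys\<in>boxed k (Suc (length zs)). if hd0 ys \<le> p then
        (if q' \<le> k \<and> k \<le> q \<and> p \<le> k then u ^ (q - k) * v ^ (k - p) * (hstep u xs' ys * hstep v ys zs) else 0) else 0)"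
      unfolding two_hsteps_def length_Cons sum_boxed_Suc[of _ m]
      by (intro sum.cong refl, drule boxed_Suc_neq_Nil)
         (auto simp: xs(1) ne hstep_Cons q'_def mult_ac)
    also have "\<dots> = (\<Sum>k\<le>m. if q' \<le> k \<and> k \<le> q \<and> p \<le> k then u ^ (q - k) * v ^ (k - p) * two_hsteps u v p xs' zs else 0)"
      unfolding sum_boxed_if
      by (intro sum.cong refl) (auto simp: two_hsteps_def sum_distrib_left min_def simp del: boxed.simps)
    also have "\<dots> = (\<Sum>k\<in>{a..b}. u ^ (q - k) * v ^ (k - p) * two_hsteps u v p xs' zs)"
      by (rule sum.mono_neutral_cong_right) (auto simp: a_def b_def)
    also have "\<dots> = (\<Sum>k\<in>{a..b}. u ^ (q - k) * v ^ (k - a) * (v ^ (q' - p) * two_hsteps u v p xs' zs))"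
    proof (rule sum.cong[OF refl])
      fix k assume k: "k \<in> {a..b}"
      have "k - p = (k - a) + (q' - p)" using k unfolding a_def by auto
      then show "u ^ (q - k) * v ^ (k - p) * two_hsteps u v p xs' zs = u ^ (q - k) * v ^ (k - a) * (v ^ (q' - p) * two_hsteps u v p xs' zs)"
        by (simp add: power_add mult_ac)
    qed
    finally show ?thesis by (simp add: sum_distrib_right)
  qed
  have IH: "y ^ (q' - p) * two_hsteps x y p xs' zs = x ^ (q' - p) * two_hsteps y x p xs' zs"
    by (rule Cons.IH[OF xs']) (simp add: q'_def)
  have qm: "q - m = q - b" by (simp add: b_def)
  have row: "y ^ (q - b) * (\<Sum>k\<in>{a..b}. x ^ (q - k) * y ^ (k - a))
       = x ^ (q - b) * (\<Sum>k\<in>{a..b}. y ^ (q - k) * x ^ (k - a))"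
    by (rule two_hsteps_swap_row) (simp add: b_def)
  show ?case unfolding hh_eq IH qm mult.assoc[symmetric] row ..
qed

text \<open>The factor by which row \<open>i\<close> of \<open>\<alpha>\<close> contributes to \<open>L(x) \<lambda> \<alpha>\<close> through the choice of putting the
  largest letter into its last box as well, where \<open>m = \<alpha>\<^sub>i\<close>, \<open>p = \<alpha>\<^bsub>i+1\<^esub>\<close> and \<open>q = \<lambda>\<^bsub>i+1\<^esub>\<close>. The row ends in
  a corner iff \<open>p \<noteq> m\<close>. If the box below the corner belongs to \<open>\<lambda>\<close>, it holds the largest letter only,
  so the choice creates a vertical equality but no new column; otherwise it creates a new column.\<close>
definition corner :: "'a::comm_ring_1 \<Rightarrow> 'a \<Rightarrow> 'a \<Rightarrow> nat \<Rightarrow> nat \<Rightarrow> nat \<Rightarrow> 'a" where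
  "corner x t w m p q = (if p = m then 1 else if m \<le> q then 1 + w * t else 1 + w * x)"

text \<open>The symmetry in the form needed for the first row: the factor \<open>1 + w x\<close> produced by
  \<open>vstep_hstep_commute\<close> turns into the factor \<open>corner\<close>. For \<open>m \<le> q\<close> the terms with first row less than
  \<open>m\<close> form a sum bounded by \<open>m - 1\<close>, so \<open>two_hsteps_swap\<close> for the bounds \<open>m\<close> and \<open>m - 1\<close> applies; the extra \<open>x\<close>
  in \<open>w x\<close> makes up for the difference of the two exponents \<open>q - m\<close> and \<open>q - (m - 1)\<close>.\<close>
lemma two_hsteps_corner:
  fixes x t w :: "'a::comm_ring_1"
  assumes "xs \<in> boxed q (Suc (Suc (length zs)))" "hd0 xs = q"
  shows "x ^ (q - m) * (\<Sum>ys\<in>boxed m (Suc (length zs)).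
            (1 + (if hd0 ys < m then w * x else 0)) * (hstep t xs ys * hstep x ys zs))
       = t ^ (q - m) * (\<Sum>ys\<in>boxed m (Suc (length zs)).
            corner x t w m (hd0 ys) q * (hstep x xs ys * hstep t ys zs))"
proof (cases "m \<le> q")
  case False
  then have 1: "hstep u xs ys = 0" if "\<not> hd0 ys < m" for u :: 'a and ys
    using that assms by (simp add: hstep_eq_0)
  have "(\<Sum>ys\<in>boxed m (Suc (length zs)). (1 + (if hd0 ys < m then w * x else 0)) * (hstep t xs ys * hstep x ys zs))
     = (1 + w * x) * two_hsteps t x m xs zs"
    unfolding two_hsteps_def sum_distrib_left by (rule sum.cong) (auto simp: 1)
  moreover have "(\<Sum>ys\<in>boxed m (Suc (length zs)). corner x t w m (hd0 ys) q * (hstep x xs ys * hstep t ys zs))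
     = (1 + w * x) * two_hsteps x t m xs zs"
    unfolding two_hsteps_def sum_distrib_left by (rule sum.cong) (use False in \<open>auto simp: 1 corner_def\<close>)
  ultimately show ?thesis using two_hsteps_swap[OF assms, of x m t] False by simp
next
  case True
  define g where "g u v = (if m = 0 then 0 else w * v * two_hsteps u v (m - 1) xs zs)" for u v :: 'a
  have g: "(\<Sum>ys\<in>boxed m (Suc (length zs)). (if hd0 ys < m then w * v else 0) * (hstep u xs ys * hstep v ys zs)) = g u v"
    for u v :: 'a
  proof (cases m)
    case (Suc m')
    have "(\<Sum>ys\<in>boxed m (Suc (length zs)). (if hd0 ys < m then w * v else 0) * (hstep u xs ys * hstep v ys zs))
      = (\<Sum>ys\<in>boxed m (Suc (length zs)). if hd0 ys \<le> m' then w * v * (hstep u xs ys * hstep v ys zs) else 0)"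
      by (rule sum.cong) (auto simp: Suc)
    also have "\<dots> = w * v * two_hsteps u v m' xs zs"
      unfolding sum_boxed_if two_hsteps_def sum_distrib_left by (simp add: Suc min_def)
    finally show ?thesis by (simp add: g_def Suc)
  qed (simp add: g_def)
  have *: "(\<Sum>ys\<in>boxed m (Suc (length zs)). (1 + (if hd0 ys < m then w * v else 0)) * (hstep u xs ys * hstep v ys zs))
     = two_hsteps u v m xs zs + g u v" for u v :: 'a
    unfolding g[symmetric] two_hsteps_def by (simp add: distrib_right sum.distrib)
  have corner: "corner x t w m (hd0 ys) q = 1 + (if hd0 ys < m then w * t else 0)"
    if "ys \<in> boxed m (Suc (length zs))" for ys
    using hd0_boxed[OF that] True by (auto simp: corner_def)
  have c: "(\<Sum>ys\<in>boxed m (Suc (length zs)). corner x t w m (hd0 ys) q * (hstep x xs ys * hstep t ys zs))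
     = two_hsteps x t m xs zs + g x t"
    unfolding *[symmetric] by (rule sum.cong[OF refl]) (simp only: corner)
  have "x ^ (q - m) * g t x = t ^ (q - m) * g x t"
  proof (cases m)
    case (Suc m')
    have "q - m' = Suc (q - m)" using True Suc by auto
    then show ?thesis using two_hsteps_swap[OF assms, of x m' t]
      by (simp add: g_def Suc mult_ac)
  qed (simp add: g_def)
  then show ?thesis unfolding * c using two_hsteps_swap[OF assms, of x m t]
    by (simp add: distrib_left)
qed

text \<open>The last steps below the first row, \<open>h(t) v(w) h(x)\<close>, where the removal with weight \<open>x\<close> shortens the first
  row from \<open>a\<close> to \<open>m\<close> and thereby bounds the middle shape. Moving \<open>h(x)\<close> to the front by
  \<open>vstep_hstep_commute\<close> and \<open>two_hsteps_corner\<close> produces exactly the first-row factor of \<open>L(x)\<close>.\<close>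
lemma steps_below_first_row:
  fixes x t w :: "'a::comm_ring_1"
  assumes us: "us \<in> boxed a (Suc (Suc n))" "hd0 us = h" and zs: "zs \<in> boxed m n"
    and ma: "m \<le> a" and ha: "h \<le> a"
  shows "(\<Sum>ys\<in>boxed a (Suc n). (\<Sum>vs\<in>boxed a (Suc n). hstep t us vs * vstep w vs ys) * hstep x (a # ys) (m # zs))
    = x ^ (a - max m h) * (t ^ (h - m) * (\<Sum>ss\<in>boxed m n. vstep w ss zs * (\<Sum>vs\<in>boxed m (Suc n). corner x t w m (hd0 vs) h * (hstep x us vs * hstep t vs ss))))"
proof -
  let ?c = "\<lambda>vs. 1 + (if hd0 vs < m then w * x else 0)"
  have 1: "(\<Sum>ys\<in>boxed a (Suc n). vstep w vs ys * hstep x (a # ys) (m # zs))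
     = x ^ (a - m) * (\<Sum>ys\<in>boxed m (Suc n). vstep w vs ys * hstep x ys zs)" for vs
  proof -
    have "(\<Sum>ys\<in>boxed a (Suc n). vstep w vs ys * hstep x (a # ys) (m # zs))
      = (\<Sum>ys\<in>boxed a (Suc n). if hd0 ys \<le> m then x ^ (a - m) * (vstep w vs ys * hstep x ys zs) else 0)"
      by (rule sum.cong[OF refl], drule boxed_Suc_neq_Nil)
         (use ma in \<open>simp add: hstep_Cons mult_ac\<close>)
    also have "\<dots> = (\<Sum>ys\<in>boxed m (Suc n). x ^ (a - m) * (vstep w vs ys * hstep x ys zs))"
      unfolding sum_boxed_if using ma by (simp add: min_def)
    finally show ?thesis by (simp add: sum_distrib_left del: boxed.simps)
  qed
  have "(\<Sum>ys\<in>boxed a (Suc n). (\<Sum>vs\<in>boxed a (Suc n). hstep t us vs * vstep w vs ys) * hstep x (a # ys) (m # zs))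
    = (\<Sum>vs\<in>boxed a (Suc n). hstep t us vs * (\<Sum>ys\<in>boxed a (Suc n). vstep w vs ys * hstep x (a # ys) (m # zs)))"
    unfolding sum_distrib_right sum_distrib_left mult.assoc by (rule sum.swap)
  also have "\<dots> = x ^ (a - m) * (\<Sum>vs\<in>boxed a (Suc n). hstep t us vs *
       (\<Sum>ys\<in>boxed m (Suc n). vstep w vs ys * hstep x ys zs))"
    unfolding 1 by (simp add: sum_distrib_left mult_ac del: boxed.simps)
  also have "(\<Sum>vs\<in>boxed a (Suc n). hstep t us vs * (\<Sum>ys\<in>boxed m (Suc n). vstep w vs ys * hstep x ys zs))
    = (\<Sum>vs\<in>boxed m (Suc n). hstep t us vs * (\<Sum>ys\<in>boxed m (Suc n). vstep w vs ys * hstep x ys zs))"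
  proof (rule sum_boxed_shrink[OF _ ma])
    fix vs assume "m < hd0 vs"
    then have "(\<Sum>ys\<in>boxed m (Suc n). vstep w vs ys * hstep x ys zs) = 0"
      by (intro sum.neutral ballI, drule_tac hd0_boxed) (simp add: vstep_eq_0)
    then show "hstep t us vs * (\<Sum>ys\<in>boxed m (Suc n). vstep w vs ys * hstep x ys zs) = 0" by simp
  qed
  also have "\<dots> = (\<Sum>vs\<in>boxed m (Suc n). hstep t us vs * (?c vs * (\<Sum>ss\<in>boxed m n. hstep x vs ss * vstep w ss zs)))"
    by (rule sum.cong[OF refl]) (simp only: vstep_hstep_commute zs)
  also have "\<dots> = (\<Sum>ss\<in>boxed m n. vstep w ss zs * (\<Sum>vs\<in>boxed m (Suc n). ?c vs * (hstep t us vs * hstep x vs ss)))"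
    unfolding sum_distrib_left by (subst sum.swap) (simp only: mult_ac)
  also have "x ^ (a - m) * \<dots> = x ^ (a - max m h) * (\<Sum>ss\<in>boxed m n. vstep w ss zs * (x ^ (h - m) * (\<Sum>vs\<in>boxed m (Suc n). ?c vs * (hstep t us vs * hstep x vs ss))))"
  proof -
    have "a - m = (a - max m h) + (h - m)" using ma ha by auto
    then have "x ^ (a - m) = x ^ (a - max m h) * x ^ (h - m)" by (simp add: power_add)
    then show ?thesis by (simp add: sum_distrib_left mult_ac del: boxed.simps)
  qed
  also have "\<dots> = x ^ (a - max m h) * (\<Sum>ss\<in>boxed m n. vstep w ss zs * (t ^ (h - m) * (\<Sum>vs\<in>boxed m (Suc n). corner x t w m (hd0 vs) h * (hstep x us vs * hstep t vs ss))))"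
  proof -
    have ush: "us \<in> boxed h (Suc (Suc n))" using us boxed_hd0 by blast
    have "x ^ (h - m) * (\<Sum>vs\<in>boxed m (Suc n). ?c vs * (hstep t us vs * hstep x vs ss))
       = t ^ (h - m) * (\<Sum>vs\<in>boxed m (Suc n). corner x t w m (hd0 vs) h * (hstep x us vs * hstep t vs ss))"
      if ss: "ss \<in> boxed m n" for ss
      using two_hsteps_corner[of us h ss x m w t] ush us(2) length_boxed[OF ss] by metis
    then show ?thesis by simp
  qed
  also have "\<dots> = x ^ (a - max m h) * (t ^ (h - m) * (\<Sum>ss\<in>boxed m n. vstep w ss zs * (\<Sum>vs\<in>boxed m (Suc n). corner x t w m (hd0 vs) h * (hstep x us vs * hstep t vs ss))))"
    by (simp add: sum_distrib_left mult_ac del: boxed.simps)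
  finally show ?thesis .
qed

section \<open>The branching identity for oscillating sums\<close>

text \<open>The matrix \<open>K\<close>, by its recursion over the first row: an oscillating sequence starting at
  \<open>a # xs\<close> keeps the first row, and below it consists of an oscillating sequence starting at \<open>xs\<close>
  with shifted variables, one removal of a horizontal strip with weight \<open>t\<^sub>1\<close>, and one addition of a
  vertical strip with weight \<open>w\<^sub>1\<close>. That this agrees with the sum over oscillating sequences is
  \<open>sum_OS\<close>.\<close>
fun osc_sum :: "(nat \<Rightarrow> 'a::comm_ring_1) \<Rightarrow> (nat \<Rightarrow> 'a) \<Rightarrow> nat list \<Rightarrow> nat list \<Rightarrow> 'a" where
  "osc_sum t w [] ys = (if \<forall>y\<in>set ys. y = 0 then 1 else 0)"
| "osc_sum t w (a # xs) [] = (if \<forall>y\<in>set (a # xs). y = 0 then 1 else 0)"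
| "osc_sum t w (a # xs) (b # ys) = (if a = b then
     \<Sum>us\<in>boxed a (Suc (length ys)). \<Sum>vs\<in>boxed a (length ys).
       osc_sum (t \<circ> Suc) (w \<circ> Suc) xs us * hstep (t 1) us vs * vstep (w 1) vs ys else 0)"

text \<open>The matrix \<open>L(x)\<close> of the branching rule for hybrid Grothendieck polynomials, one factor per row.
  The boxes of \<open>\<lambda>/\<alpha>\<close> in a row with a further box of \<open>\<lambda>\<close> below them give a vertical equality, the others
  are the lowest boxes of their columns and count these columns.\<close>
fun branch_coeff :: "'a::comm_ring_1 \<Rightarrow> (nat \<Rightarrow> 'a) \<Rightarrow> (nat \<Rightarrow> 'a) \<Rightarrow> nat list \<Rightarrow> nat list \<Rightarrow> 'a" where
  "branch_coeff x t w (a # xs) (m # ys) = (if m \<le> a then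
      x ^ (a - max m (hd0 xs)) * t 1 ^ (hd0 xs - m) * corner x (t 1) (w 1) m (hd0 ys) (hd0 xs)
        * branch_coeff x (t \<circ> Suc) (w \<circ> Suc) xs ys else 0)"
| "branch_coeff x t w _ _ = 1"

lemma osc_sum_eq_0: "ys \<noteq> [] \<Longrightarrow> hd0 ys \<noteq> hd0 xs \<Longrightarrow> osc_sum t w xs ys = 0"
  by (cases xs; cases ys) auto

lemma hstep_zero: "hstep x (replicate (Suc n) 0) ys = (if ys = replicate n 0 then 1 else 0)"
proof (induction n arbitrary: ys)
  case 0 then show ?case by (cases ys) auto
next
  case (Suc n) then show ?case by (cases ys) auto
qed

lemma zero_boxed: "replicate n 0 \<in> boxed q n"
  by (induction n arbitrary: q) auto

text \<open>For the empty shape the column-counting variable only occurs as \<open>x\<close> to the number of columns.\<close>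
lemma branch_coeff_zero: "branch_coeff y t w xs (replicate (length xs) 0) * x ^ hd0 xs = branch_coeff x t w xs (replicate (length xs) 0) * y ^ hd0 xs"
  if "xs \<in> boxed q n"
  using that
proof (induction xs arbitrary: t w q n)
  case (Cons a xs)
  then obtain n' where n: "n = Suc n'" by (cases n) auto
  have xs: "xs \<in> boxed a n'" using Cons.prems n by auto
  define h where "h = hd0 xs"
  have h: "h \<le> a" unfolding h_def using xs by (rule hd0_boxed)
  have c: "corner z (t 1) (w 1) 0 (hd0 (replicate (length xs) 0)) h = 1" for z :: 'a
    by (cases xs) (simp_all add: corner_def)
  have L: "branch_coeff z t w (a # xs) (replicate (length (a # xs)) 0)
     = z ^ (a - h) * t 1 ^ h * branch_coeff z (t \<circ> Suc) (w \<circ> Suc) xs (replicate (length xs) 0)" for z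
    using c[of z] by (simp add: h_def)
  have IH: "branch_coeff y (t \<circ> Suc) (w \<circ> Suc) xs (replicate (length xs) 0) * x ^ h
      = branch_coeff x (t \<circ> Suc) (w \<circ> Suc) xs (replicate (length xs) 0) * y ^ h"
    unfolding h_def using xs by (rule Cons.IH)
  have p: "z ^ a = z ^ (a - h) * z ^ h" for z :: 'a using h by (simp add: power_add[symmetric])
  have "branch_coeff y t w (a # xs) (replicate (length (a # xs)) 0) * x ^ a
     = y ^ (a - h) * t 1 ^ h * x ^ (a - h) * (branch_coeff y (t \<circ> Suc) (w \<circ> Suc) xs (replicate (length xs) 0) * x ^ h)"
    unfolding L p[of x] by (simp add: mult_ac)
  also have "\<dots> = branch_coeff x t w (a # xs) (replicate (length (a # xs)) 0) * y ^ a"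
    unfolding L p[of y] IH by (simp add: mult_ac)
  finally show ?case by simp
qed simp

lemma all_zero_boxed_iff: "ys \<in> boxed d n \<Longrightarrow> (\<forall>y\<in>set ys. y = 0) \<longleftrightarrow> ys = replicate n 0"
  using length_boxed[of ys d n] by (metis in_set_replicate replicate_eqI)

lemma all_zero_iff: "(\<forall>y\<in>set ys. y = 0) \<longleftrightarrow> ys = replicate (length ys) 0"
  by (metis in_set_replicate replicate_eqI)

lemma osc_sum_Nil_right: "osc_sum t w xs [] = (if xs = replicate (length xs) 0 then 1 else 0)"
  by (cases xs) (auto simp: all_zero_iff)

lemma sum_swap_outer:
  "(\<Sum>a\<in>A. \<Sum>b\<in>B. \<Sum>c\<in>C. f a b c) = (\<Sum>c\<in>C. \<Sum>b\<in>B. \<Sum>a\<in>A. f a b c)"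
proof -
  have "(\<Sum>a\<in>A. \<Sum>b\<in>B. \<Sum>c\<in>C. f a b c) = (\<Sum>a\<in>A. \<Sum>c\<in>C. \<Sum>b\<in>B. f a b c)"
    by (intro sum.cong refl sum.swap)
  also have "\<dots> = (\<Sum>c\<in>C. \<Sum>a\<in>A. \<Sum>b\<in>B. f a b c)" by (rule sum.swap)
  also have "\<dots> = (\<Sum>c\<in>C. \<Sum>b\<in>B. \<Sum>a\<in>A. f a b c)"
    by (intro sum.cong refl sum.swap)
  finally show ?thesis .
qed

text \<open>The identity \<open>K h(x) = L(x) K\<close>. By \<open>steps_below_first_row\<close> the matrix \<open>h(x)\<close> moves in front of the
  last two steps below the first row, and the induction hypothesis moves it in front of all the
  others. The first-row factor then refers to the first row of the shape reached by the lower part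
  of the sequence; as \<open>K\<close> preserves first rows, this is the first row of its starting point, as \<open>L(x)\<close>
  requires.\<close>
lemma osc_sum_branching:
  fixes x :: "'a::comm_ring_1"
  assumes "xs \<in> boxed q l" "zs \<in> boxed p n" "hd0 xs \<le> c" "hd0 zs \<le> d"
  shows "(\<Sum>ys\<in>boxed c (Suc n). osc_sum t w xs ys * hstep x ys zs) = (\<Sum>us\<in>boxed d l. branch_coeff x t w xs us * osc_sum t w us zs)"
  using assms
proof (induction l arbitrary: x t w xs zs q p n c d)
  case 0
  then have xs: "xs = []" by simp
  have "(\<Sum>ys\<in>boxed c (Suc n). osc_sum t w xs ys * hstep x ys zs)
      = (\<Sum>ys\<in>boxed c (Suc n). if ys = replicate (Suc n) 0 then hstep x ys zs else 0)"
    by (rule sum.cong[OF refl]) (simp add: xs all_zero_boxed_iff del: boxed.simps replicate.simps)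
  also have "\<dots> = (if zs = replicate n 0 then 1 else 0)"
    using zero_boxed[of "Suc n" c] by (simp add: hstep_zero del: boxed.simps replicate.simps)
  finally show ?case using 0 all_zero_boxed_iff[of zs p n] by (simp add: xs)
next
  case (Suc l)
  obtain a xs' where xs: "xs = a # xs'" "xs' \<in> boxed a l"
    using Suc.prems(1) by (rule boxed_SucE)
  define h where "h = hd0 xs'"
  have h: "h \<le> a" unfolding h_def using xs(2) by (rule hd0_boxed)
  have ac: "a \<le> c" using Suc.prems xs by simp
  let ?t = "t \<circ> Suc" and ?w = "w \<circ> Suc"
  let ?K = "osc_sum ?t ?w" and ?L = "branch_coeff x ?t ?w" and ?v = "vstep (w 1)" and ?h = "hstep (t 1)"
  \<comment> \<open>an oscillating sequence never changes the first row, so only the lists starting with \<open>a\<close> remain\<close>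
  have lhs: "(\<Sum>ys\<in>boxed c (Suc n). osc_sum t w xs ys * hstep x ys zs)
     = (\<Sum>ys\<in>boxed a n. osc_sum t w xs (a # ys) * hstep x (a # ys) zs)"
  proof -
    have "(\<Sum>ys\<in>boxed c (Suc n). osc_sum t w xs ys * hstep x ys zs)
       = (\<Sum>b\<le>c. if b = a then \<Sum>ys\<in>boxed b n. osc_sum t w xs (b # ys) * hstep x (b # ys) zs else 0)"
      unfolding sum_boxed_Suc by (rule sum.cong[OF refl]) (auto simp: xs)
    then show ?thesis using ac by simp
  qed
  show ?case
  proof (cases n)
    case 0
    then have zs: "zs = []" using Suc.prems by simp
    have "(\<Sum>ys\<in>boxed c (Suc n). osc_sum t w xs ys * hstep x ys zs)
       = x ^ a * (\<Sum>us\<in>boxed a (Suc 0). ?K xs' us * ?h us [])"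
      unfolding lhs by (simp add: 0 zs xs mult.commute del: boxed.simps) simp
    also have "(\<Sum>us\<in>boxed a (Suc 0). ?K xs' us * ?h us [])
       = (\<Sum>us\<in>boxed d l. branch_coeff (t 1) ?t ?w xs' us * ?K us [])"
      by (rule Suc.IH[OF xs(2)]) (use h h_def in auto)
    also have "\<dots> = (\<Sum>us\<in>boxed d l. if us = replicate l 0 then branch_coeff (t 1) ?t ?w xs' us else 0)"
      by (rule sum.cong[OF refl]) (simp add: osc_sum_Nil_right length_boxed)
    also have "\<dots> = branch_coeff (t 1) ?t ?w xs' (replicate l 0)"
      by (simp add: zero_boxed)
    \<comment> \<open>the induction hypothesis was used at \<open>t 1\<close> in place of \<open>x\<close>, which \<open>branch_coeff_zero\<close> corrects\<close>
    also have "x ^ a * \<dots> = x ^ (a - h) * (branch_coeff (t 1) ?t ?w xs' (replicate l 0) * x ^ h)"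
    proof -
      have "x ^ a = x ^ (a - h) * x ^ h" using h by (simp add: power_add[symmetric])
      then show ?thesis by (simp only: mult_ac)
    qed
    also have "branch_coeff (t 1) ?t ?w xs' (replicate l 0) * x ^ h = ?L xs' (replicate l 0) * t 1 ^ h"
      using branch_coeff_zero[OF xs(2)] length_boxed[OF xs(2)] unfolding h_def by metis
    also have "x ^ (a - h) * \<dots> = branch_coeff x t w xs (replicate (Suc l) 0)"
    proof -
      have "hd0 (replicate l 0) = 0" by (cases l) auto
      then show ?thesis by (simp add: xs h_def corner_def mult_ac)
    qed
    also have "\<dots> = (\<Sum>us\<in>boxed d (Suc l). if us = replicate (Suc l) 0 then branch_coeff x t w xs us else 0)"
      using zero_boxed[of "Suc l" d] by (simp del: boxed.simps replicate.simps)
    also have "\<dots> = (\<Sum>us\<in>boxed d (Suc l). branch_coeff x t w xs us * osc_sum t w us zs)"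
    proof (rule sum.cong[OF refl])
      fix us assume "us \<in> boxed d (Suc l)"
      then show "(if us = replicate (Suc l) 0 then branch_coeff x t w xs us else 0) = branch_coeff x t w xs us * osc_sum t w us zs"
        by (simp add: zs osc_sum_Nil_right length_boxed[of us d "Suc l"] del: boxed.simps replicate.simps)
    qed
    finally show ?thesis .
  next
    case n: (Suc n')
    obtain m zs' where zs: "zs = m # zs'" "zs' \<in> boxed m n'"
      using Suc.prems(2) unfolding n by (rule boxed_SucE)
    have md: "m \<le> d" using Suc.prems zs by simp
    have len: "length zs' = n'" using zs(2) by (rule length_boxed)
    have rhs: "(\<Sum>us\<in>boxed d (Suc l). branch_coeff x t w xs us * osc_sum t w us zs)
     = (\<Sum>us\<in>boxed m l. branch_coeff x t w xs (m # us) * osc_sum t w (m # us) zs)"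
    proof -
      have "(\<Sum>us\<in>boxed d (Suc l). branch_coeff x t w xs us * osc_sum t w us zs)
         = (\<Sum>b\<le>d. if b = m then \<Sum>us\<in>boxed b l. branch_coeff x t w xs (b # us) * osc_sum t w (b # us) zs else 0)"
        unfolding sum_boxed_Suc by (rule sum.cong[OF refl]) (auto simp: zs)
      then show ?thesis using md by simp
    qed
    show ?thesis
    proof (cases "m \<le> a")
      case False
      then have "(\<Sum>ys\<in>boxed a n. osc_sum t w xs (a # ys) * hstep x (a # ys) zs) = 0"
        by (intro sum.neutral ballI) (simp add: zs hstep_eq_0)
      moreover have "(\<Sum>us\<in>boxed m l. branch_coeff x t w xs (m # us) * osc_sum t w (m # us) zs) = 0"
        using False by (intro sum.neutral ballI) (simp add: xs)
      ultimately show ?thesis unfolding lhs rhs by simp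
    next
      case True
      let ?M = "x ^ (a - max m h)"
      let ?S = "\<lambda>us. \<Sum>ss\<in>boxed m n'. ?v ss zs' *
             (\<Sum>vs\<in>boxed m (Suc n'). corner x (t 1) (w 1) m (hd0 vs) h * (hstep x us vs * ?h vs ss))"
      have step: "(\<Sum>ys\<in>boxed a (Suc n'). (\<Sum>vs\<in>boxed a (Suc n'). ?h us vs * ?v vs ys) * hstep x (a # ys) zs)
          = ?M * (t 1 ^ (h - m) * ?S us)"
        if us: "us \<in> boxed a (Suc (Suc n'))" "hd0 us = h" for us
        unfolding zs(1) by (rule steps_below_first_row[OF us zs(2) True h])
      have "(\<Sum>ys\<in>boxed c (Suc n). osc_sum t w xs ys * hstep x ys zs)
        = (\<Sum>us\<in>boxed a (Suc (Suc n')). ?K xs' us * (\<Sum>ys\<in>boxed a (Suc n').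
             (\<Sum>vs\<in>boxed a (Suc n'). ?h us vs * ?v vs ys) * hstep x (a # ys) zs))"
      proof -
        have "osc_sum t w xs (a # ys) = (\<Sum>us\<in>boxed a (Suc (Suc n')). ?K xs' us * (\<Sum>vs\<in>boxed a (Suc n'). ?h us vs * ?v vs ys))"
          if "ys \<in> boxed a (Suc n')" for ys
          using length_boxed[OF that] by (simp add: xs sum_distrib_left mult.assoc del: boxed.simps)
        then have "(\<Sum>ys\<in>boxed c (Suc n). osc_sum t w xs ys * hstep x ys zs) = (\<Sum>ys\<in>boxed a (Suc n').
            (\<Sum>us\<in>boxed a (Suc (Suc n')). ?K xs' us * (\<Sum>vs\<in>boxed a (Suc n'). ?h us vs * ?v vs ys)) * hstep x (a # ys) zs)"
          unfolding lhs unfolding n by (simp del: boxed.simps cong: sum.cong)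
        also have "\<dots> = (\<Sum>us\<in>boxed a (Suc (Suc n')). ?K xs' us * (\<Sum>ys\<in>boxed a (Suc n').
             (\<Sum>vs\<in>boxed a (Suc n'). ?h us vs * ?v vs ys) * hstep x (a # ys) zs))"
          unfolding sum_distrib_right[where r = "hstep x (a # _) zs"] sum_distrib_left[of "osc_sum _ _ _ _"]
          by (subst sum.swap) (simp add: sum_distrib_left sum_distrib_right mult_ac del: boxed.simps)
        finally show ?thesis .
      qed
      also have "\<dots> = (\<Sum>us\<in>boxed a (Suc (Suc n')). ?K xs' us * (?M * (t 1 ^ (h - m) * ?S us)))"
      proof (rule sum.cong[OF refl])
        fix us assume us: "us \<in> boxed a (Suc (Suc n'))"
        show "?K xs' us * (\<Sum>ys\<in>boxed a (Suc n').
             (\<Sum>vs\<in>boxed a (Suc n'). ?h us vs * ?v vs ys) * hstep x (a # ys) zs)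
           = ?K xs' us * (?M * (t 1 ^ (h - m) * ?S us))"
        proof (cases "hd0 us = h")
          case True
          then show ?thesis by (simp only: step[OF us])
        next
          case False
          then have "?K xs' us = 0"
            using boxed_Suc_neq_Nil[OF us] osc_sum_eq_0 h_def by blast
          then show ?thesis by simp
        qed
      qed
      also have "\<dots> = (\<Sum>vs\<in>boxed m (Suc n'). \<Sum>ss\<in>boxed m n'. ?M * t 1 ^ (h - m) * corner x (t 1) (w 1) m (hd0 vs) h * ?h vs ss * ?v ss zs' *
             (\<Sum>us\<in>boxed a (Suc (Suc n')). ?K xs' us * hstep x us vs))"
        unfolding sum_distrib_left
        by (rule trans[OF sum_swap_outer], intro sum.cong refl) (simp only: mult_ac)
      also have "\<dots> = (\<Sum>vs\<in>boxed m (Suc n'). \<Sum>ss\<in>boxed m n'. ?M * t 1 ^ (h - m) * corner x (t 1) (w 1) m (hd0 vs) h * ?h vs ss * ?v ss zs' *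
             (\<Sum>us\<in>boxed m l. ?L xs' us * ?K us vs))"
      proof (rule sum.cong[OF refl], rule sum.cong[OF refl], rule arg_cong2[where f = times, OF refl])
        fix vs assume vs: "vs \<in> boxed m (Suc n')"
        show "(\<Sum>us\<in>boxed a (Suc (Suc n')). ?K xs' us * hstep x us vs) = (\<Sum>us\<in>boxed m l. ?L xs' us * ?K us vs)"
          by (rule Suc.IH[OF xs(2) vs]) (use h h_def hd0_boxed[OF vs] in auto)
      qed
      also have "\<dots> = (\<Sum>us\<in>boxed m l. \<Sum>vs\<in>boxed m (Suc n'). \<Sum>ss\<in>boxed m n'.
              ?M * t 1 ^ (h - m) * corner x (t 1) (w 1) m (hd0 vs) h * ?L xs' us *
              (?K us vs * ?h vs ss * ?v ss zs'))"
        unfolding sum_distrib_left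
        by (rule trans[OF _ sum.swap], rule sum.cong[OF refl], rule trans[OF sum.swap],
            intro sum.cong refl) (simp only: mult_ac)
      also have "\<dots> = (\<Sum>us\<in>boxed m l. \<Sum>vs\<in>boxed m (Suc n'). \<Sum>ss\<in>boxed m n'.
              ?M * t 1 ^ (h - m) * corner x (t 1) (w 1) m (hd0 us) h * ?L xs' us *
              (?K us vs * ?h vs ss * ?v ss zs'))"
      proof (intro sum.cong refl)
        fix us vs ss assume vs: "vs \<in> boxed m (Suc n')"
        show "?M * t 1 ^ (h - m) * corner x (t 1) (w 1) m (hd0 vs) h * ?L xs' us *
              (?K us vs * ?h vs ss * ?v ss zs')
           = ?M * t 1 ^ (h - m) * corner x (t 1) (w 1) m (hd0 us) h * ?L xs' us *
              (?K us vs * ?h vs ss * ?v ss zs')"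
          using osc_sum_eq_0[OF boxed_Suc_neq_Nil[OF vs], of us ?t ?w] by (cases "hd0 vs = hd0 us") auto
      qed
      also have "\<dots> = (\<Sum>us\<in>boxed m l. branch_coeff x t w xs (m # us) * osc_sum t w (m # us) zs)"
        by (intro sum.cong refl) (simp add: xs zs len True h_def sum_distrib_left del: boxed.simps)
      finally show ?thesis unfolding rhs .
    qed
  qed
qed

section \<open>Partitions and their rows\<close>

text \<open>Translates between partitions, whose rows are numbered from 1, and padded lists.\<close>
definition rows :: "(nat \<Rightarrow> nat) \<Rightarrow> nat \<Rightarrow> nat list" where
  "rows f n = map f [1..<Suc n]"

lemma rows_0 [simp]: "rows f 0 = []"
  by (simp add: rows_def)

lemma rows_Suc: "rows f (Suc n) = f 1 # rows (\<lambda>i. f (Suc i)) n"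
  by (simp add: rows_def upt_conv_Cons map_Suc_upt[symmetric] comp_def del: upt_Suc)

lemma length_rows [simp]: "length (rows f n) = n"
  by (simp add: rows_def)

lemma rows_cong: "(\<And>i. 1 \<le> i \<Longrightarrow> i \<le> n \<Longrightarrow> f i = g i) \<Longrightarrow> rows f n = rows g n"
  by (auto simp: rows_def simp del: upt_Suc)

lemma rows_eqD: "rows f n = rows g n \<Longrightarrow> 1 \<le> i \<Longrightarrow> i \<le> n \<Longrightarrow> f i = g i"
  unfolding rows_def by (auto simp del: upt_Suc)

lemma part_0 [simp]: "part lam 0 = 0"
  using part[of lam] by simp

lemma part_Suc_le: "1 \<le> i \<Longrightarrow> part lam (Suc i) \<le> part lam i"
  using part[of lam] by simp

lemma finite_part: "finite {i. part lam i \<noteq> 0}"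
  using part[of lam] by simp

lemma part_antimono: "1 \<le> i \<Longrightarrow> i \<le> j \<Longrightarrow> part lam j \<le> part lam i"
  by (induction j) (auto simp: le_Suc_eq intro: le_trans[OF part_Suc_le])

lemma part_eqI: "(\<And>i. 1 \<le> i \<Longrightarrow> part lam i = part mu i) \<Longrightarrow> lam = mu"
  by (subst part_inject[symmetric], rule ext) (metis One_nat_def Suc_leI neq0_conv part_0)

lemma part_Abs:
  assumes "f 0 = 0" "\<And>i. 1 \<le> i \<Longrightarrow> f (Suc i) \<le> f i" "finite {i. f i \<noteq> 0}"
  shows "part (Abs_integer_partition f) = f"
  by (rule Abs_integer_partition_inverse) (use assms in auto)

definition rest :: "integer_partition \<Rightarrow> integer_partition" where
  "rest lam = Abs_integer_partition (\<lambda>i. if i = 0 then 0 else part lam (Suc i))"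

definition row_cons :: "nat \<Rightarrow> integer_partition \<Rightarrow> integer_partition" where
  "row_cons m lam = Abs_integer_partition (\<lambda>i. if i = 0 then 0 else if i = 1 then m else part lam (i - 1))"

lemma part_rest: "1 \<le> i \<Longrightarrow> part (rest lam) i = part lam (Suc i)"
proof -
  have "finite {i. (if i = 0 then 0 else part lam (Suc i)) \<noteq> 0}"
    by (rule finite_subset[OF _ finite_vimageI[OF finite_part[of lam], of Suc]]) auto
  then have "part (rest lam) = (\<lambda>i. if i = 0 then 0 else part lam (Suc i))"
    unfolding rest_def by (intro part_Abs) (auto simp: part_Suc_le)
  then show "1 \<le> i \<Longrightarrow> part (rest lam) i = part lam (Suc i)" by simp
qed

lemma part_row_cons:
  assumes "part lam 1 \<le> m"
  shows "part (row_cons m lam) i = (if i = 0 then 0 else if i = 1 then m else part lam (i - 1))"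
proof -
  let ?f = "\<lambda>i. if i = 0 then 0 else if i = 1 then m else part lam (i - 1)"
  have "{i. ?f i \<noteq> 0} \<subseteq> insert 1 (Suc ` {i. part lam i \<noteq> 0})"
  proof
    fix i assume "i \<in> {i. ?f i \<noteq> 0}"
    then show "i \<in> insert 1 (Suc ` {i. part lam i \<noteq> 0})"
      by (cases i) (auto split: if_splits)
  qed
  then have "finite {i. ?f i \<noteq> 0}"
    by (rule finite_subset) (intro finite.insertI finite_imageI finite_part)
  moreover have "?f (Suc i) \<le> ?f i" if "1 \<le> i" for i
    using that assms part_Suc_le[of "i - 1" lam] by auto
  ultimately have "part (row_cons m lam) = ?f"
    unfolding row_cons_def by (intro part_Abs) auto
  then show ?thesis by simp
qed

lemma rest_row_cons: "part lam 1 \<le> m \<Longrightarrow> rest (row_cons m lam) = lam"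
  by (rule part_eqI) (simp add: part_rest part_row_cons)

lemma row_cons_rest: "part lam 1 = m \<Longrightarrow> row_cons m (rest lam) = lam"
  by (rule part_eqI) (use part_Suc_le[of 1 lam] in \<open>auto simp: part_rest part_row_cons\<close>)

lemma part_rest_1_le: "part (rest lam) 1 \<le> part lam 1"
  using part_Suc_le[of 1 lam] by (simp add: part_rest)

lemma rows_part_Suc: "rows (part lam) (Suc n) = part lam 1 # rows (part (rest lam)) n"
  unfolding rows_Suc by (simp add: part_rest cong: rows_cong)

text \<open>The partitions whose lists of \<open>n\<close> rows make up \<open>boxed q n\<close>.\<close>
definition in_box :: "nat \<Rightarrow> nat \<Rightarrow> integer_partition set" where
  "in_box q n = {lam. part lam 1 \<le> q \<and> (\<forall>i>n. part lam i = 0)}"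

lemma rest_in_box: "lam \<in> in_box q (Suc n) \<Longrightarrow> rest lam \<in> in_box (part lam 1) n"
  using part_Suc_le[of 1 lam] by (auto simp: in_box_def part_rest)

lemma row_cons_in_box: "lam \<in> in_box m n \<Longrightarrow> m \<le> q \<Longrightarrow> row_cons m lam \<in> in_box q (Suc n)"
  by (auto simp: in_box_def part_row_cons)

lemma rows_in_boxed: "lam \<in> in_box q n \<Longrightarrow> rows (part lam) n \<in> boxed q n"
proof (induction n arbitrary: lam q)
  case (Suc n)
  then have "rows (part (rest lam)) n \<in> boxed (part lam 1) n" "part lam 1 \<le> q"
    using rest_in_box by (auto simp: in_box_def)
  then show ?case by (auto simp: rows_part_Suc)
qed simp

lemma rows_surj: "xs \<in> boxed q n \<Longrightarrow> \<exists>lam\<in>in_box q n. rows (part lam) n = xs"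
proof (induction n arbitrary: xs q)
  case 0
  have "part (Abs_integer_partition (\<lambda>_. 0)) = (\<lambda>_. 0)" by (rule part_Abs) auto
  then show ?case using 0 by (intro bexI[of _ "Abs_integer_partition (\<lambda>_. 0)"]) (auto simp: in_box_def)
next
  case (Suc n)
  obtain a ys where xs: "xs = a # ys" "a \<le> q" "ys \<in> boxed a n"
    using Suc.prems by (rule boxed_SucE)
  from Suc.IH[OF xs(3)] obtain lam where lam: "lam \<in> in_box a n" "rows (part lam) n = ys" by blast
  have "part lam 1 \<le> a" using lam by (simp add: in_box_def)
  then have "rows (part (row_cons a lam)) (Suc n) = xs"
    unfolding rows_part_Suc using lam by (simp add: rest_row_cons part_row_cons xs)
  then show ?case using row_cons_in_box[OF lam(1) xs(2)] by blast
qed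

lemma rows_inj: "inj_on (\<lambda>lam. rows (part lam) n) (in_box q n)"
proof (rule inj_onI)
  fix lam mu assume *: "lam \<in> in_box q n" "mu \<in> in_box q n" "rows (part lam) n = rows (part mu) n"
  show "lam = mu"
  proof (rule part_eqI)
    fix i :: nat assume "1 \<le> i"
    then show "part lam i = part mu i"
      using rows_eqD[OF *(3), of i] *(1,2) by (cases "i \<le> n") (auto simp: in_box_def)
  qed
qed

lemma bij_rows: "bij_betw (\<lambda>lam. rows (part lam) n) (in_box q n) (boxed q n)"
  unfolding bij_betw_def
proof (intro conjI equalityI subsetI)
  fix xs assume "xs \<in> boxed q n"
  then show "xs \<in> (\<lambda>lam. rows (part lam) n) ` in_box q n" using rows_surj by blast
qed (auto simp: rows_inj rows_in_boxed)

lemma finite_in_box [simp]: "finite (in_box q n)"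
  using bij_betw_finite[OF bij_rows] by simp

lemma sum_in_box: "(\<Sum>lam\<in>in_box q n. f (rows (part lam) n)) = (\<Sum>xs\<in>boxed q n. f xs)"
  by (rule sum.reindex_bij_betw[OF bij_rows])

lemma skew_iff: "(i, j) \<in> skew lam mu \<longleftrightarrow> 1 \<le> i \<and> part mu i < j \<and> j \<le> part lam i"
  by (auto simp: skew_def diagram_def)

lemma card_skew:
  assumes "\<forall>i>n. part lam i = 0"
  shows "card (skew lam mu) = (\<Sum>i=1..n. part lam i - part mu i)"
proof -
  have "skew lam mu = (SIGMA i:{1..n}. {part mu i<..part lam i})"
  proof (intro equalityI subsetI)
    fix b assume "b \<in> skew lam mu"
    then obtain i j where b: "b = (i, j)" "1 \<le> i" "part mu i < j" "j \<le> part lam i"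
      by (cases b) (auto simp: skew_iff)
    then have "i \<le> n" using assms by (metis leI less_zeroE order.strict_trans2)
    then show "b \<in> (SIGMA i:{1..n}. {part mu i<..part lam i})" using b by auto
  qed (auto simp: skew_iff)
  then show ?thesis by simp
qed

text \<open>A skew shape is a horizontal strip iff the two partitions interlace. In particular \<open>falling_pair 0\<close>
  is the bare condition of removing a horizontal strip, since row 0 is always 0.\<close>
lemma falling_pair_iff:
  "falling_pair k lam mu \<longleftrightarrow>
     (\<forall>i\<ge>1. part mu i \<le> part lam i \<and> part lam (Suc i) \<le> part mu i) \<and> (\<forall>i\<le>k. part lam i = part mu i)"
proof -
  have "horizontal_strip (skew lam mu) \<longleftrightarrow> (\<forall>i\<ge>1. part lam (Suc i) \<le> part mu i)"
    if c: "\<forall>i. part mu i \<le> part lam i"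
  proof
    assume h: "horizontal_strip (skew lam mu)"
    show "\<forall>i\<ge>1. part lam (Suc i) \<le> part mu i"
    proof (intro allI impI, rule ccontr)
      fix i :: nat assume i: "1 \<le> i" "\<not> part lam (Suc i) \<le> part mu i"
      then have "(i, Suc (part mu i)) \<in> skew lam mu" "(Suc i, Suc (part mu i)) \<in> skew lam mu"
        using part_Suc_le[of i lam] part_Suc_le[of i mu] by (auto simp: skew_iff)
      then show False using h unfolding horizontal_strip_def by (metis n_not_Suc_n)
    qed
  next
    assume h: "\<forall>i\<ge>1. part lam (Suc i) \<le> part mu i"
    have False if "(i, j) \<in> skew lam mu" "(i', j) \<in> skew lam mu" "i < i'" for i i' j
    proof -
      have "part lam i' \<le> part lam (Suc i)" using that by (intro part_antimono) auto
      then show False using that h by (fastforce simp: skew_iff)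
    qed
    then show "horizontal_strip (skew lam mu)"
      unfolding horizontal_strip_def by (metis linorder_neqE_nat)
  qed
  moreover have "(\<forall>i. part mu i \<le> part lam i) \<longleftrightarrow> (\<forall>i\<ge>1. part mu i \<le> part lam i)"
    by (metis One_nat_def Suc_leI le0 neq0_conv part_0)
  ultimately show ?thesis unfolding falling_pair_def contained_def by blast
qed

lemma rising_pair_iff:
  "rising_pair k lam mu \<longleftrightarrow>
     (\<forall>i\<ge>1. part lam i \<le> part mu i \<and> part mu i \<le> Suc (part lam i)) \<and> (\<forall>i\<le>k. part lam i = part mu i)"
proof -
  have "vertical_strip (skew mu lam) \<longleftrightarrow> (\<forall>i\<ge>1. part mu i \<le> Suc (part lam i))"
    if c: "\<forall>i. part lam i \<le> part mu i"
  proof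
    assume h: "vertical_strip (skew mu lam)"
    show "\<forall>i\<ge>1. part mu i \<le> Suc (part lam i)"
    proof (intro allI impI, rule ccontr)
      fix i :: nat assume i: "1 \<le> i" "\<not> part mu i \<le> Suc (part lam i)"
      then have "(i, Suc (part lam i)) \<in> skew mu lam" "(i, Suc (Suc (part lam i))) \<in> skew mu lam"
        by (auto simp: skew_iff)
      then show False using h unfolding vertical_strip_def by (metis n_not_Suc_n)
    qed
  next
    assume h: "\<forall>i\<ge>1. part mu i \<le> Suc (part lam i)"
    have "j = Suc (part lam i)" if "(i, j) \<in> skew mu lam" for i j
    proof -
      have "1 \<le> i" "part lam i < j" "j \<le> part mu i" using that by (auto simp: skew_iff)
      moreover from this h have "part mu i \<le> Suc (part lam i)" by blast
      ultimately show ?thesis by linarith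
    qed
    then show "vertical_strip (skew mu lam)"
      unfolding vertical_strip_def by blast
  qed
  moreover have "(\<forall>i. part lam i \<le> part mu i) \<longleftrightarrow> (\<forall>i\<ge>1. part lam i \<le> part mu i)"
    by (metis One_nat_def Suc_leI le0 neq0_conv part_0)
  ultimately show ?thesis unfolding rising_pair_def contained_def by blast
qed

lemma all_ge1_split: "(\<forall>i\<ge>1. P i) \<longleftrightarrow> P 1 \<and> (\<forall>i\<ge>1. P (Suc i))"
  by (metis One_nat_def Suc_le_mono le0 not0_implies_Suc not_one_le_zero order_refl)

lemma all_le_Suc_split: "(\<forall>i\<le>Suc k. P i) \<longleftrightarrow> P 0 \<and> P 1 \<and> (\<forall>i\<le>k. 1 \<le> i \<longrightarrow> P (Suc i))"
proof
  assume "\<forall>i\<le>Suc k. P i"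
  then show "P 0 \<and> P 1 \<and> (\<forall>i\<le>k. 1 \<le> i \<longrightarrow> P (Suc i))" by simp
next
  assume *: "P 0 \<and> P 1 \<and> (\<forall>i\<le>k. 1 \<le> i \<longrightarrow> P (Suc i))"
  have "P i" if "i \<le> Suc k" for i
  proof -
    have "i = 0 \<or> i = 1 \<or> (i = Suc (i - 1) \<and> 1 \<le> i - 1 \<and> i - 1 \<le> k)"
      using that by linarith
    then show ?thesis using * by metis
  qed
  then show "\<forall>i\<le>Suc k. P i" by blast
qed

lemma ball_Suc_split: "(\<forall>i\<in>{1..Suc n}. P i) \<longleftrightarrow> P 1 \<and> (\<forall>i\<in>{1..n}. P (Suc i))"
proof -
  have *: "{1..Suc n} = insert 1 (Suc ` {1..n})"
    by (auto simp: image_Suc_atLeastAtMost)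
  show ?thesis unfolding * by blast
qed

lemma all_le_split0: "P 0 \<Longrightarrow> (\<forall>i\<le>k. P i) \<longleftrightarrow> (\<forall>i\<le>(k::nat). 1 \<le> i \<longrightarrow> P i)"
  by (metis One_nat_def Suc_leI neq0_conv)

text \<open>Once the first rows agree, the interlacing condition between the first two rows follows from the
  partition property.\<close>
lemma falling_pair_Suc:
  "falling_pair (Suc k) lam mu \<longleftrightarrow> part lam 1 = part mu 1 \<and> falling_pair k (rest lam) (rest mu)"
proof -
  have *: "(\<forall>i\<le>k. part (rest lam) i = part (rest mu) i) \<longleftrightarrow> (\<forall>i\<le>k. 1 \<le> i \<longrightarrow> part lam (Suc i) = part mu (Suc i))"
    by (subst all_le_split0) (auto simp: part_rest)
  show ?thesis
    unfolding falling_pair_iff all_le_Suc_split * 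
    by (subst all_ge1_split) (use part_Suc_le[of 1 lam] in \<open>auto simp: part_rest\<close>)
qed

lemma rising_pair_Suc:
  "rising_pair (Suc k) lam mu \<longleftrightarrow> part lam 1 = part mu 1 \<and> rising_pair k (rest lam) (rest mu)"
proof -
  have *: "(\<forall>i\<le>k. part (rest lam) i = part (rest mu) i) \<longleftrightarrow> (\<forall>i\<le>k. 1 \<le> i \<longrightarrow> part lam (Suc i) = part mu (Suc i))"
    by (subst all_le_split0) (auto simp: part_rest)
  show ?thesis
    unfolding rising_pair_iff all_le_Suc_split * 
    by (subst all_ge1_split) (auto simp: part_rest)
qed

lemma card_skew_rest:
  assumes "part lam 1 = part mu 1"
  shows "card (skew (rest lam) (rest mu)) = card (skew lam mu)"
proof -
  have "bij_betw (\<lambda>(i, j). (Suc i, j)) (skew (rest lam) (rest mu)) (skew lam mu)"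
  proof (rule bij_betw_byWitness[of _ "\<lambda>(i, j). (i - 1, j)"])
    have 2: "2 \<le> i" if "(i, j) \<in> skew lam mu" for i j
      using that assms by (cases "i = 1") (auto simp: skew_iff)
    then show "\<forall>b\<in>skew lam mu. (\<lambda>(i, j). (Suc i, j)) ((\<lambda>(i, j). (i - 1, j)) b) = b" by fastforce
    show "(\<lambda>(i, j). (i - 1, j)) ` skew lam mu \<subseteq> skew (rest lam) (rest mu)"
    proof (intro image_subsetI)
      fix b assume b: "b \<in> skew lam mu"
      obtain i j where ij: "b = (i, j)" by (cases b)
      show "(\<lambda>(i, j). (i - 1, j)) b \<in> skew (rest lam) (rest mu)"
        using b 2[of i j] by (auto simp: ij skew_iff part_rest)
    qed
  qed (auto simp: skew_iff part_rest)
  then show ?thesis by (rule bij_betw_same_card)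
qed

lemma hstep_rows_aux:
  "hstep x (rows f (Suc n)) (rows g n) =
     (if \<forall>i\<in>{1..n}. g i \<le> f i \<and> f (Suc i) \<le> g i then x ^ ((\<Sum>i=1..n. f i - g i) + f (Suc n)) else 0)"
proof (induction n arbitrary: f g)
  case (Suc n)
  have s: "(\<Sum>i=1..Suc n. f i - g i) = (f 1 - g 1) + (\<Sum>i=1..n. f (Suc i) - g (Suc i))"
    by (subst sum.atLeast_Suc_atMost) (simp_all add: sum.shift_bounds_cl_Suc_ivl del: sum.cl_ivl_Suc)
  show ?case
    unfolding rows_Suc[of f "Suc n"] rows_Suc[of g n] s ball_Suc_split
    using Suc.IH[of "\<lambda>i. f (Suc i)" "\<lambda>i. g (Suc i)"]
    by (subst hstep_Cons) (auto simp: rows_Suc power_add[symmetric] add.assoc)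
qed (simp add: rows_Suc)

lemma hstep_rows:
  assumes "\<forall>i>Suc n. part lam i = 0" "\<forall>i>n. part mu i = 0"
  shows "hstep x (rows (part lam) (Suc n)) (rows (part mu) n)
    = (if falling_pair 0 lam mu then x ^ card (skew lam mu) else 0)"
proof -
  have "(\<forall>i\<in>{1..n}. part mu i \<le> part lam i \<and> part lam (Suc i) \<le> part mu i) \<longleftrightarrow> falling_pair 0 lam mu"
  proof -
    have "part mu i \<le> part lam i \<and> part lam (Suc i) \<le> part mu i" if "\<not> i \<le> n" for i
      using that assms by simp
    then show ?thesis unfolding falling_pair_iff by force
  qed
  moreover have "card (skew lam mu) = (\<Sum>i=1..n. part lam i - part mu i) + part lam (Suc n)"
    unfolding card_skew[OF assms(1)] using assms(2) by simp
  ultimately show ?thesis unfolding hstep_rows_aux by simp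
qed

lemma vstep_rows_aux:
  "vstep w (rows f n) (rows g n) =
     (if \<forall>i\<in>{1..n}. f i \<le> g i \<and> g i \<le> Suc (f i) then w ^ (\<Sum>i=1..n. g i - f i) else 0)"
proof (induction n arbitrary: f g)
  case (Suc n)
  have s: "(\<Sum>i=1..Suc n. g i - f i) = (g 1 - f 1) + (\<Sum>i=1..n. g (Suc i) - f (Suc i))"
    by (subst sum.atLeast_Suc_atMost) (simp_all add: sum.shift_bounds_cl_Suc_ivl del: sum.cl_ivl_Suc)
  show ?case
    unfolding rows_Suc s ball_Suc_split using Suc.IH[of "\<lambda>i. f (Suc i)" "\<lambda>i. g (Suc i)"]
    by (auto simp: power_add le_Suc_eq)
qed simp

lemma vstep_rows:
  assumes "\<forall>i>n. part lam i = 0" "\<forall>i>n. part mu i = 0"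
  shows "vstep w (rows (part lam) n) (rows (part mu) n)
    = (if rising_pair 0 lam mu then w ^ card (skew mu lam) else 0)"
proof -
  have "(\<forall>i\<in>{1..n}. part lam i \<le> part mu i \<and> part mu i \<le> Suc (part lam i)) \<longleftrightarrow> rising_pair 0 lam mu"
  proof -
    have "part lam i \<le> part mu i \<and> part mu i \<le> Suc (part lam i)" if "\<not> i \<le> n" for i
      using that assms by simp
    then show ?thesis unfolding rising_pair_iff by force
  qed
  then show ?thesis unfolding vstep_rows_aux card_skew[OF assms(2)] by simp
qed

section \<open>Counting oscillating sequences\<close>

text \<open>The weight of an oscillating sequence with arbitrary families of variables, as the recursion
  over rows shifts them.\<close>
definition osc_weight :: "(nat \<Rightarrow> 'a::comm_ring_1) \<Rightarrow> (nat \<Rightarrow> 'a) \<Rightarrow> nat \<Rightarrow> integer_partition list \<Rightarrow> 'a" where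
  "osc_weight t w l S =
     (\<Prod>i\<in>{1..l}. w (l - i + 1) ^ card (skew (S ! (2 * i - 1)) (S ! (2 * i - 2)))) *
     (\<Prod>j\<in>{1..l - 1}. t (l - j) ^ card (skew (S ! (2 * j - 1)) (S ! (2 * j))))"

text \<open>All pairs in an oscillating sequence are rising or falling with index at least 1, so the first row
  never changes.\<close>
lemma OS_first_row:
  assumes "S \<in> OS l lam mu" "i < 2 * l"
  shows "part (S ! i) 1 = part lam 1"
  using assms(2)
proof (induction i)
  case 0 then show ?case using assms by (simp add: OS_def)
next
  case (Suc i)
  have "part (S ! i) 1 = part (S ! Suc i) 1"
  proof (cases "even i")
    case True
    then obtain k where k: "i = 2 * k" by blast
    then have "Suc k \<in> {1..l}" using Suc.prems by auto
    then have "rising_pair (l - Suc k + 1) (S ! (2 * Suc k - 2)) (S ! (2 * Suc k - 1))"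
      using assms(1) unfolding OS_def by blast
    then show ?thesis using k by (simp add: rising_pair_iff)
  next
    case False
    then obtain k where k: "i = 2 * k + 1" by (elim oddE)
    then have k': "Suc k \<in> {1..l - 1}" using Suc.prems by auto
    then have "falling_pair (l - Suc k) (S ! (2 * Suc k - 1)) (S ! (2 * Suc k))"
      using assms(1) unfolding OS_def by blast
    moreover have "1 \<le> l - Suc k" using k' by auto
    ultimately show ?thesis using k unfolding falling_pair_iff by simp
  qed
  then show ?case using Suc by simp
qed

lemma OS_hd_last: "S \<in> OS l lam mu \<Longrightarrow> length S = 2 * l \<and> S ! 0 = lam \<and> S ! (2 * l - 1) = mu"
  by (simp add: OS_def)

text \<open>Putting a common first row on top raises the index of every pair by one; the two partitions
  appended to \<open>S\<close> account for the last falling and the last rising pair, which have index 0 below the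
  first row.\<close>
lemma OS_Suc_append_iff:
  assumes l: "1 \<le> l" and len: "length S = 2 * l"
    and a: "\<And>x. x \<in> set S \<Longrightarrow> part x 1 \<le> a" "part rho 1 \<le> a" "part tau 1 \<le> a"
  shows "map (row_cons a) (S @ [rho, tau]) \<in> OS (Suc l) (row_cons a lam) (row_cons a tau)
     \<longleftrightarrow> row_cons a (S ! 0) = row_cons a lam \<and> S \<in> OS l (S ! 0) (S ! (2 * l - 1)) \<and> 
         falling_pair 0 (S ! (2 * l - 1)) rho \<and> rising_pair 0 rho tau" (is "?M \<in> _ \<longleftrightarrow> _")
proof -
  let ?rM = "\<lambda>i. rising_pair (Suc l - i + 1) (?M ! (2 * i - 2)) (?M ! (2 * i - 1))"
  let ?rS = "\<lambda>i. rising_pair (l - i + 1) (S ! (2 * i - 2)) (S ! (2 * i - 1))"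
  let ?fM = "\<lambda>i. falling_pair (Suc l - i) (?M ! (2 * i - 1)) (?M ! (2 * i))"
  let ?fS = "\<lambda>i. falling_pair (l - i) (S ! (2 * i - 1)) (S ! (2 * i))"
  have M: "?M ! i = row_cons a (S ! i)" if "i < 2 * l" for i
    using that len by (simp add: nth_append)
  have M1: "?M ! (2 * l) = row_cons a rho" "?M ! (Suc (2 * l)) = row_cons a tau"
    using len by (simp_all add: nth_append)
  have pS: "part (S ! i) 1 \<le> a" if "i < 2 * l" for i using that len a by simp
  have rise: "rising_pair (Suc k) (row_cons a x) (row_cons a y) \<longleftrightarrow> rising_pair k x y"
    if "part x 1 \<le> a" "part y 1 \<le> a" for k x y
    using that by (simp add: rising_pair_Suc rest_row_cons part_row_cons)
  have fall: "falling_pair (Suc k) (row_cons a x) (row_cons a y) \<longleftrightarrow> falling_pair k x y"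
    if "part x 1 \<le> a" "part y 1 \<le> a" for k x y
    using that by (simp add: falling_pair_Suc rest_row_cons part_row_cons)
  have R: "(\<forall>i\<in>{1..Suc l}. ?rM i)
     \<longleftrightarrow> (\<forall>i\<in>{1..l}. ?rS i) \<and> rising_pair 0 rho tau"
  proof -
    have e: "?rM i
       \<longleftrightarrow> ?rS i" if "i \<in> {1..l}" for i
    proof -
      have i: "2 * i - 2 < 2 * l" "2 * i - 1 < 2 * l" "Suc l - i + 1 = Suc (l - i + 1)" using that by auto
      show ?thesis unfolding M[OF i(1)] M[OF i(2)] i(3) by (rule rise[OF pS[OF i(1)] pS[OF i(2)]])
    qed
    have "{1..Suc l} = insert (Suc l) {1..l}" by auto
    then have "(\<forall>i\<in>{1..Suc l}. ?rM i)
       \<longleftrightarrow> ?rM (Suc l) \<and>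
         (\<forall>i\<in>{1..l}. ?rM i)"
      by simp
    also have "?rM (Suc l) \<longleftrightarrow> rising_pair 0 rho tau"
    proof -
      have i: "2 * Suc l - 2 = 2 * l" "2 * Suc l - 1 = Suc (2 * l)" "Suc l - Suc l + 1 = Suc 0" by auto
      show ?thesis unfolding i M1 by (rule rise[OF a(2,3)])
    qed
    also have "(\<forall>i\<in>{1..l}. ?rM i)
       \<longleftrightarrow> (\<forall>i\<in>{1..l}. ?rS i)"
      by (rule ball_cong[OF refl e])
    finally show ?thesis by blast
  qed
  have F: "(\<forall>i\<in>{1..Suc l - 1}. ?fM i)
     \<longleftrightarrow> (\<forall>i\<in>{1..l - 1}. ?fS i) \<and> falling_pair 0 (S ! (2 * l - 1)) rho"
  proof -
    have e: "?fM i
       \<longleftrightarrow> ?fS i" if "i \<in> {1..l - 1}" for i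
    proof -
      have i: "2 * i - 1 < 2 * l" "2 * i < 2 * l" "Suc l - i = Suc (l - i)" using that by auto
      show ?thesis unfolding M[OF i(1)] M[OF i(2)] i(3) by (rule fall[OF pS[OF i(1)] pS[OF i(2)]])
    qed
    have "{1..Suc l - 1} = insert l {1..l - 1}" using l by auto
    then have "(\<forall>i\<in>{1..Suc l - 1}. ?fM i)
       \<longleftrightarrow> ?fM l \<and>
         (\<forall>i\<in>{1..l - 1}. ?fM i)"
      by simp
    also have "?fM l \<longleftrightarrow> falling_pair 0 (S ! (2 * l - 1)) rho"
    proof -
      have i: "2 * l - 1 < 2 * l" "Suc l - l = Suc 0" using l by auto
      show ?thesis unfolding i(2) M[OF i(1)] M1 by (rule fall[OF pS[OF i(1)] a(2)])
    qed
    also have "(\<forall>i\<in>{1..l - 1}. ?fM i)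
       \<longleftrightarrow> (\<forall>i\<in>{1..l - 1}. ?fS i)"
      by (rule ball_cong[OF refl e])
    finally show ?thesis by blast
  qed
  have 0: "?M ! 0 = row_cons a (S ! 0)" using l by (intro M) simp
  have last: "2 * Suc l - 1 = Suc (2 * l)" by simp
  have "length ?M = 2 * Suc l" using len by simp
  then show ?thesis
    unfolding OS_def mem_Collect_eq R F 0 last M1 using len by blast
qed

lemma osc_weight_append:
  assumes l: "1 \<le> l" and len: "length S = 2 * l"
    and a: "\<And>x. x \<in> set S \<Longrightarrow> part x 1 \<le> a" "part rho 1 \<le> a" "part tau 1 \<le> a"
  shows "osc_weight t w (Suc l) (map (row_cons a) (S @ [rho, tau]))
     = osc_weight (t \<circ> Suc) (w \<circ> Suc) l S * t 1 ^ card (skew (S ! (2 * l - 1)) rho) * w 1 ^ card (skew tau rho)"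
    (is "osc_weight t w (Suc l) ?M = _")
proof -
  let ?wM = "\<lambda>i. w (Suc l - i + 1) ^ card (skew (?M ! (2 * i - 1)) (?M ! (2 * i - 2)))"
  let ?wS = "\<lambda>i. (w \<circ> Suc) (l - i + 1) ^ card (skew (S ! (2 * i - 1)) (S ! (2 * i - 2)))"
  let ?tM = "\<lambda>i. t (Suc l - i) ^ card (skew (?M ! (2 * i - 1)) (?M ! (2 * i)))"
  let ?tS = "\<lambda>i. (t \<circ> Suc) (l - i) ^ card (skew (S ! (2 * i - 1)) (S ! (2 * i)))"
  have M: "?M ! i = row_cons a (S ! i)" if "i < 2 * l" for i
    using that len by (simp add: nth_append)
  have M1: "?M ! (2 * l) = row_cons a rho" "?M ! (Suc (2 * l)) = row_cons a tau"
    using len by (simp_all add: nth_append)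
  have pS: "part (S ! i) 1 \<le> a" if "i < 2 * l" for i using that len a by simp
  have c: "card (skew (row_cons a x) (row_cons a y)) = card (skew x y)"
    if "part x 1 \<le> a" "part y 1 \<le> a" for x y
    using card_skew_rest[of "row_cons a x" "row_cons a y"] that
    by (simp add: rest_row_cons part_row_cons)
  have "(\<Prod>i\<in>{1..Suc l}. ?wM i)
     = (\<Prod>i\<in>{1..l}. ?wM i) * w 1 ^ card (skew (?M ! (Suc (2 * l))) (?M ! (2 * l)))"
    by (simp add: prod.cl_ivl_Suc)
  also have "(\<Prod>i\<in>{1..l}. ?wM i)
     = (\<Prod>i\<in>{1..l}. ?wS i)"
  proof (rule prod.cong[OF refl])
    fix i assume i: "i \<in> {1..l}"
    then have i: "2 * i - 2 < 2 * l" "2 * i - 1 < 2 * l" "Suc l - i + 1 = Suc (l - i + 1)" by auto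
    show "?wM i
       = ?wS i"
      unfolding M[OF i(1)] M[OF i(2)] i(3) c[OF pS[OF i(2)] pS[OF i(1)]] by simp
  qed
  finally have W: "(\<Prod>i\<in>{1..Suc l}. ?wM i)
     = (\<Prod>i\<in>{1..l}. ?wS i) * w 1 ^ card (skew tau rho)"
    unfolding M1 c[OF a(3,2)] .
  have e: "{1..Suc l - 1} = insert l {1..l - 1}" "l \<notin> {1..l - 1}" using l by auto
  have "(\<Prod>i\<in>{1..Suc l - 1}. ?tM i)
     = t 1 ^ card (skew (?M ! (2 * l - 1)) (?M ! (2 * l))) * (\<Prod>i\<in>{1..l - 1}. ?tM i)"
    unfolding e(1) using e(2) by (simp del: One_nat_def) simp
  also have "card (skew (?M ! (2 * l - 1)) (?M ! (2 * l))) = card (skew (S ! (2 * l - 1)) rho)"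
  proof -
    have i: "2 * l - 1 < 2 * l" using l by auto
    show ?thesis unfolding M[OF i] M1 by (rule c[OF pS[OF i] a(2)])
  qed
  also have "(\<Prod>i\<in>{1..l - 1}. ?tM i)
     = (\<Prod>i\<in>{1..l - 1}. ?tS i)"
  proof (rule prod.cong[OF refl])
    fix i assume i: "i \<in> {1..l - 1}"
    then have i: "2 * i - 1 < 2 * l" "2 * i < 2 * l" "Suc l - i = Suc (l - i)" by auto
    show "?tM i
       = ?tS i"
      unfolding M[OF i(1)] M[OF i(2)] i(3) c[OF pS[OF i(1)] pS[OF i(2)]] by simp
  qed
  finally have T: "(\<Prod>i\<in>{1..Suc l - 1}. ?tM i)
     = t 1 ^ card (skew (S ! (2 * l - 1)) rho) * (\<Prod>i\<in>{1..l - 1}. ?tS i)" .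
  show ?thesis unfolding osc_weight_def W T by (simp add: mult_ac)
qed

text \<open>The recursion behind \<open>osc_sum\<close> as a bijection: \<open>kap\<close> is the end of the shorter sequence, and \<open>rho\<close> the
  partition between the last falling and the last rising step.\<close>
lemma bij_OS_Suc:
  assumes l: "1 \<le> l" and first: "part lam 1 = part mu 1"
    and mu: "\<forall>i>Suc n. part mu i = 0"
  defines "a \<equiv> part lam 1"
  shows "bij_betw (\<lambda>((kap, rho), S). map (row_cons a) (S @ [rho, rest mu]))
      (SIGMA (kap, rho) : {(kap, rho) \<in> in_box a (Suc n) \<times> in_box a n. falling_pair 0 kap rho \<and> rising_pair 0 rho (rest mu)}.
         OS l (rest lam) kap) (OS (Suc l) lam mu)" (is "bij_betw ?f ?A _")
proof (rule bij_betw_byWitness[of _ "\<lambda>S. ((rest (S ! (2 * l - 1)), rest (S ! (2 * l))), map rest (take (2 * l) S))"])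
  let ?g = "\<lambda>S. ((rest (S ! (2 * l - 1)), rest (S ! (2 * l))), map rest (take (2 * l) S))"
  have la: "row_cons a (rest lam) = lam" unfolding a_def by (rule row_cons_rest[OF refl])
  have mua: "row_cons a (rest mu) = mu" by (rule row_cons_rest) (unfold a_def, rule first[symmetric])
  have pa: "part (rest lam) 1 \<le> a" "part (rest mu) 1 \<le> a"
    using part_rest_1_le[of lam] part_rest_1_le[of mu] first by (simp_all add: a_def)
  have A: "length S = 2 * l \<and> (\<forall>x\<in>set S. part x 1 \<le> a) \<and> part rho 1 \<le> a \<and> S ! (2 * l - 1) = kap \<and> S ! 0 = rest lam"
    if "((kap, rho), S) \<in> ?A" for kap rho S
  proof -
    have S: "S \<in> OS l (rest lam) kap" and "rho \<in> in_box a n" using that by auto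
    have "part x 1 \<le> a" if "x \<in> set S" for x
    proof -
      obtain i where "i < 2 * l" "x = S ! i" using \<open>x \<in> set S\<close> OS_hd_last[OF S] by (metis in_set_conv_nth)
      then show ?thesis using OS_first_row[OF S, of i] pa by simp
    qed
    then show ?thesis using OS_hd_last[OF S] \<open>rho \<in> in_box a n\<close> by (simp add: in_box_def)
  qed
  show "\<forall>p\<in>?A. ?g (?f p) = p"
  proof
    fix p assume p: "p \<in> ?A"
    obtain kap rho S where e: "p = ((kap, rho), S)" by (cases p) auto
    note a = A[OF p[unfolded e]]
    have "rest (map (row_cons a) (S @ [rho, rest mu]) ! (2 * l - 1)) = kap"
      using a l pa nth_mem[of "2 * l - 1" S] by (simp add: nth_append rest_row_cons)
    moreover have "map (\<lambda>x. rest (row_cons a x)) S = S"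
      by (rule map_idI) (use a in \<open>auto simp: rest_row_cons\<close>)
    ultimately show "?g (?f p) = p"
      using a by (simp add: e nth_append rest_row_cons comp_def)
  qed
  have G: "?f (?g S) = S \<and> ?g S \<in> ?A" if S: "S \<in> OS (Suc l) lam mu" for S
  proof -
    have len: "length S = 2 * Suc l" and S0: "S ! 0 = lam" and Sl: "S ! (2 * Suc l - 1) = mu"
      using OS_hd_last[OF S] by auto
    have p1: "part (S ! i) 1 = a" if "i < 2 * Suc l" for i
      unfolding a_def using S that by (rule OS_first_row)
    have rc: "row_cons a (rest (S ! i)) = S ! i" if "i < 2 * Suc l" for i
      using p1[OF that] by (rule row_cons_rest)
    define S' where "S' = map rest (take (2 * l) S)"
    have len': "length S' = 2 * l" unfolding S'_def using len by simp
    have S'i: "S' ! i = rest (S ! i)" if "i < 2 * l" for i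
      unfolding S'_def using that len by simp
    let ?rho = "rest (S ! (2 * l))"
    have eq: "map (row_cons a) (S' @ [?rho, rest mu]) = S"
    proof (rule nth_equalityI)
      show "length (map (row_cons a) (S' @ [?rho, rest mu])) = length S" using len len' by simp
      fix i assume "i < length (map (row_cons a) (S' @ [?rho, rest mu]))"
      then consider "i < 2 * l" | "i = 2 * l" | "i = Suc (2 * l)" using len' by fastforce
      then show "map (row_cons a) (S' @ [?rho, rest mu]) ! i = S ! i"
      proof cases
        case 1
        then show ?thesis using len' rc[of i] S'i[of i] by (simp add: nth_append)
      next
        case 2
        then show ?thesis using len' rc[of i] by (simp add: nth_append)
      next
        case 3
        then show ?thesis using len' mua Sl by (simp add: nth_append)
      qed
    qed
    have pS': "part x 1 \<le> a" if "x \<in> set S'" for x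
    proof -
      obtain i where "i < 2 * l" "x = S' ! i" using \<open>x \<in> set S'\<close> len' by (metis in_set_conv_nth)
      then show ?thesis using S'i p1[of i] part_rest_1_le[of "S ! i"] by simp
    qed
    have prho: "part ?rho 1 \<le> a" using p1[of "2 * l"] part_rest_1_le[of "S ! (2 * l)"] by simp
    have S'0: "S' ! 0 = rest lam" using S'i[of 0] S0 l by simp
    have "map (row_cons a) (S' @ [?rho, rest mu]) \<in> OS (Suc l) (row_cons a (rest lam)) (row_cons a (rest mu))"
      unfolding eq la mua by (rule S)
    then have *: "S' \<in> OS l (S' ! 0) (S' ! (2 * l - 1))" "falling_pair 0 (S' ! (2 * l - 1)) ?rho" "rising_pair 0 ?rho (rest mu)"
      using OS_Suc_append_iff[OF l len' pS' prho pa(2), of "rest lam"] by blast+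
    have kap: "S' ! (2 * l - 1) = rest (S ! (2 * l - 1))" using l by (intro S'i) simp
    have "part ?rho i = 0" if "i > n" for i
    proof -
      have "part ?rho i \<le> part (rest mu) i" using *(3) that by (simp add: rising_pair_iff)
      also have "\<dots> = 0" using mu that by (simp add: part_rest)
      finally show ?thesis by simp
    qed
    then have rho_box: "?rho \<in> in_box a n" using prho by (simp add: in_box_def)
    have "part (S' ! (2 * l - 1)) i = 0" if i: "i > Suc n" for i
    proof -
      have "part (S' ! (2 * l - 1)) (Suc (i - 1)) \<le> part ?rho (i - 1)"
        using *(2) i unfolding falling_pair_iff by (metis Suc_less_eq2 diff_Suc_1 less_eq_Suc_le not_gr_zero not_less_zero One_nat_def)
      also have "\<dots> = 0" using rho_box i by (auto simp: in_box_def)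
      finally show ?thesis using i by simp
    qed
    moreover have "part (S' ! (2 * l - 1)) 1 \<le> a" using pS' len' l by simp
    ultimately have "S' ! (2 * l - 1) \<in> in_box a (Suc n)" by (simp add: in_box_def)
    then have "?g S \<in> ?A" using rho_box *[unfolded kap S'0] unfolding kap
      by (simp add: S'_def[symmetric])
    then show ?thesis using eq by (simp add: S'_def[symmetric])
  qed
  show "\<forall>S\<in>OS (Suc l) lam mu. ?f (?g S) = S" using G by blast
  show "?g ` OS (Suc l) lam mu \<subseteq> ?A" using G by blast
  show "?f ` ?A \<subseteq> OS (Suc l) lam mu"
  proof (rule image_subsetI)
    fix p assume p: "p \<in> ?A"
    obtain kap rho S where e: "p = ((kap, rho), S)" by (cases p) auto
    note a = A[OF p[unfolded e]]
    have "map (row_cons a) (S @ [rho, rest mu]) \<in> OS (Suc l) (row_cons a (rest lam)) (row_cons a (rest mu))"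
      by (subst OS_Suc_append_iff[OF l]) (use a pa p e in auto)
    then show "?f p \<in> OS (Suc l) lam mu" by (simp add: e la mua)
  qed
qed

lemma OS_1: "OS 1 lam mu = (if rising_pair 1 lam mu then {[lam, mu]} else {})"
proof -
  have "S \<in> OS 1 lam mu \<longleftrightarrow> S = [lam, mu] \<and> rising_pair 1 lam mu" for S
    by (cases S; cases "tl S") (auto simp: OS_def)
  then show ?thesis by auto
qed

lemma OS_first_eq: "1 \<le> l \<Longrightarrow> S \<in> OS l lam mu \<Longrightarrow> part lam 1 = part mu 1"
  using OS_first_row[of S l lam mu "2 * l - 1"] OS_hd_last[of S l lam mu] by simp

text \<open>Finiteness is proved along with the formula: given the end point, the shapes before it have a
  bounded number of rows, and their first rows are bounded as well.\<close>
lemma sum_OS: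
  assumes "1 \<le> l" "\<forall>i>l. part lam i = 0" "\<forall>i>Suc n. part mu i = 0"
  shows "finite (OS l lam mu) \<and>
    (\<Sum>S\<in>OS l lam mu. osc_weight t w l S) = osc_sum t w (rows (part lam) l) (rows (part mu) (Suc n))"
  using assms
proof (induction l arbitrary: lam mu n t w rule: dec_induct)
  case base
  have zero: "part (rest lam) i = 0" for i
    using base by (cases "i = 0") (auto simp: part_rest)
  have r0: "rows (part (rest lam)) m = replicate m 0" for m
    by (rule nth_equalityI) (simp_all add: rows_def zero del: upt_Suc)
  have z0: "replicate m 0 \<in> boxed q m" for q m by (rule zero_boxed)
  have mu': "\<forall>i>n. part (rest mu) i = 0" using base by (simp add: part_rest)
  have "osc_sum t w (rows (part lam) 1) (rows (part mu) (Suc n)) =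
     (if part lam 1 = part mu 1 then vstep (w 1) (replicate n 0) (rows (part (rest mu)) n) else 0)"
  proof (cases "part lam 1 = part mu 1")
    case True
    let ?q = "part lam 1"
    have "osc_sum t w (rows (part lam) 1) (rows (part mu) (Suc n)) =
       (\<Sum>us\<in>boxed ?q (Suc n). \<Sum>vs\<in>boxed ?q n. (if us = replicate (Suc n) 0 then hstep (t 1) us vs * vstep (w 1) vs (rows (part (rest mu)) n) else 0))"
      using True by (simp add: rows_part_Suc all_zero_boxed_iff del: boxed.simps replicate.simps cong: sum.cong)
        (auto intro!: sum.cong simp: rows_part_Suc all_zero_boxed_iff simp del: boxed.simps replicate.simps)
    also have "\<dots> = (\<Sum>vs\<in>boxed ?q n. hstep (t 1) (replicate (Suc n) 0) vs * vstep (w 1) vs (rows (part (rest mu)) n))"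
      by (subst sum.swap) (simp add: z0 del: boxed.simps replicate.simps)
    also have "\<dots> = vstep (w 1) (replicate n 0) (rows (part (rest mu)) n)"
      unfolding hstep_zero by (simp add: z0 if_distrib[of "\<lambda>x. x * _"] cong: if_cong)
    finally show ?thesis using True by simp
  qed (simp add: rows_part_Suc)
  also have "\<dots> = (if rising_pair 1 lam mu then w 1 ^ card (skew mu lam) else 0)"
    unfolding r0[symmetric] using zero mu'
    by (simp add: vstep_rows rising_pair_Suc card_skew_rest)
  also have "\<dots> = (\<Sum>S\<in>OS 1 lam mu. osc_weight t w 1 S)"
    unfolding OS_1 by (simp add: osc_weight_def)
  finally have "(\<Sum>S\<in>OS 1 lam mu. osc_weight t w 1 S) = osc_sum t w (rows (part lam) 1) (rows (part mu) (Suc n))" ..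
  moreover have "finite (OS 1 lam mu)" unfolding OS_1 by simp
  ultimately show ?case by blast
next
  case (step l)
  show ?case
  proof (cases "part lam 1 = part mu 1")
    case False
    then have "OS (Suc l) lam mu = {}" using OS_first_eq[of "Suc l" _ lam mu] by auto
    then show ?thesis using False by (simp add: rows_part_Suc)
  next
    case True
    define a where "a = part lam 1"
    let ?B = "{(kap, rho) \<in> in_box a (Suc n) \<times> in_box a n. falling_pair 0 kap rho \<and> rising_pair 0 rho (rest mu)}"
    let ?t = "t \<circ> Suc" and ?w = "w \<circ> Suc"
    let ?K = "\<lambda>kap. osc_sum ?t ?w (rows (part (rest lam)) l) (rows (part kap) (Suc n))"
    let ?h = "\<lambda>kap rho. hstep (t 1) (rows (part kap) (Suc n)) (rows (part rho) n)"
    let ?v = "\<lambda>rho. vstep (w 1) (rows (part rho) n) (rows (part (rest mu)) n)"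
    let ?F = "\<lambda>kap rho. ?K kap * t 1 ^ card (skew kap rho) * w 1 ^ card (skew (rest mu) rho)"
    let ?G = "\<lambda>kap rho. ?K kap * ?h kap rho * ?v rho"
    note bij = bij_OS_Suc[OF step.hyps(1) True step.prems(2), folded a_def]
    have lam': "\<forall>i>l. part (rest lam) i = 0" using step.prems by (simp add: part_rest)
    have IH: "finite (OS l (rest lam) kap)" 
      "(\<Sum>S\<in>OS l (rest lam) kap. osc_weight ?t ?w l S) = ?K kap"
      if "kap \<in> in_box a (Suc n)" for kap
    proof -
      have "\<forall>i>Suc n. part kap i = 0" using that by (simp add: in_box_def)
      note * = step.IH[OF lam' this, of ?t ?w]
      show "finite (OS l (rest lam) kap)" using * by (rule conjunct1)
      show "(\<Sum>S\<in>OS l (rest lam) kap. osc_weight ?t ?w l S) = ?K kap"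
        using * by (rule conjunct2)
    qed
    have finB: "finite ?B" by (rule finite_subset[of _ "in_box a (Suc n) \<times> in_box a n"]) auto
    have finA: "finite (SIGMA (kap, rho) : ?B. OS l (rest lam) kap)"
      using finB IH(1) by (intro finite_SigmaI) auto
    then have fin: "finite (OS (Suc l) lam mu)" using bij_betw_finite[OF bij] by simp
    have mu': "\<forall>i>n. part (rest mu) i = 0" using step.prems by (simp add: part_rest)
    have "(\<Sum>S\<in>OS (Suc l) lam mu. osc_weight t w (Suc l) S)
      = (\<Sum>p\<in>(SIGMA (kap, rho) : ?B. OS l (rest lam) kap).
           osc_weight t w (Suc l) ((\<lambda>((kap, rho), S). map (row_cons a) (S @ [rho, rest mu])) p))"
      by (rule sum.reindex_bij_betw[OF bij, symmetric])
    also have "\<dots> = (\<Sum>p\<in>(SIGMA (kap, rho) : ?B. OS l (rest lam) kap).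
           case p of ((kap, rho), S) \<Rightarrow> osc_weight ?t ?w l S * t 1 ^ card (skew kap rho) * w 1 ^ card (skew (rest mu) rho))"
    proof (rule sum.cong[OF refl])
      fix p assume p: "p \<in> (SIGMA (kap, rho) : ?B. OS l (rest lam) kap)"
      obtain kap rho S where e: "p = ((kap, rho), S)" by (cases p) auto
      have S: "S \<in> OS l (rest lam) kap" and rho: "part rho 1 \<le> a" using p by (auto simp: e in_box_def)
      have len: "length S = 2 * l" "S ! (2 * l - 1) = kap" using OS_hd_last[OF S] by blast+
      have pS: "part x 1 \<le> a" if "x \<in> set S" for x
      proof -
        obtain i where "i < 2 * l" "x = S ! i" using \<open>x \<in> set S\<close> len(1) by (metis in_set_conv_nth)
        then show ?thesis using OS_first_row[OF S, of i] part_rest_1_le[of lam] by (simp add: a_def)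
      qed
      have "part (rest mu) 1 \<le> a" using part_rest_1_le[of mu] True by (simp add: a_def)
      from osc_weight_append[OF step.hyps(1) len(1) pS rho this, of t w]
      show "osc_weight t w (Suc l) ((\<lambda>((kap, rho), S). map (row_cons a) (S @ [rho, rest mu])) p)
        = (case p of ((kap, rho), S) \<Rightarrow> osc_weight ?t ?w l S * t 1 ^ card (skew kap rho) * w 1 ^ card (skew (rest mu) rho))"
        unfolding e prod.case len(2) .
    qed
    also have "\<dots> = (\<Sum>p\<in>?B. \<Sum>S\<in>(case p of (kap, rho) \<Rightarrow> OS l (rest lam) kap).
           case p of (kap, rho) \<Rightarrow> osc_weight ?t ?w l S * t 1 ^ card (skew kap rho) * w 1 ^ card (skew (rest mu) rho))"
    proof -
      have "finite (case p of (kap, rho) \<Rightarrow> OS l (rest lam) kap)" if "p \<in> ?B" for p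
        using that IH(1) by auto
      then show ?thesis
        using finB by (subst sum.Sigma) (blast, blast, rule sum.cong[OF refl], clarsimp)
    qed
    also have "\<dots> = (\<Sum>(kap, rho)\<in>?B. ?F kap rho)"
    proof (rule sum.cong[OF refl])
      fix p assume p: "p \<in> ?B"
      obtain kap rho where e: "p = (kap, rho)" by (cases p)
      have "kap \<in> in_box a (Suc n)" using p by (simp add: e)
      from IH(2)[OF this]
      show "(\<Sum>S\<in>(case p of (kap, rho) \<Rightarrow> OS l (rest lam) kap).
           case p of (kap, rho) \<Rightarrow> osc_weight ?t ?w l S * t 1 ^ card (skew kap rho) * w 1 ^ card (skew (rest mu) rho))
         = case_prod ?F p"
        unfolding e prod.case sum_distrib_right[symmetric] by (simp only:)
    qed
    also have "\<dots> = (\<Sum>(kap, rho)\<in>in_box a (Suc n) \<times> in_box a n. ?G kap rho)"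
    proof (rule sum.mono_neutral_cong_left)
      fix p assume "p \<in> ?B"
      then show "case_prod ?F p
        = case_prod ?G p"
        using mu' by (auto simp: in_box_def hstep_rows vstep_rows)
    next
      show "\<forall>p\<in>in_box a (Suc n) \<times> in_box a n - ?B. case_prod ?G p = 0"
        using mu' by (auto simp: in_box_def hstep_rows vstep_rows split: if_splits)
    qed auto
    also have "\<dots> = (\<Sum>kap\<in>in_box a (Suc n). \<Sum>rho\<in>in_box a n. ?G kap rho)"
      by (simp only: sum.cartesian_product)
    also have "\<dots> = (\<Sum>us\<in>boxed a (Suc n). \<Sum>vs\<in>boxed a n. osc_sum ?t ?w (rows (part (rest lam)) l) us *
          hstep (t 1) us vs * vstep (w 1) vs (rows (part (rest mu)) n))"
      unfolding sum_in_box[of "\<lambda>vs. osc_sum ?t ?w _ _ * hstep (t 1) _ vs * vstep (w 1) vs _"]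
      by (rule sum_in_box)
    also have "\<dots> = osc_sum t w (rows (part lam) (Suc l)) (rows (part mu) (Suc n))"
      using True by (simp add: rows_part_Suc a_def del: boxed.simps)
    finally show ?thesis using fin by blast
  qed
qed

section \<open>Young diagrams\<close>

lemma diagram_iff: "(i, j) \<in> diagram lam \<longleftrightarrow> 1 \<le> i \<and> 1 \<le> j \<and> j \<le> part lam i"
  by (simp add: diagram_def)

lemma diagram_down:
  "(i, j) \<in> diagram lam \<Longrightarrow> 1 \<le> i' \<Longrightarrow> i' \<le> i \<Longrightarrow> 1 \<le> j' \<Longrightarrow> j' \<le> j \<Longrightarrow> (i', j') \<in> diagram lam"
  using part_antimono[of i' i lam] by (auto simp: diagram_iff)

lemma ex_in_box: "\<exists>n. \<forall>i>n. part lam i = 0"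
proof -
  obtain n where "{i. part lam i \<noteq> 0} \<subseteq> {..n}"
    using finite_part[of lam] finite_nat_iff_bounded_le by blast
  then have "part lam i = 0" if "i > n" for i using that by fastforce
  then show ?thesis by blast
qed

lemma finite_diagram [simp]: "finite (diagram lam)"
proof -
  obtain n where n: "\<forall>i>n. part lam i = 0" using ex_in_box by blast
  have "diagram lam \<subseteq> {..n} \<times> {..part lam 1}"
  proof
    fix b assume "b \<in> diagram lam"
    then obtain i j where b: "b = (i, j)" "1 \<le> i" "1 \<le> j" "j \<le> part lam i" by (cases b) (auto simp: diagram_iff)
    have "i \<le> n"
    proof (rule ccontr)
      assume "\<not> i \<le> n"
      then have "part lam i = 0" using n by simp
      then show False using b by simp
    qed
    then show "b \<in> {..n} \<times> {..part lam 1}" using b part_antimono[of 1 i lam] by auto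
  qed
  then show ?thesis by (rule finite_subset) simp
qed

lemma diagram_inj: "diagram lam = diagram mu \<Longrightarrow> lam = mu"
proof (rule part_eqI)
  fix i :: nat assume d: "diagram lam = diagram mu" and i: "1 \<le> i"
  have "{j. (i, j) \<in> diagram x} = {1..part x i}" for x using i by (auto simp: diagram_iff)
  then have "{1..part lam i} = {1..part mu i}" using d by metis
  then show "part lam i = part mu i" by (metis card_atLeastAtMost diff_Suc_1)
qed

lemma diagram_subset_iff: "diagram alpha \<subseteq> diagram lam \<longleftrightarrow> (\<forall>i\<ge>1. part alpha i \<le> part lam i)"
proof
  assume d: "diagram alpha \<subseteq> diagram lam"
  show "\<forall>i\<ge>1. part alpha i \<le> part lam i"
  proof (intro allI impI)
    fix i :: nat assume i: "1 \<le> i"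
    show "part alpha i \<le> part lam i"
    proof (cases "part alpha i = 0")
      case False
      then have "(i, part alpha i) \<in> diagram alpha" using i by (simp add: diagram_iff)
      then have "(i, part alpha i) \<in> diagram lam" using d by blast
      then show ?thesis by (simp add: diagram_iff)
    qed simp
  qed
next
  assume le: "\<forall>i\<ge>1. part alpha i \<le> part lam i"
  show "diagram alpha \<subseteq> diagram lam"
  proof
    fix b assume "b \<in> diagram alpha"
    then obtain i j where b: "b = (i, j)" "1 \<le> i" "1 \<le> j" "j \<le> part alpha i" by (cases b) (auto simp: diagram_iff)
    then have "part alpha i \<le> part lam i" using le by blast
    then show "b \<in> diagram lam" using b by (simp add: diagram_iff)
  qed
qed

text \<open>Each row of a set closed towards the north-west is an initial segment, and lower rows are not longer
  than higher ones.\<close>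
lemma ex_diagram:
  assumes D: "D \<subseteq> diagram lam"
    and down: "\<And>i j i' j'. (i, j) \<in> D \<Longrightarrow> 1 \<le> i' \<Longrightarrow> i' \<le> i \<Longrightarrow> 1 \<le> j' \<Longrightarrow> j' \<le> j \<Longrightarrow> (i', j') \<in> D"
  shows "\<exists>alpha. diagram alpha = D"
proof -
  define f where "f i = card {j. (i, j) \<in> D}" for i
  have pos: "1 \<le> i \<and> 1 \<le> j \<and> j \<le> part lam i" if "(i, j) \<in> D" for i j using that D by (auto simp: diagram_iff)
  have fin: "finite {j. (i, j) \<in> D}" for i by (rule finite_subset[of _ "{..part lam i}"]) (use pos in auto)
  have row: "{j. (i, j) \<in> D} = {1..f i}" for i
  proof (cases "{j. (i, j) \<in> D} = {}")
    case False
    let ?m = "Max {j. (i, j) \<in> D}"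
    have m: "(i, ?m) \<in> D" using Max_in[OF fin False] by simp
    have "{j. (i, j) \<in> D} = {1..?m}"
    proof (intro equalityI subsetI)
      fix j assume "j \<in> {j. (i, j) \<in> D}"
      then show "j \<in> {1..?m}" using pos[of i j] Max_ge[OF fin, of j i] by simp
    next
      fix j assume "j \<in> {1..?m}"
      then show "j \<in> {j. (i, j) \<in> D}" using down[OF m, of i j] pos[OF m] by simp
    qed
    moreover from this have "f i = ?m" unfolding f_def by (metis card_atLeastAtMost diff_Suc_1)
    ultimately show ?thesis by simp
  qed (simp add: f_def)
  have "{j. (0, j) \<in> D} = {}" using pos[of 0] by auto
  then have f0: "f 0 = 0" by (simp add: f_def)
  have le: "f i \<le> part lam i" for i
    unfolding f_def using card_mono[of "{1..part lam i}" "{j. (i, j) \<in> D}"] pos[of i] by fastforce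
  have "f (Suc i) \<le> f i" if "1 \<le> i" for i
    unfolding f_def by (rule card_mono[OF fin]) (use down[of "Suc i" _ i] pos that in fastforce)
  moreover have "finite {i. f i \<noteq> 0}"
    by (rule finite_subset[OF _ finite_part[of lam]]) (rule subsetI, use le in \<open>simp add: less_le_trans\<close>)
  ultimately have "part (Abs_integer_partition f) = f" using f0 by (intro part_Abs) auto
  moreover have "(i, j) \<in> D \<longleftrightarrow> 1 \<le> i \<and> 1 \<le> j \<and> j \<le> f i" for i j
    using row[of i] pos[of i j] by auto
  ultimately have "diagram (Abs_integer_partition f) = D" by (auto simp: diagram_def)
  then show ?thesis ..
qed

section \<open>Removing the largest letter of a semistandard tableau\<close>

definition ssyts :: "integer_partition \<Rightarrow> (nat \<Rightarrow> nat) \<Rightarrow> (nat \<times> nat \<Rightarrow> nat) set" where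
  "ssyts mu c = {T \<in> SSYT mu. ssyt_content mu T = c}"

lemma SSYT_ext: "T \<in> SSYT mu \<Longrightarrow> T \<in> extensional (diagram mu)"
  by (auto simp: SSYT_def PiE_def)

lemma SSYT_pos: "T \<in> SSYT mu \<Longrightarrow> b \<in> diagram mu \<Longrightarrow> 1 \<le> T b"
  by (auto simp: SSYT_def)

lemma SSYT_row: "T \<in> SSYT mu \<Longrightarrow> (i, j) \<in> diagram mu \<Longrightarrow> (i, j') \<in> diagram mu \<Longrightarrow> j < j' \<Longrightarrow> T (i, j) \<le> T (i, j')"
  unfolding SSYT_def by blast

lemma SSYT_col: "T \<in> SSYT mu \<Longrightarrow> (i, j) \<in> diagram mu \<Longrightarrow> (i', j) \<in> diagram mu \<Longrightarrow> i < i' \<Longrightarrow> T (i, j) < T (i', j)"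
  unfolding SSYT_def by blast

lemma SSYT_I:
  assumes "T \<in> extensional (diagram mu)" "\<And>b. b \<in> diagram mu \<Longrightarrow> 1 \<le> T b"
    "\<And>i j j'. (i, j) \<in> diagram mu \<Longrightarrow> (i, j') \<in> diagram mu \<Longrightarrow> j < j' \<Longrightarrow> T (i, j) \<le> T (i, j')"
    "\<And>i i' j. (i, j) \<in> diagram mu \<Longrightarrow> (i', j) \<in> diagram mu \<Longrightarrow> i < i' \<Longrightarrow> T (i, j) < T (i', j)"
  shows "T \<in> SSYT mu"
proof -
  have "T \<in> diagram mu \<rightarrow>\<^sub>E {1..}" using assms(1,2) by (auto simp: PiE_def)
  then show ?thesis unfolding SSYT_def using assms(3,4) by blast
qed

lemma SSYT_mono:
  assumes T: "T \<in> SSYT mu" and b: "(i, j) \<in> diagram mu" and "1 \<le> i'" "i' \<le> i" "1 \<le> j'" "j' \<le> j"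
  shows "T (i', j') \<le> T (i, j)"
proof -
  have "(i', j') \<in> diagram mu" "(i', j) \<in> diagram mu"
    using assms diagram_down[OF b, of i' j'] diagram_down[OF b, of i' j] by (auto simp: diagram_iff)
  then have "T (i', j') \<le> T (i', j)" using SSYT_row[OF T, of i' j' j] assms by (cases "j' = j") auto
  also have "\<dots> \<le> T (i, j)" using SSYT_col[OF T \<open>(i', j) \<in> diagram mu\<close> b] assms by (cases "i' = i") auto
  finally show ?thesis .
qed

text \<open>Columns increase strictly from an entry that is at least 1.\<close>
lemma SSYT_ge_row: "T \<in> SSYT mu \<Longrightarrow> (i, j) \<in> diagram mu \<Longrightarrow> i \<le> T (i, j)"
proof (induction i)
  case (Suc i)
  show ?case
  proof (cases "i = 0")
    case False
    then have b: "(i, j) \<in> diagram mu"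
      using Suc.prems by (intro diagram_down[OF Suc.prems(2)]) (auto simp: diagram_iff)
    have "i \<le> T (i, j)" using Suc.IH Suc.prems(1) b by blast
    also have "\<dots> < T (Suc i, j)" using SSYT_col[OF Suc.prems(1) b Suc.prems(2)] by simp
    finally show ?thesis by simp
  qed (use SSYT_pos[OF Suc.prems] in simp)
qed simp

lemma ssyts_content: "T \<in> ssyts mu c \<Longrightarrow> card {b \<in> diagram mu. T b = k} = c k"
  by (auto simp: ssyts_def ssyt_content_def fun_eq_iff)

lemma ssyts_content_pos:
  assumes "T \<in> ssyts mu c" "b \<in> diagram mu"
  shows "c (T b) \<noteq> 0"
proof -
  have "b \<in> {x \<in> diagram mu. T x = T b}" using assms(2) by simp
  moreover have "finite {x \<in> diagram mu. T x = T b}" by simp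
  ultimately show ?thesis unfolding ssyts_content[OF assms(1), symmetric] by (metis card_0_eq empty_iff)
qed

lemma ssyts_le: "T \<in> ssyts mu c \<Longrightarrow> b \<in> diagram mu \<Longrightarrow> \<forall>k>n. c k = 0 \<Longrightarrow> T b \<le> n"
  using ssyts_content_pos by (metis leI)

text \<open>There is no strictly increasing column of length \<open>n + 1\<close> with letters up to \<open>n\<close>.\<close>
lemma ssyts_empty:
  assumes "\<forall>k>n. c k = 0" "part mu (Suc n) \<noteq> 0"
  shows "ssyts mu c = {}"
proof (rule equals0I)
  fix T assume T: "T \<in> ssyts mu c"
  have "(Suc n, 1) \<in> diagram mu" using assms by (simp add: diagram_iff Suc_le_eq)
  then show False using SSYT_ge_row[of T mu "Suc n" 1] ssyts_le[OF T _ assms(1)] T by (fastforce simp: ssyts_def)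
qed

definition ssyt_extend :: "nat \<Rightarrow> integer_partition \<Rightarrow> integer_partition \<Rightarrow> (nat \<times> nat \<Rightarrow> nat) \<Rightarrow> nat \<times> nat \<Rightarrow> nat" where
  "ssyt_extend N mu nu T = restrict (\<lambda>b. if b \<in> diagram nu then T b else N) (diagram mu)"

lemma falling_pair_diagram:
  assumes "falling_pair 0 mu nu"
  shows "diagram nu \<subseteq> diagram mu" "\<And>i j. (Suc i, j) \<in> diagram mu \<Longrightarrow> 1 \<le> i \<Longrightarrow> (i, j) \<in> diagram nu"
  using assms by (auto simp: falling_pair_iff diagram_subset_iff diagram_iff intro: le_trans)

text \<open>The boxes with entries at most \<open>n\<close> form a smaller diagram, and strictness of the columns makes the
  remaining boxes, all of which have entry \<open>n + 1\<close>, a horizontal strip.\<close>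
lemma bij_ssyt_extend:
  assumes c: "\<forall>k>Suc n. c k = 0"
  shows "bij_betw (\<lambda>(nu, T). ssyt_extend (Suc n) mu nu T)
     (SIGMA nu : {nu. falling_pair 0 mu nu \<and> card (skew mu nu) = c (Suc n)}. ssyts nu (c(Suc n := 0))) (ssyts mu c)"
    (is "bij_betw ?f ?A _")
proof -
  define g where "g T = (let nu = (THE nu. diagram nu = {b \<in> diagram mu. T b \<le> n}) in (nu, restrict T (diagram nu)))"
    for T :: "nat \<times> nat \<Rightarrow> nat"
  have cont: "ssyt_content mu (ssyt_extend (Suc n) mu nu T) = (ssyt_content nu T)(Suc n := card (skew mu nu))"
    if nu: "diagram nu \<subseteq> diagram mu" and le: "\<And>b. b \<in> diagram nu \<Longrightarrow> T b \<le> n" for nu T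
  proof
    fix k
    have "{b \<in> diagram mu. ssyt_extend (Suc n) mu nu T b = k} =
       (if k = Suc n then skew mu nu else {b \<in> diagram nu. T b = k})"
      using nu le by (auto simp: ssyt_extend_def skew_def split: if_splits) force+
    then show "ssyt_content mu (ssyt_extend (Suc n) mu nu T) k = ((ssyt_content nu T)(Suc n := card (skew mu nu))) k"
      by (simp add: ssyt_content_def)
  qed
  have f: "?f p \<in> ssyts mu c \<and> g (?f p) = p" if p: "p \<in> ?A" for p
  proof -
    obtain nu T where e: "p = (nu, T)" by (cases p)
    have fall: "falling_pair 0 mu nu" and cN: "card (skew mu nu) = c (Suc n)" and T: "T \<in> ssyts nu (c(Suc n := 0))"
      using p by (auto simp: e)
    note nu = falling_pair_diagram[OF fall]
    have TS: "T \<in> SSYT nu" using T by (simp add: ssyts_def)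
    have le: "T b \<le> n" if "b \<in> diagram nu" for b
      using c by (intro ssyts_le[OF T that]) (auto simp: less_Suc_eq_le Suc_le_eq nat_less_le)
    let ?E = "ssyt_extend (Suc n) mu nu T"
    have E: "?E b = (if b \<in> diagram nu then T b else Suc n)" if "b \<in> diagram mu" for b
      using that by (simp add: ssyt_extend_def)
    have "?E \<in> SSYT mu"
    proof (rule SSYT_I)
      show "?E \<in> extensional (diagram mu)" by (simp add: ssyt_extend_def)
      show "1 \<le> ?E b" if "b \<in> diagram mu" for b using SSYT_pos[OF TS, of b] by (simp add: E[OF that])
      show "?E (i, j) \<le> ?E (i, j')" if "(i, j) \<in> diagram mu" "(i, j') \<in> diagram mu" "j < j'" for i j j'
        using that SSYT_row[OF TS, of i j j'] le[of "(i, j)"] diagram_down[of i j' nu i j]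
        by (auto simp: E diagram_iff[of _ _ mu] intro: le_SucI)
      show "?E (i, j) < ?E (i', j)" if b: "(i, j) \<in> diagram mu" "(i', j) \<in> diagram mu" "i < i'" for i i' j
      proof -
        have "(Suc i, j) \<in> diagram mu" using b by (intro diagram_down[OF b(2)]) (auto simp: diagram_iff)
        then have "(i, j) \<in> diagram nu" using nu(2) b by (auto simp: diagram_iff[of _ _ mu])
        then show ?thesis using b SSYT_col[OF TS, of i j i'] le[of "(i, j)"] by (auto simp: E)
      qed
    qed
    moreover have "ssyt_content mu ?E = c"
    proof -
      have "ssyt_content mu ?E = (ssyt_content nu T)(Suc n := card (skew mu nu))"
        by (rule cont[OF nu(1) le])
      then show ?thesis using T cN by (simp add: ssyts_def)
    qed
    moreover have "g ?E = p"
    proof -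
      have d: "{b \<in> diagram mu. ?E b \<le> n} = diagram nu" using nu(1) le by (auto simp: E split: if_splits)
      have "(THE nu'. diagram nu' = {b \<in> diagram mu. ?E b \<le> n}) = nu"
        unfolding d by (rule the_equality) (auto intro: diagram_inj)
      moreover have "restrict ?E (diagram nu) = T"
        by (rule extensionalityI[OF _ SSYT_ext[OF TS]]) (use nu(1) in \<open>auto simp: E\<close>)
      ultimately show ?thesis by (simp add: g_def e)
    qed
    ultimately show ?thesis by (simp add: ssyts_def e)
  qed
  have h: "g T \<in> ?A \<and> ?f (g T) = T" if T: "T \<in> ssyts mu c" for T
  proof -
    have TS: "T \<in> SSYT mu" using T by (simp add: ssyts_def)
    have leN: "T b \<le> Suc n" if "b \<in> diagram mu" for b by (rule ssyts_le[OF T that c])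
    have "\<exists>nu. diagram nu = {b \<in> diagram mu. T b \<le> n}"
      by (rule ex_diagram[of _ mu]) (auto intro: diagram_down order.trans[OF SSYT_mono[OF TS]])
    then obtain nu where nu: "diagram nu = {b \<in> diagram mu. T b \<le> n}" ..
    have the: "(THE nu. diagram nu = {b \<in> diagram mu. T b \<le> n}) = nu"
      by (rule the_equality) (auto simp: nu[symmetric] intro: diagram_inj)
    let ?T = "restrict T (diagram nu)"
    have gT: "g T = (nu, ?T)" by (simp add: g_def the)
    have nu_mu: "diagram nu \<subseteq> diagram mu" using nu by auto
    have ext: "ssyt_extend (Suc n) mu nu ?T = T"
    proof (rule extensionalityI[OF _ SSYT_ext[OF TS]])
      show "ssyt_extend (Suc n) mu nu ?T \<in> extensional (diagram mu)" by (simp add: ssyt_extend_def)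
      show "ssyt_extend (Suc n) mu nu ?T b = T b" if "b \<in> diagram mu" for b
        using that leN[OF that] nu by (auto simp: ssyt_extend_def)
    qed
    have TS': "?T \<in> SSYT nu"
    proof (rule SSYT_I)
      show "1 \<le> ?T b" if "b \<in> diagram nu" for b using that SSYT_pos[OF TS, of b] nu_mu by auto
      show "?T (i, j) \<le> ?T (i, j')" if "(i, j) \<in> diagram nu" "(i, j') \<in> diagram nu" "j < j'" for i j j'
        using SSYT_row[OF TS, of i j j'] that nu_mu by auto
      show "?T (i, j) < ?T (i', j)" if "(i, j) \<in> diagram nu" "(i', j) \<in> diagram nu" "i < i'" for i i' j
        using SSYT_col[OF TS, of i j i'] that nu_mu by auto
    qed simp
    have "falling_pair 0 mu nu"
      unfolding falling_pair_iff
    proof (intro conjI allI impI)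
      fix i :: nat assume i: "1 \<le> i"
      then show "part nu i \<le> part mu i" using nu_mu diagram_subset_iff by blast
      show "part mu (Suc i) \<le> part nu i"
      proof (cases "part mu (Suc i) = 0")
        case False
        let ?j = "part mu (Suc i)"
        have b: "(Suc i, ?j) \<in> diagram mu" using False by (simp add: diagram_iff)
        then have b': "(i, ?j) \<in> diagram mu" by (rule diagram_down) (use i False in auto)
        have "T (i, ?j) < T (Suc i, ?j)" by (rule SSYT_col[OF TS b' b]) simp
        then have "(i, ?j) \<in> diagram nu" using leN[OF b] b' by (simp add: nu)
        then show ?thesis by (simp add: diagram_iff)
      qed simp
    qed simp
    moreover have "ssyt_content mu T = (ssyt_content nu ?T)(Suc n := card (skew mu nu))"
      using cont[OF nu_mu, of ?T] nu unfolding ext by auto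
    then have "ssyt_content nu ?T = c(Suc n := 0) \<and> card (skew mu nu) = c (Suc n)"
    proof -
      have c': "c = (ssyt_content nu ?T)(Suc n := card (skew mu nu))"
        using T \<open>ssyt_content mu T = _\<close> by (simp add: ssyts_def)
      have "ssyt_content nu ?T (Suc n) = 0" unfolding ssyt_content_def using nu by (auto simp: card_eq_0_iff)
      then show ?thesis unfolding c' by auto
    qed
    ultimately show ?thesis using TS' ext by (simp add: gT ssyts_def)
  qed
  show ?thesis
  proof (rule bij_betw_byWitness[of _ g])
    show "\<forall>p\<in>?A. g (?f p) = p" using f by blast
    show "\<forall>T\<in>ssyts mu c. ?f (g T) = T" using h by blast
    show "?f ` ?A \<subseteq> ssyts mu c" using f by blast
    show "g ` ssyts mu c \<subseteq> ?A" using h by blast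
  qed
qed

lemma finite_ssyts: "finite (ssyts mu c)" if "\<forall>k>n. c k = 0"
proof -
  have "ssyts mu c \<subseteq> diagram mu \<rightarrow>\<^sub>E {..n}"
  proof
    fix T assume T: "T \<in> ssyts mu c"
    then have "T \<in> extensional (diagram mu)" by (intro SSYT_ext) (simp add: ssyts_def)
    then show "T \<in> diagram mu \<rightarrow>\<^sub>E {..n}" using ssyts_le[OF T _ that] by (auto simp: PiE_def)
  qed
  then show ?thesis by (rule finite_subset) (simp add: finite_PiE)
qed

text \<open>The branching rule of Schur functions. The smaller shapes with \<open>n + 1\<close> rows do not contribute,
  by \<open>ssyts_empty\<close>.\<close>
lemma ssyts_branching:
  assumes c: "\<forall>k>Suc n. c k = 0" and mu: "mu \<in> in_box q (Suc n)"
  shows "card (ssyts mu c) =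
     (\<Sum>nu\<in>in_box q n. if falling_pair 0 mu nu \<and> card (skew mu nu) = c (Suc n) then card (ssyts nu (c(Suc n := 0))) else 0)"
proof -
  let ?c = "c(Suc n := 0)"
  let ?F = "{nu. falling_pair 0 mu nu \<and> card (skew mu nu) = c (Suc n)}"
  have c': "\<forall>k>n. ?c k = 0" using c by (auto simp: less_Suc_eq_le Suc_le_eq nat_less_le)
  have F: "?F \<subseteq> in_box q (Suc n)"
  proof
    fix nu assume "nu \<in> ?F"
    then have le: "part nu i \<le> part mu i" if "1 \<le> i" for i using that by (simp add: falling_pair_iff)
    have "part nu 1 \<le> q" using le[of 1] mu by (simp add: in_box_def)
    moreover have "part nu i = 0" if "Suc n < i" for i
      using le[of i] mu that by (simp add: in_box_def)
    ultimately show "nu \<in> in_box q (Suc n)" by (simp add: in_box_def)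
  qed
  then have fin: "finite ?F" by (rule finite_subset) simp
  have "card (ssyts mu c) = card (SIGMA nu : ?F. ssyts nu ?c)"
    using bij_betw_same_card[OF bij_ssyt_extend[OF c, of mu]] by simp
  also have "\<dots> = (\<Sum>nu\<in>?F. card (ssyts nu ?c))"
    using fin finite_ssyts[OF c'] by (intro card_SigmaI) blast+
  also have "\<dots> = (\<Sum>nu\<in>in_box q (Suc n). if nu \<in> ?F then card (ssyts nu ?c) else 0)"
    using F by (simp add: sum.If_cases Int_absorb1 Collect_conj_eq[symmetric] inf.absorb2)
  also have "\<dots> = (\<Sum>nu\<in>in_box q n. if nu \<in> ?F then card (ssyts nu ?c) else 0)"
  proof (rule sum.mono_neutral_right)
    show "in_box q n \<subseteq> in_box q (Suc n)" by (auto simp: in_box_def)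
    show "\<forall>nu\<in>in_box q (Suc n) - in_box q n. (if nu \<in> ?F then card (ssyts nu ?c) else 0) = 0"
    proof
      fix nu assume "nu \<in> in_box q (Suc n) - in_box q n"
      then have "part nu 1 \<le> q" "\<forall>i>Suc n. part nu i = 0" "nu \<notin> in_box q n"
        by (simp_all add: in_box_def)
      then have "part nu (Suc n) \<noteq> 0"
        unfolding in_box_def using Suc_lessI[of n] by blast
      with c' have "ssyts nu ?c = {}" by (rule ssyts_empty)
      then show "(if nu \<in> ?F then card (ssyts nu ?c) else 0) = 0" unfolding \<open>ssyts nu ?c = {}\<close> by simp
    qed
  qed simp
  finally show ?thesis by simp
qed

section \<open>Uniqueness of Schur expansions\<close>

lemma sum_eq_if_same_fibres:
  fixes f :: "'a \<Rightarrow> nat" and g :: "'b \<Rightarrow> nat" and h :: "nat \<Rightarrow> nat"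
  assumes fin: "finite A" "finite B" and "\<And>k. card {a \<in> A. f a = k} = card {b \<in> B. g b = k}"
  shows "(\<Sum>a\<in>A. h (f a)) = (\<Sum>b\<in>B. h (g b))"
proof -
  have im: "f ` A = g ` B"
  proof -
    have "f ` A = {k. card {a \<in> A. f a = k} \<noteq> 0}" using fin by (auto simp: card_eq_0_iff)
    moreover have "g ` B = {k. card {b \<in> B. g b = k} \<noteq> 0}" using fin by (auto simp: card_eq_0_iff)
    ultimately show ?thesis using assms(3) by simp
  qed
  have "(\<Sum>a\<in>A. h (f a)) = (\<Sum>k\<in>f ` A. \<Sum>a\<in>{a \<in> A. f a = k}. h (f a))"
    by (rule sum.image_gen[OF fin(1)])
  also have "\<dots> = (\<Sum>k\<in>f ` A. card {a \<in> A. f a = k} * h k)" by (rule sum.cong) auto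
  also have "\<dots> = (\<Sum>k\<in>g ` B. card {b \<in> B. g b = k} * h k)" using im assms(3) by simp
  also have "\<dots> = (\<Sum>k\<in>g ` B. \<Sum>b\<in>{b \<in> B. g b = k}. h (g b))" by (rule sum.cong) auto
  also have "\<dots> = (\<Sum>b\<in>B. h (g b))" by (rule sum.image_gen[OF fin(2), symmetric])
  finally show ?thesis .
qed

lemma card_row_boxes: "card {b \<in> diagram mu. fst b = k} = part mu k"
proof -
  have "{b \<in> diagram mu. fst b = k} = {k} \<times> {1..part mu k}" if "k \<noteq> 0"
    using that by (auto simp: diagram_iff)
  moreover have "{b \<in> diagram mu. fst b = 0} = {}" by (auto simp: diagram_iff)
  ultimately show ?thesis by (cases "k = 0") (auto simp: card_cartesian_product)
qed

text \<open>Unitriangularity of the Kostka matrix. As the entries in row \<open>i\<close> are at least \<open>i\<close>, the sum of the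
  row indices over the boxes of \<open>\<nu>\<close> is at most the sum of all entries. The latter depends only on the
  content and is the sum of the row indices over \<open>\<mu>\<close>. Equality forces every entry to be its row
  index.\<close>
lemma ssyts_of_part:
  assumes T: "T \<in> ssyts nu (part mu)"
  shows "(\<Sum>b\<in>diagram nu. fst b) \<le> (\<Sum>b\<in>diagram mu. fst b)"
    and "(\<Sum>b\<in>diagram nu. fst b) = (\<Sum>b\<in>diagram mu. fst b) \<Longrightarrow> nu = mu \<and> T = restrict fst (diagram mu)"
proof -
  have TS: "T \<in> SSYT nu" and cT: "\<And>k. card {b \<in> diagram nu. T b = k} = part mu k"
    using T ssyts_content[OF T] by (simp_all add: ssyts_def)
  have sum: "(\<Sum>b\<in>diagram nu. T b) = (\<Sum>b\<in>diagram mu. fst b)"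
    by (rule sum_eq_if_same_fibres[where h = "\<lambda>x. x"]) (simp_all add: cT card_row_boxes)
  have ge: "fst b \<le> T b" if "b \<in> diagram nu" for b
    using SSYT_ge_row[OF TS, of "fst b" "snd b"] that by simp
  show "(\<Sum>b\<in>diagram nu. fst b) \<le> (\<Sum>b\<in>diagram mu. fst b)"
    unfolding sum[symmetric] by (rule sum_mono) (rule ge)
  assume eq: "(\<Sum>b\<in>diagram nu. fst b) = (\<Sum>b\<in>diagram mu. fst b)"
  have Tb: "T b = fst b" if "b \<in> diagram nu" for b
  proof (rule ccontr)
    assume "T b \<noteq> fst b"
    then have "(\<Sum>b\<in>diagram nu. fst b) < (\<Sum>b\<in>diagram nu. T b)"
      using ge that by (intro sum_strict_mono_ex1) (auto intro!: bexI[of _ b] simp: nat_less_le)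
    then show False using eq sum by simp
  qed
  have "part nu k = part mu k" for k
  proof -
    have "{b \<in> diagram nu. T b = k} = {b \<in> diagram nu. fst b = k}" using Tb by auto
    then show ?thesis using cT[of k] card_row_boxes[of nu k] by simp
  qed
  then have "nu = mu" by (intro part_eqI) simp
  moreover have "T = restrict fst (diagram nu)"
    by (rule extensionalityI[OF SSYT_ext[OF TS]]) (simp_all add: Tb)
  ultimately show "nu = mu \<and> T = restrict fst (diagram mu)" by simp
qed

lemma ssyts_part_self: "ssyts mu (part mu) = {restrict fst (diagram mu)}"
proof -
  let ?T = "restrict fst (diagram mu)"
  have "?T \<in> SSYT mu" by (rule SSYT_I) (auto simp: diagram_iff)
  moreover have "ssyt_content mu ?T = part mu"
  proof
    fix k
    have "{b \<in> diagram mu. ?T b = k} = {b \<in> diagram mu. fst b = k}" by auto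
    then show "ssyt_content mu ?T k = part mu k" by (simp add: ssyt_content_def card_row_boxes)
  qed
  ultimately have "?T \<in> ssyts mu (part mu)" by (simp add: ssyts_def)
  then show ?thesis using ssyts_of_part(2)[of _ mu mu] by blast
qed

lemma schur_ssyts: "schur mu g = of_nat (card (ssyts mu (Poly_Mapping.lookup g)))"
  by (simp add: schur_def ssyts_def)

lemma part_in_box_card: "lam \<in> in_box (card (diagram lam)) (card (diagram lam))"
proof -
  have "{1} \<times> {1..part lam 1} \<subseteq> diagram lam" by (auto simp: diagram_iff)
  from card_mono[OF _ this] have "part lam 1 \<le> card (diagram lam)" by simp
  moreover have "i \<le> card (diagram lam)" if "part lam i \<noteq> 0" for i
  proof -
    have "i \<noteq> 0" using that by (metis part_0)
    have "{1..i} \<times> {1} \<subseteq> diagram lam"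
      using part_antimono[of _ i lam] that by (auto simp: diagram_iff Suc_le_eq) (metis le_zero_eq neq0_conv)
    from card_mono[OF _ this] show ?thesis by simp
  qed
  then have "\<forall>i>card (diagram lam). part lam i = 0" using not_le by blast
  ultimately show ?thesis unfolding in_box_def by blast
qed

lemma finite_schur_support: "finite {mu. schur mu g \<noteq> 0}"
proof -
  define s where "s = (\<Sum>k\<in>Poly_Mapping.keys g. Poly_Mapping.lookup g k)"
  have "{mu. schur mu g \<noteq> 0} \<subseteq> in_box s s"
  proof
    fix mu assume "mu \<in> {mu. schur mu g \<noteq> 0}"
    then have "ssyts mu (Poly_Mapping.lookup g) \<noteq> {}" by (auto simp: schur_ssyts)
    then obtain T where T: "T \<in> ssyts mu (Poly_Mapping.lookup g)" by blast
    have "card (diagram mu) = (\<Sum>b\<in>diagram mu. 1)" by simp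
    also have "\<dots> = (\<Sum>k\<in>T ` diagram mu. \<Sum>b\<in>{b \<in> diagram mu. T b = k}. 1)"
      by (rule sum.image_gen) simp
    also have "\<dots> = (\<Sum>k\<in>T ` diagram mu. Poly_Mapping.lookup g k)"
      by (intro sum.cong refl) (simp add: ssyts_content[OF T])
    also have "\<dots> \<le> s" unfolding s_def
      by (rule sum_mono2) (use ssyts_content_pos[OF T] in \<open>auto simp: in_keys_iff\<close>)
    finally have "card (diagram mu) \<le> s" .
    then show "mu \<in> in_box s s" using part_in_box_card[of mu] by (auto simp: in_box_def)
  qed
  then show ?thesis by (rule finite_subset) simp
qed

text \<open>Among the partitions where two expansions differ, take \<open>\<mu>\<close> with minimal sum of row indices. By
  \<open>ssyts_of_part\<close>, the coefficient of \<open>x^\<mu>\<close> in the difference only involves \<open>\<mu>\<close> itself, with Kostka number 1.\<close>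
lemma schur_expansion_unique:
  assumes c: "schur_expansion F c" and d: "schur_expansion F d"
  shows "c = d"
proof (rule ccontr)
  assume "c \<noteq> d"
  then have ex: "\<exists>mu. c mu \<noteq> d mu" by auto
  define n where "n mu = (\<Sum>b\<in>diagram mu. fst b)" for mu
  obtain mu where mu: "c mu \<noteq> d mu" and min: "\<And>nu. c nu \<noteq> d nu \<Longrightarrow> n mu \<le> n nu"
    using ex_has_least_nat[of "\<lambda>mu. c mu \<noteq> d mu" _ n] ex by blast
  define g where "g = Abs_poly_mapping (part mu)"
  have g: "Poly_Mapping.lookup g = part mu"
    unfolding g_def by (rule lookup_Abs_poly_mapping) (rule finite_part)
  have fin: "finite {nu. e nu * schur nu g \<noteq> 0}" for e
    by (rule finite_subset[OF _ finite_schur_support[of g]]) auto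
  have "Sum_any (\<lambda>nu. (c nu - d nu) * schur nu g) = Sum_any (\<lambda>nu. c nu * schur nu g + (- d nu) * schur nu g)"
    by (simp add: algebra_simps)
  also have "\<dots> = Sum_any (\<lambda>nu. c nu * schur nu g) + Sum_any (\<lambda>nu. (- d nu) * schur nu g)"
    by (rule Sum_any.distrib) (rule fin)+
  also have "Sum_any (\<lambda>nu. (- d nu) * schur nu g) = - Sum_any (\<lambda>nu. d nu * schur nu g)"
    by (simp add: Sum_any.expand_set sum_negf)
  also have "Sum_any (\<lambda>nu. c nu * schur nu g) = Sum_any (\<lambda>nu. d nu * schur nu g)"
    using c d unfolding schur_expansion_def by metis
  finally have "Sum_any (\<lambda>nu. (c nu - d nu) * schur nu g) = 0" by simp
  moreover have "Sum_any (\<lambda>nu. (c nu - d nu) * schur nu g) = (\<Sum>nu\<in>{mu}. (c nu - d nu) * schur nu g)"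
  proof (rule Sum_any.expand_superset)
    show "{nu. (c nu - d nu) * schur nu g \<noteq> 0} \<subseteq> {mu}"
    proof
      fix nu assume "nu \<in> {nu. (c nu - d nu) * schur nu g \<noteq> 0}"
      then have "c nu \<noteq> d nu" "schur nu g \<noteq> 0" by auto
      then have "ssyts nu (part mu) \<noteq> {}" by (auto simp: schur_ssyts g)
      then obtain T where T: "T \<in> ssyts nu (part mu)" by blast
      have "n nu = n mu" using min[OF \<open>c nu \<noteq> d nu\<close>] ssyts_of_part(1)[OF T] by (simp add: n_def)
      then show "nu \<in> {mu}" using ssyts_of_part(2)[OF T] by (simp add: n_def)
    qed
  qed simp
  moreover have "schur mu g = 1" by (simp add: schur_ssyts g ssyts_part_self)
  ultimately show False using mu by simp
qed

section \<open>Removing the largest letter of a set-valued reverse plane partition\<close>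

lemma SVRPP_ext: "T \<in> SVRPP lam \<Longrightarrow> T \<in> extensional (diagram lam)"
  by (simp add: SVRPP_def PiE_def)

lemma SVRPP_box:
  assumes "T \<in> SVRPP lam" "b \<in> diagram lam"
  shows "finite (T b)" "T b \<noteq> {}" "T b \<subseteq> {1..}"
proof -
  have "T \<in> diagram lam \<rightarrow>\<^sub>E {A. finite A \<and> A \<noteq> {} \<and> A \<subseteq> {1..}}"
    using assms(1) by (simp add: SVRPP_def)
  then have "T b \<in> {A. finite A \<and> A \<noteq> {} \<and> A \<subseteq> {1..}}" using assms(2) by (rule PiE_mem)
  then show "finite (T b)" "T b \<noteq> {}" "T b \<subseteq> {1..}" by auto
qed

lemma SVRPP_row:
  "T \<in> SVRPP lam \<Longrightarrow> (i, j) \<in> diagram lam \<Longrightarrow> (i, j') \<in> diagram lam \<Longrightarrow> j < j' \<Longrightarrow> Max (T (i, j)) \<le> Min (T (i, j'))"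
  unfolding SVRPP_def set_le_def by blast

lemma SVRPP_col:
  "T \<in> SVRPP lam \<Longrightarrow> (i, j) \<in> diagram lam \<Longrightarrow> (i', j) \<in> diagram lam \<Longrightarrow> i < i' \<Longrightarrow> Max (T (i, j)) \<le> Min (T (i', j))"
  unfolding SVRPP_def set_le_def by blast

lemma SVRPP_I:
  assumes "T \<in> extensional (diagram lam)"
    "\<And>b. b \<in> diagram lam \<Longrightarrow> finite (T b) \<and> T b \<noteq> {} \<and> T b \<subseteq> {1..}"
    "\<And>i j j'. (i, j) \<in> diagram lam \<Longrightarrow> (i, j') \<in> diagram lam \<Longrightarrow> j < j' \<Longrightarrow> Max (T (i, j)) \<le> Min (T (i, j'))"
    "\<And>i i' j. (i, j) \<in> diagram lam \<Longrightarrow> (i', j) \<in> diagram lam \<Longrightarrow> i < i' \<Longrightarrow> Max (T (i, j)) \<le> Min (T (i', j))"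
  shows "T \<in> SVRPP lam"
proof -
  have "T \<in> diagram lam \<rightarrow>\<^sub>E {A. finite A \<and> A \<noteq> {} \<and> A \<subseteq> {1..}}"
    using assms(1,2) by (simp add: PiE_def)
  then show ?thesis unfolding SVRPP_def set_le_def using assms(3,4) by blast
qed

text \<open>Weak monotonicity towards the south-east: the conditions on rows and columns compare distinct
  boxes only, and a path through the box \<open>(i', j)\<close> combines them.\<close>
lemma SVRPP_le:
  assumes T: "T \<in> SVRPP lam" and b: "(i, j) \<in> diagram lam" and "1 \<le> i'" "i' \<le> i" "1 \<le> j'" "j' \<le> j"
    and ne: "(i', j') \<noteq> (i, j)" and k: "k \<in> T (i', j')" and k': "k' \<in> T (i, j)"
  shows "k \<le> k'"
proof -
  have b': "(i', j') \<in> diagram lam" and b'': "(i', j) \<in> diagram lam"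
    using assms diagram_down[OF b, of i' j'] diagram_down[OF b, of i' j] by (auto simp: diagram_iff)
  note fin = SVRPP_box[OF T b'] SVRPP_box[OF T b''] SVRPP_box[OF T b]
  have "k \<le> Max (T (i', j'))" using fin k by simp
  also have "\<dots> \<le> Min (T (i, j))"
  proof (cases "j' = j")
    case True
    then show ?thesis using SVRPP_col[OF T b'' b] assms(4) ne by auto
  next
    case False
    then have r: "Max (T (i', j')) \<le> Min (T (i', j))" using SVRPP_row[OF T b' b''] assms by simp
    show ?thesis
    proof (cases "i' = i")
      case False
      have "Min (T (i', j)) \<le> Max (T (i', j))" using fin by simp
      also have "\<dots> \<le> Min (T (i, j))" using SVRPP_col[OF T b'' b] assms(4) False by simp
      finally show ?thesis using r by simp
    qed (use r in simp)
  qed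
  also have "\<dots> \<le> k'" using fin k' by simp
  finally show ?thesis .
qed

definition svrpps :: "integer_partition \<Rightarrow> (nat \<Rightarrow> nat) \<Rightarrow> (nat \<times> nat \<Rightarrow> nat set) set" where
  "svrpps lam c = {T \<in> SVRPP lam. ircont lam T = c}"

lemma finite_columns: "finite {j. \<exists>i. (i, j) \<in> diagram lam \<and> P i j}"
  by (rule finite_subset[of _ "snd ` diagram lam"]) (auto intro: rev_image_eqI)

lemma svrpps_le:
  assumes T: "T \<in> svrpps lam c" and b: "b \<in> diagram lam" and c: "\<forall>k>n. c k = 0" and k: "k \<in> T b"
  shows "k \<le> n"
proof (rule ccontr)
  assume "\<not> k \<le> n"
  then have "card {j. \<exists>i. (i, j) \<in> diagram lam \<and> k \<in> T (i, j)} = 0"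
    using T c unfolding svrpps_def ircont_def by (auto simp: fun_eq_iff)
  then have "{j. \<exists>i. (i, j) \<in> diagram lam \<and> k \<in> T (i, j)} = {}"
    using finite_columns[of lam "\<lambda>i j. k \<in> T (i, j)"] by simp
  then show False using b k by (cases b) auto
qed

lemma finite_svrpps: "finite (svrpps lam c)" if "\<forall>k>n. c k = 0"
proof -
  have "svrpps lam c \<subseteq> diagram lam \<rightarrow>\<^sub>E Pow {..n}"
  proof
    fix T assume T: "T \<in> svrpps lam c"
    then have "T \<in> extensional (diagram lam)" by (intro SVRPP_ext) (simp add: svrpps_def)
    then show "T \<in> diagram lam \<rightarrow>\<^sub>E Pow {..n}" using svrpps_le[OF T _ that] by (auto simp: PiE_def)
  qed
  then show ?thesis by (rule finite_subset) (simp add: finite_PiE)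
qed

definition corner_rows :: "integer_partition \<Rightarrow> nat set" where
  "corner_rows alpha = {i. 1 \<le> i \<and> part alpha (Suc i) < part alpha i}"

definition row_ends :: "integer_partition \<Rightarrow> nat set \<Rightarrow> (nat \<times> nat) set" where
  "row_ends alpha R = (\<lambda>i. (i, part alpha i)) ` R"

text \<open>The boxes that hold the letter \<open>N\<close> after it has been added.\<close>
definition new_boxes :: "integer_partition \<Rightarrow> integer_partition \<Rightarrow> nat set \<Rightarrow> (nat \<times> nat) set" where
  "new_boxes lam alpha R = (diagram lam - diagram alpha) \<union> row_ends alpha R"

text \<open>Every tableau with largest letter at most \<open>N\<close> arises from one with letters less than \<open>N\<close> in exactly
  one way like this (\<open>bij_add_letter\<close>); \<open>R\<close> records which corners of \<open>\<alpha>\<close> hold \<open>N\<close> besides other letters.\<close>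
definition add_letter :: "nat \<Rightarrow> integer_partition \<Rightarrow> integer_partition \<Rightarrow> nat set \<Rightarrow> (nat \<times> nat \<Rightarrow> nat set) \<Rightarrow> nat \<times> nat \<Rightarrow> nat set" where
  "add_letter N lam alpha R T = restrict (\<lambda>b. if b \<notin> diagram alpha then {N}
      else if b \<in> row_ends alpha R then insert N (T b) else T b) (diagram lam)"

lemma row_ends_iff: "(i, j) \<in> row_ends alpha R \<longleftrightarrow> i \<in> R \<and> j = part alpha i"
  by (auto simp: row_ends_def)

context
  fixes N :: nat and lam alpha :: integer_partition and R :: "nat set" and T :: "nat \<times> nat \<Rightarrow> nat set"
  assumes N: "1 \<le> N" and sub: "diagram alpha \<subseteq> diagram lam" and R: "R \<subseteq> corner_rows alpha"
    and T: "T \<in> SVRPP alpha" and below: "\<forall>b\<in>diagram alpha. \<forall>k\<in>T b. k < N"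
begin

abbreviation (input) "G \<equiv> add_letter N lam alpha R T"

lemma less: "b \<in> diagram alpha \<Longrightarrow> k \<in> T b \<Longrightarrow> k < N"
  using below by blast

text \<open>No box of \<open>\<alpha>\<close> lies weakly south-east of a corner, so adding a large letter there violates no
  inequality within \<open>\<alpha>\<close>.\<close>
lemma row_ends_corner:
  assumes "(i, j) \<in> row_ends alpha R"
  shows "(i, j) \<in> diagram alpha" "\<And>i' j'. (i', j') \<in> diagram alpha \<Longrightarrow> i \<le> i' \<Longrightarrow> j \<le> j' \<Longrightarrow> (i', j') = (i, j)"
proof -
  have i: "i \<in> corner_rows alpha" "j = part alpha i" using assms R by (auto simp: row_ends_iff)
  then show "(i, j) \<in> diagram alpha" by (auto simp: corner_rows_def diagram_iff)
  fix i' j' assume b: "(i', j') \<in> diagram alpha" "i \<le> i'" "j \<le> j'"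
  have "i' = i"
  proof (rule ccontr)
    assume "i' \<noteq> i"
    then have "part alpha i' \<le> part alpha (Suc i)" using b by (intro part_antimono) auto
    then show False using i b by (auto simp: corner_rows_def diagram_iff)
  qed
  then show "(i', j') = (i, j)" using i b by (auto simp: diagram_iff)
qed

lemma add_letter_out: "b \<in> diagram lam \<Longrightarrow> b \<notin> diagram alpha \<Longrightarrow> G b = {N}"
  by (simp add: add_letter_def)

lemma add_letter_end: "b \<in> row_ends alpha R \<Longrightarrow> G b = insert N (T b)"
  using row_ends_corner(1)[of "fst b" "snd b"] sub by (auto simp: add_letter_def)

lemma add_letter_in: "b \<in> diagram alpha \<Longrightarrow> b \<notin> row_ends alpha R \<Longrightarrow> G b = T b"
  using sub by (auto simp: add_letter_def)

lemma in_add_letter_iff: "b \<in> diagram lam \<Longrightarrow> N \<in> G b \<longleftrightarrow> b \<in> new_boxes lam alpha R"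
  using less[of b N] by (auto simp: add_letter_def new_boxes_def)

lemma add_letter_minus: "b \<in> diagram alpha \<Longrightarrow> G b - {N} = T b"
  using less[of b N] sub by (auto simp: add_letter_def)

lemma add_letter_box: "b \<in> diagram lam \<Longrightarrow> finite (G b) \<and> G b \<noteq> {} \<and> G b \<subseteq> {1..N}"
proof -
  assume b: "b \<in> diagram lam"
  show ?thesis
  proof (cases "b \<in> diagram alpha")
    case True
    have "T b \<subseteq> {1..N}"
    proof
      fix k assume k: "k \<in> T b"
      have "k < N" using True k by (rule less)
      then show "k \<in> {1..N}" using SVRPP_box(3)[OF T True] k by auto
    qed
    then show ?thesis using SVRPP_box(1,2)[OF T True] b N True by (auto simp: add_letter_def)
  qed (use b N in \<open>simp add: add_letter_out\<close>)
qed

lemma add_letter_le: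
  assumes b: "(i, j) \<in> diagram lam" "(i', j') \<in> diagram lam" "i \<le> i'" "j \<le> j'" "(i, j) \<noteq> (i', j')"
  shows "Max (G (i, j)) \<le> Min (G (i', j'))"
proof -
  have "k \<le> k'" if k: "k \<in> G (i, j)" and k': "k' \<in> G (i', j')" for k k'
  proof (cases "(i', j') \<in> diagram alpha")
    case False
    then show ?thesis using k k' add_letter_box[OF b(1)] b by (auto simp: add_letter_out)
  next
    case True
    then have a: "(i, j) \<in> diagram alpha"
      using b by (intro diagram_down[OF True]) (auto simp: diagram_iff)
    have "(i, j) \<notin> row_ends alpha R" using row_ends_corner(2)[of i j i' j'] True b by auto
    then have kT: "k \<in> T (i, j)" using k a by (simp add: add_letter_in)
    show ?thesis
    proof (cases "k' = N")
      case True
      then show ?thesis using less[OF a kT] by simp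
    next
      case False
      then have "k' \<in> T (i', j')" using k' add_letter_minus[OF True] by blast
      then show ?thesis using SVRPP_le[OF T True _ b(3) _ b(4) b(5) kT] a by (simp add: diagram_iff)
    qed
  qed
  then show ?thesis using add_letter_box[OF b(1)] add_letter_box[OF b(2)] by simp
qed

lemma add_letter_SVRPP: "G \<in> SVRPP lam"
proof (rule SVRPP_I)
  show "finite (G b) \<and> G b \<noteq> {} \<and> G b \<subseteq> {1..}" if "b \<in> diagram lam" for b
    using add_letter_box[OF that] by auto
  show "G \<in> extensional (diagram lam)" by (simp add: add_letter_def)
qed (auto intro!: add_letter_le)

lemma ircont_add_letter:
  "ircont lam G k = (if k = N then card (snd ` new_boxes lam alpha R) else ircont alpha T k)"
proof (cases "k = N")
  case True
  have "{j. \<exists>i. (i, j) \<in> diagram lam \<and> N \<in> G (i, j)} = snd ` new_boxes lam alpha R"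
  proof (intro equalityI subsetI)
    fix j assume "j \<in> {j. \<exists>i. (i, j) \<in> diagram lam \<and> N \<in> G (i, j)}"
    then obtain i where "(i, j) \<in> diagram lam" "N \<in> G (i, j)" by blast
    then have "(i, j) \<in> new_boxes lam alpha R" by (simp add: in_add_letter_iff)
    then show "j \<in> snd ` new_boxes lam alpha R" by force
  next
    fix j assume "j \<in> snd ` new_boxes lam alpha R"
    then obtain i where i: "(i, j) \<in> new_boxes lam alpha R" by force
    then have "(i, j) \<in> diagram lam" using row_ends_corner(1) sub by (auto simp: new_boxes_def)
    then show "j \<in> {j. \<exists>i. (i, j) \<in> diagram lam \<and> N \<in> G (i, j)}" using i in_add_letter_iff by blast
  qed
  then show ?thesis using True by (simp add: ircont_def)
next
  case False
  have "{j. \<exists>i. (i, j) \<in> diagram lam \<and> k \<in> G (i, j)} = {j. \<exists>i. (i, j) \<in> diagram alpha \<and> k \<in> T (i, j)}"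
  proof -
    have "(b \<in> diagram lam \<and> k \<in> G b) \<longleftrightarrow> (b \<in> diagram alpha \<and> k \<in> T b)" for b
      using False sub add_letter_minus[of b] add_letter_out[of b] by auto
    then show ?thesis by simp
  qed
  then show ?thesis using False by (simp add: ircont_def)
qed

lemma excess_add_letter: "excess lam G i = excess alpha T i + (if i \<in> R then 1 else 0)"
proof -
  let ?A = "{j. (i, j) \<in> diagram alpha}" and ?L = "{j. (i, j) \<in> diagram lam}"
  have fin: "finite {j. (i, j) \<in> diagram x}" for x
    by (rule finite_subset[of _ "{..part x i}"]) (auto simp: diagram_iff)
  have "excess lam G i = (\<Sum>j\<in>?L. card (G (i, j)) - 1)" by (simp add: excess_def)
  also have "\<dots> = (\<Sum>j\<in>?A. card (G (i, j)) - 1)"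
    using sub by (intro sum.mono_neutral_right fin) (auto simp: add_letter_out)
  also have "\<dots> = (\<Sum>j\<in>?A. (card (T (i, j)) - 1) + (if (i, j) \<in> row_ends alpha R then 1 else 0))"
  proof (rule sum.cong[OF refl])
    fix j assume "j \<in> ?A"
    then have b: "(i, j) \<in> diagram alpha" by simp
    have "N \<notin> T (i, j)" using less[OF b, of N] by auto
    moreover have "card (T (i, j)) \<noteq> 0" using SVRPP_box(1,2)[OF T b] by simp
    ultimately show "card (G (i, j)) - 1 = (card (T (i, j)) - 1) + (if (i, j) \<in> row_ends alpha R then 1 else 0)"
      using SVRPP_box(1,2)[OF T b] by (auto simp: add_letter_end add_letter_in b Suc_pred card_gt_0_iff)
  qed
  also have "\<dots> = excess alpha T i + card {j \<in> ?A. (i, j) \<in> row_ends alpha R}"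
    by (simp add: sum.distrib excess_def sum.If_cases fin Int_def)
  also have "{j \<in> ?A. (i, j) \<in> row_ends alpha R} = (if i \<in> R then {part alpha i} else {})"
    using row_ends_corner(1)[of i] by (auto simp: row_ends_iff)
  finally show ?thesis by simp
qed

text \<open>Adding the letter leaves the vertical equalities inside \<open>\<alpha>\<close> unchanged. The new ones have their
  lower box in \<open>\<lambda>/\<alpha>\<close>, where the only letter is \<open>N\<close>.\<close>
lemma ceq_add_letter:
  "ceq lam G i = ceq alpha T i
     + card {j. (i, j) \<in> new_boxes lam alpha R \<and> (Suc i, j) \<in> diagram lam - diagram alpha}"
proof -
  let ?A = "{j. (i, j) \<in> diagram alpha \<and> (i + 1, j) \<in> diagram alpha \<and> Max (T (i, j)) = Min (T (i + 1, j))}"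
  let ?B = "{j. (i, j) \<in> new_boxes lam alpha R \<and> (Suc i, j) \<in> diagram lam - diagram alpha}"
  have fin: "finite ?A" "finite ?B"
    by (rule finite_subset[of _ "{..part lam (Suc i)}"], use sub in \<open>auto simp: diagram_iff subset_iff\<close>)+
  have new_lam: "(i, j) \<in> diagram lam" if "(i, j) \<in> new_boxes lam alpha R" for j
    using that row_ends_corner(1) sub by (auto simp: new_boxes_def)
  have "(i, j) \<in> diagram lam \<and> (i + 1, j) \<in> diagram lam \<and> Max (G (i, j)) = Min (G (i + 1, j))
     \<longleftrightarrow> j \<in> ?A \<union> ?B" for j
  proof (cases "(i, j) \<in> diagram lam \<and> (Suc i, j) \<in> diagram lam")
    case False
    then show ?thesis using sub new_lam by auto
  next
    case True
    note l = True
    show ?thesis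
    proof (cases "(Suc i, j) \<in> diagram alpha")
      case True
      then have a: "(i, j) \<in> diagram alpha"
        using l by (intro diagram_down[OF True]) (auto simp: diagram_iff)
      have "(i, j) \<notin> row_ends alpha R" using row_ends_corner(2)[of i j "Suc i" j] True by auto
      then have "G (i, j) = T (i, j)" using a by (rule add_letter_in[rotated])
      moreover have "Min (G (Suc i, j)) = Min (T (Suc i, j))"
      proof (cases "(Suc i, j) \<in> row_ends alpha R")
        case e: True
        have "Min (T (Suc i, j)) < N" using less[OF True] SVRPP_box(1,2)[OF T True] by simp
        then show ?thesis using SVRPP_box(1,2)[OF T True] unfolding add_letter_end[OF e] by (subst Min_insert) simp_all
      qed (simp add: add_letter_in True)
      ultimately show ?thesis using l a True by simp
    next
      case False
      then have "Min (G (Suc i, j)) = N" using l by (simp add: add_letter_out)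
      moreover have "Max (G (i, j)) = N \<longleftrightarrow> N \<in> G (i, j)"
      proof -
        have g: "finite (G (i, j))" "G (i, j) \<noteq> {}" "G (i, j) \<subseteq> {1..N}" using add_letter_box l by auto
        show ?thesis
        proof
          assume "Max (G (i, j)) = N"
          then show "N \<in> G (i, j)" using Max_in[OF g(1,2)] by simp
        next
          assume "N \<in> G (i, j)"
          then show "Max (G (i, j)) = N" using g by (intro Max_eqI) auto
        qed
      qed
      ultimately show ?thesis using l False in_add_letter_iff by simp
    qed
  qed
  then have "ceq lam G i = card (?A \<union> ?B)" unfolding ceq_def by (intro arg_cong[where f = card]) blast
  also have "\<dots> = card ?A + card ?B" by (rule card_Un_disjoint[OF fin]) auto
  finally show ?thesis by (simp add: ceq_def)
qed

end

text \<open>The inverse of \<open>add_letter\<close>.\<close>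
definition drop_letter :: "nat \<Rightarrow> integer_partition \<Rightarrow> (nat \<times> nat \<Rightarrow> nat set) \<Rightarrow> (integer_partition \<times> nat set) \<times> (nat \<times> nat \<Rightarrow> nat set)" where
  "drop_letter N lam T = (let alpha = (THE alpha. diagram alpha = {b \<in> diagram lam. T b \<noteq> {N}}) in
     ((alpha, {i. \<exists>j. (i, j) \<in> diagram alpha \<and> N \<in> T (i, j)}), restrict (\<lambda>b. T b - {N}) (diagram alpha)))"

lemma drop_letter_eq:
  assumes "diagram alpha = {b \<in> diagram lam. T b \<noteq> {N}}"
  shows "drop_letter N lam T =
     ((alpha, {i. \<exists>j. (i, j) \<in> diagram alpha \<and> N \<in> T (i, j)}), restrict (\<lambda>b. T b - {N}) (diagram alpha))"
proof -
  have "(THE alpha. diagram alpha = {b \<in> diagram lam. T b \<noteq> {N}}) = alpha"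
    by (rule the_equality) (auto simp: assms[symmetric] intro: diagram_inj)
  then show ?thesis by (simp add: drop_letter_def)
qed

lemma drop_add_letter:
  assumes "1 \<le> N" "diagram alpha \<subseteq> diagram lam" "R \<subseteq> corner_rows alpha"
    and T: "T \<in> SVRPP alpha" and less: "\<forall>b\<in>diagram alpha. \<forall>k\<in>T b. k < N"
  shows "drop_letter N lam (add_letter N lam alpha R T) = ((alpha, R), T)"
proof -
  note a = assms(1-3) T less
  let ?G = "add_letter N lam alpha R T"
  have minus: "?G b - {N} = T b" if "b \<in> diagram alpha" for b by (rule add_letter_minus[OF a that])
  have d: "diagram alpha = {b \<in> diagram lam. ?G b \<noteq> {N}}"
  proof (intro equalityI subsetI)
    fix b assume b: "b \<in> diagram alpha"
    then show "b \<in> {b \<in> diagram lam. ?G b \<noteq> {N}}"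
      using minus[OF b] SVRPP_box(2)[OF T b] assms(2) by auto
  next
    fix b assume "b \<in> {b \<in> diagram lam. ?G b \<noteq> {N}}"
    then show "b \<in> diagram alpha" using add_letter_out[OF a, where b = b] by blast
  qed
  have "{i. \<exists>j. (i, j) \<in> diagram alpha \<and> N \<in> ?G (i, j)} = R"
  proof -
    have "(i, j) \<in> diagram alpha \<and> N \<in> ?G (i, j) \<longleftrightarrow> (i, j) \<in> row_ends alpha R" for i j
      using in_add_letter_iff[OF a, where b = "(i, j)"] row_ends_corner(1)[OF a, where i = i and j = j] assms(2) by (auto simp: new_boxes_def)
    then show ?thesis by (simp add: row_ends_iff)
  qed
  moreover have "restrict (\<lambda>b. ?G b - {N}) (diagram alpha) = T"
    by (rule extensionalityI[OF _ SVRPP_ext[OF T]]) (simp_all add: minus)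
  ultimately show ?thesis unfolding drop_letter_eq[OF d] by simp
qed

text \<open>If a box holds \<open>N\<close>, then all boxes to the south-east hold \<open>N\<close> only. Hence the boxes other than
  those with content \<open>{N}\<close> form a partition, and such a box holding \<open>N\<close> is one of its corners.\<close>
lemma add_drop_letter:
  assumes N: "1 \<le> N" and T: "T \<in> SVRPP lam" and le_N: "\<forall>b\<in>diagram lam. \<forall>k\<in>T b. k \<le> N"
  obtains alpha R T' where "drop_letter N lam T = ((alpha, R), T')" "diagram alpha \<subseteq> diagram lam"
    "R \<subseteq> corner_rows alpha" "T' \<in> SVRPP alpha" "\<forall>b\<in>diagram alpha. \<forall>k\<in>T' b. k < N"
    "add_letter N lam alpha R T' = T"
proof -
  have le: "k \<le> N" if "b \<in> diagram lam" "k \<in> T b" for b k using le_N that by blast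
  have big: "T (i, j) = {N}"
    if b: "(i, j) \<in> diagram lam" "1 \<le> i'" "i' \<le> i" "1 \<le> j'" "j' \<le> j" "(i', j') \<noteq> (i, j)" "N \<in> T (i', j')" for i j i' j'
  proof -
    have "k = N" if "k \<in> T (i, j)" for k
      using SVRPP_le[OF T b that] le[OF b(1) that] by simp
    then show ?thesis using SVRPP_box(2)[OF T b(1)] by auto
  qed
  have "\<exists>alpha. diagram alpha = {b \<in> diagram lam. T b \<noteq> {N}}"
  proof (rule ex_diagram[of _ lam])
    fix i j i' j' assume b: "(i, j) \<in> {b \<in> diagram lam. T b \<noteq> {N}}" "1 \<le> i'" "i' \<le> i" "1 \<le> j'" "j' \<le> (j::nat)"
    then have "(i', j') \<in> diagram lam" by (auto intro: diagram_down)
    moreover have "T (i', j') \<noteq> {N}" using big[of i j i' j'] b by (cases "(i', j') = (i, j)") auto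
    ultimately show "(i', j') \<in> {b \<in> diagram lam. T b \<noteq> {N}}" by simp
  qed auto
  then obtain alpha where alpha: "diagram alpha = {b \<in> diagram lam. T b \<noteq> {N}}" ..
  define R where "R = {i. \<exists>j. (i, j) \<in> diagram alpha \<and> N \<in> T (i, j)}"
  define T' where "T' = restrict (\<lambda>b. T b - {N}) (diagram alpha)"
  have sub: "diagram alpha \<subseteq> diagram lam" using alpha by blast
  have corner: "j = part alpha i \<and> i \<in> corner_rows alpha" if b: "(i, j) \<in> diagram alpha" "N \<in> T (i, j)" for i j
  proof -
    have ij: "1 \<le> i" "1 \<le> j" "j \<le> part alpha i" using b(1) by (auto simp: diagram_iff)
    have out: "(i', j') \<notin> diagram alpha" if "i \<le> i'" "j \<le> j'" "(i', j') \<noteq> (i, j)" for i' j'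
      using big[of i' j' i j] ij that b(2) unfolding alpha by auto
    have j: "j = part alpha i"
      using out[of i "Suc j"] ij by (fastforce simp: diagram_iff)
    moreover have "part alpha (Suc i) < part alpha i"
      using out[of "Suc i" j] ij unfolding j[symmetric] by (auto simp: diagram_iff)
    ultimately show ?thesis using ij by (simp add: corner_rows_def)
  qed
  have R_corner: "R \<subseteq> corner_rows alpha" unfolding R_def using corner by blast
  have ends: "b \<in> row_ends alpha R \<longleftrightarrow> b \<in> diagram alpha \<and> N \<in> T b" for b
  proof -
    obtain i j where b: "b = (i, j)" by (cases b)
    show ?thesis unfolding b row_ends_iff R_def using corner[of i] by auto
  qed
  have T'b: "T' b = T b - {N}" if "b \<in> diagram alpha" for b using that by (simp add: T'_def)
  have less: "k < N" if "b \<in> diagram alpha" "k \<in> T' b" for b k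
    using that le[of b k] sub by (auto simp: T'b nat_less_le)
  have ne: "T' b \<noteq> {}" if "b \<in> diagram alpha" for b
  proof -
    have "b \<in> diagram lam" "T b \<noteq> {N}" using that alpha by auto
    then show ?thesis using SVRPP_box(2)[OF T] unfolding T'b[OF that] by blast
  qed
  have T': "T' \<in> SVRPP alpha"
  proof (rule SVRPP_I)
    show "T' \<in> extensional (diagram alpha)" by (simp add: T'_def)
    show fin: "finite (T' b) \<and> T' b \<noteq> {} \<and> T' b \<subseteq> {1..}" if "b \<in> diagram alpha" for b
    proof -
      have "b \<in> diagram lam" using that sub by blast
      then show ?thesis using SVRPP_box[OF T, of b] ne[OF that] unfolding T'b[OF that] by blast
    qed
    have le: "Max (T' (i, j)) \<le> Min (T' (i', j'))"
      if b: "(i, j) \<in> diagram alpha" "(i', j') \<in> diagram alpha" "i \<le> i'" "j \<le> j'" "(i, j) \<noteq> (i', j')" for i j i' j'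
    proof -
      have "k \<le> k'" if "k \<in> T' (i, j)" "k' \<in> T' (i', j')" for k k'
        by (rule SVRPP_le[OF T, of i' j' i j]) (use b that sub in \<open>auto simp: T'b diagram_iff[of i j]\<close>)
      then show ?thesis using fin[OF b(1)] fin[OF b(2)] by simp
    qed
    show "Max (T' (i, j)) \<le> Min (T' (i, j'))" if "(i, j) \<in> diagram alpha" "(i, j') \<in> diagram alpha" "j < j'" for i j j'
      using that by (intro le) auto
    show "Max (T' (i, j)) \<le> Min (T' (i', j))" if "(i, j) \<in> diagram alpha" "(i', j) \<in> diagram alpha" "i < i'" for i i' j
      using that by (intro le) auto
  qed
  have "add_letter N lam alpha R T' = T"
  proof (rule extensionalityI[OF _ SVRPP_ext[OF T]])
    show "add_letter N lam alpha R T' \<in> extensional (diagram lam)" by (simp add: add_letter_def)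
    fix b assume b: "b \<in> diagram lam"
    show "add_letter N lam alpha R T' b = T b"
    proof (cases "b \<in> diagram alpha")
      case True
      then show ?thesis using b ends[of b] by (auto simp: add_letter_def T'b)
    next
      case False
      then have "T b = {N}" using b alpha by blast
      then show ?thesis using b False by (simp add: add_letter_def)
    qed
  qed
  moreover have "drop_letter N lam T = ((alpha, R), T')"
    unfolding drop_letter_eq[OF alpha] R_def T'_def ..
  ultimately show ?thesis using that[of alpha R T'] sub R_corner T' less by blast
qed

text \<open>The index set of the branching rule when the largest letter has exponent \<open>k\<close>.\<close>
definition strips :: "integer_partition \<Rightarrow> nat \<Rightarrow> (integer_partition \<times> nat set) set" where
  "strips lam k = {(alpha, R). diagram alpha \<subseteq> diagram lam \<and> R \<subseteq> corner_rows alpha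
      \<and> card (snd ` new_boxes lam alpha R) = k}"

lemma bij_add_letter:
  assumes c: "\<forall>k>Suc n. c k = 0"
  shows "bij_betw (\<lambda>((alpha, R), T). add_letter (Suc n) lam alpha R T)
     (SIGMA (alpha, R) : strips lam (c (Suc n)). svrpps alpha (c(Suc n := 0))) (svrpps lam c)"
    (is "bij_betw ?f ?A _")
proof -
  let ?N = "Suc n" and ?c = "c(Suc n := 0)"
  have N: "1 \<le> ?N" by simp
  have c': "\<forall>k>n. ?c k = 0" using c by (auto simp: less_Suc_eq_le Suc_le_eq nat_less_le)
  have f: "?f p \<in> svrpps lam c \<and> drop_letter ?N lam (?f p) = p" if p: "p \<in> ?A" for p
  proof -
    obtain alpha R T where e: "p = ((alpha, R), T)" by (cases p) auto
    have sub: "diagram alpha \<subseteq> diagram lam" and R: "R \<subseteq> corner_rows alpha"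
      and k: "card (snd ` new_boxes lam alpha R) = c ?N" and T: "T \<in> svrpps alpha ?c"
      using p by (auto simp: e strips_def)
    have TS: "T \<in> SVRPP alpha" and ir: "ircont alpha T = ?c" using T by (auto simp: svrpps_def)
    have less: "\<forall>b\<in>diagram alpha. \<forall>k\<in>T b. k < ?N"
      using svrpps_le[OF T _ c'] by (simp add: less_Suc_eq_le)
    have "ircont lam (add_letter ?N lam alpha R T) j = c j" for j
      unfolding ircont_add_letter[OF N sub R TS less] k ir by simp
    then have "add_letter ?N lam alpha R T \<in> svrpps lam c"
      using add_letter_SVRPP[OF N sub R TS less] by (simp add: svrpps_def fun_eq_iff)
    then show ?thesis using drop_add_letter[OF N sub R TS less] by (simp add: e)
  qed
  have g: "drop_letter ?N lam T \<in> ?A \<and> ?f (drop_letter ?N lam T) = T" if T: "T \<in> svrpps lam c" for T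
  proof -
    have TS: "T \<in> SVRPP lam" and ir: "ircont lam T = c" using T by (auto simp: svrpps_def)
    obtain alpha R T' where d: "drop_letter ?N lam T = ((alpha, R), T')" and sub: "diagram alpha \<subseteq> diagram lam"
      and R: "R \<subseteq> corner_rows alpha" and T': "T' \<in> SVRPP alpha" and less: "\<forall>b\<in>diagram alpha. \<forall>k\<in>T' b. k < ?N"
      and G: "add_letter ?N lam alpha R T' = T"
    proof -
      have "\<forall>b\<in>diagram lam. \<forall>k\<in>T b. k \<le> ?N" using svrpps_le[OF T _ c] by blast
      from add_drop_letter[OF N TS this] that show thesis by blast
    qed
    have cj: "c j = (if j = ?N then card (snd ` new_boxes lam alpha R) else ircont alpha T' j)" for j
      using ircont_add_letter[OF N sub R T' less, where k = j] unfolding G ir .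
    have "ircont alpha T' ?N = 0"
    proof -
      have *: "{j. \<exists>i. (i, j) \<in> diagram alpha \<and> ?N \<in> T' (i, j)} = {}" using less by blast
      show ?thesis unfolding ircont_def * by simp
    qed
    then have "ircont alpha T' = ?c" using cj by (auto simp: fun_eq_iff)
    then show ?thesis using d sub R T' G cj[of ?N] by (simp add: strips_def svrpps_def)
  qed
  show ?thesis
  proof (rule bij_betw_byWitness[of _ "drop_letter ?N lam"])
    show "\<forall>p\<in>?A. drop_letter ?N lam (?f p) = p" using f by blast
    show "\<forall>T\<in>svrpps lam c. ?f (drop_letter ?N lam T) = T" using g by blast
    show "?f ` ?A \<subseteq> svrpps lam c" using f by blast
    show "drop_letter ?N lam ` svrpps lam c \<subseteq> ?A" using g by blast
  qed
qed

section \<open>The branching rule of the hybrid Grothendieck polynomials\<close>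

definition sv_weight :: "(nat \<Rightarrow> 'a::comm_ring_1) \<Rightarrow> (nat \<Rightarrow> 'a) \<Rightarrow> nat \<Rightarrow> integer_partition \<Rightarrow> (nat \<times> nat \<Rightarrow> nat set) \<Rightarrow> 'a" where
  "sv_weight t w l lam T = (\<Prod>i=1..l. t i ^ ceq lam T i * w i ^ excess lam T i)"

definition strip_weight :: "(nat \<Rightarrow> 'a::comm_ring_1) \<Rightarrow> (nat \<Rightarrow> 'a) \<Rightarrow> nat \<Rightarrow> integer_partition \<Rightarrow> integer_partition \<Rightarrow> nat set \<Rightarrow> 'a" where
  "strip_weight t w l lam alpha R = (\<Prod>i=1..l.
     t i ^ ((part lam (Suc i) - part alpha i) + (if i \<in> R \<and> part alpha i \<le> part lam (Suc i) then 1 else 0))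
     * w i ^ (if i \<in> R then 1 else 0))"

lemma row_le: "\<forall>i>l. part lam i = 0 \<Longrightarrow> part lam i \<noteq> 0 \<Longrightarrow> i \<le> l"
  by (meson not_le)

text \<open>The columns that hold the new letter, sorted by the row of their lowest box in \<open>\<lambda>\<close>: if a column
  holds the new letter anywhere, it does so in its lowest box.\<close>
lemma card_new_columns:
  assumes sub: "diagram alpha \<subseteq> diagram lam" and R: "R \<subseteq> corner_rows alpha" and l: "\<forall>i>l. part lam i = 0"
  shows "card (snd ` new_boxes lam alpha R) = (\<Sum>i=1..l. (part lam i - max (part alpha i) (part lam (Suc i)))
     + (if i \<in> R \<and> part lam (Suc i) < part alpha i then 1 else 0))"
proof -
  let ?n = "\<lambda>i. (part lam i - max (part alpha i) (part lam (Suc i))) + (if i \<in> R \<and> part lam (Suc i) < part alpha i then 1 else 0)"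
  let ?I = "\<lambda>i. {max (part alpha i) (part lam (Suc i))<..part lam i}"
  let ?E = "\<lambda>i. if i \<in> R \<and> part lam (Suc i) < part alpha i then {part alpha i} else {}"
  let ?C = "\<lambda>i. {j. part lam (Suc i) < j \<and> j \<le> part lam i \<and> (i, j) \<in> new_boxes lam alpha R}"
  have le: "part alpha i \<le> part lam i" if "1 \<le> i" for i using sub that diagram_subset_iff by blast
  have new: "(i, j) \<in> new_boxes lam alpha R \<longleftrightarrow> 1 \<le> i \<and> 1 \<le> j \<and> j \<le> part lam i \<and> (part alpha i < j \<or> i \<in> R \<and> j = part alpha i)" for i j
    using R le[of i] by (auto simp: new_boxes_def diagram_iff row_ends_iff corner_rows_def)
  have "snd ` new_boxes lam alpha R = (\<Union>i\<in>{1..l}. ?C i)"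
  proof (intro equalityI subsetI)
    fix j assume "j \<in> snd ` new_boxes lam alpha R"
    then obtain i where i: "(i, j) \<in> new_boxes lam alpha R" by force
    \<comment> \<open>the row of the lowest box of column \<open>j\<close>\<close>
    define m where "m = Max {i. 1 \<le> i \<and> j \<le> part lam i}"
    have "{i. 1 \<le> i \<and> j \<le> part lam i} \<subseteq> {..l}"
    proof
      fix k assume "k \<in> {i. 1 \<le> i \<and> j \<le> part lam i}"
      then have "part lam k \<noteq> 0" using i by (auto simp: new)
      then show "k \<in> {..l}" using row_le[OF l] by simp
    qed
    then have fin: "finite {i. 1 \<le> i \<and> j \<le> part lam i}" by (rule finite_subset) simp
    have "i \<in> {i. 1 \<le> i \<and> j \<le> part lam i}" using i by (simp add: new)
    then have im: "i \<le> m" and m: "1 \<le> m" "j \<le> part lam m"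
      unfolding m_def using Max_ge[OF fin] Max_in[OF fin] by auto
    have ml: "m \<in> {1..l}"
    proof -
      have "part lam m \<noteq> 0" using m i by (auto simp: new)
      then show ?thesis using row_le[OF l] m by simp
    qed
    have "part lam (Suc m) < j"
    proof (rule ccontr)
      assume "\<not> part lam (Suc m) < j"
      then have "Suc m \<le> m" unfolding m_def by (intro Max_ge[OF fin]) simp
      then show False by simp
    qed
    moreover have "(m, j) \<in> new_boxes lam alpha R"
    proof (cases "i = m")
      case False
      then have "part alpha m \<le> part alpha (Suc i)" using im i by (intro part_antimono) auto
      also have "\<dots> < j" using i R part_Suc_le[of i alpha] by (auto simp: new corner_rows_def)
      finally show ?thesis using m i by (simp add: new)
    qed (use i in simp)
    ultimately show "j \<in> (\<Union>i\<in>{1..l}. ?C i)" using ml m by blast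
  next
    fix j assume "j \<in> (\<Union>i\<in>{1..l}. ?C i)"
    then show "j \<in> snd ` new_boxes lam alpha R" by force
  qed
  also have "card \<dots> = (\<Sum>i\<in>{1..l}. card (?C i))"
  proof (rule card_UN_disjoint)
    show "\<forall>i\<in>{1..l}. finite (?C i)" by auto
    show "\<forall>i\<in>{1..l}. \<forall>j\<in>{1..l}. i \<noteq> j \<longrightarrow> ?C i \<inter> ?C j = {}"
    proof (intro ballI impI)
      fix i j assume ij: "i \<in> {1..l}" "j \<in> {1..l}" "i \<noteq> j"
      have "?C i \<inter> ?C j = {}" if "i < j" "1 \<le> i" for i j
      proof -
        have "part lam j \<le> part lam (Suc i)" using that by (intro part_antimono) auto
        then show ?thesis by auto
      qed
      from this[of i j] this[of j i] show "?C i \<inter> ?C j = {}" using ij by (cases i j rule: linorder_cases) auto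
    qed
  qed simp
  also have "\<dots> = (\<Sum>i=1..l. ?n i)"
  proof (rule sum.cong[OF refl])
    fix i assume "i \<in> {1..l}"
    then have i: "1 \<le> i" by simp
    have "?C i = ?I i \<union> ?E i"
      using i le[OF i] by (auto simp: new)
    moreover have "card (?I i \<union> ?E i)
      = ?n i"
      by (subst card_Un_disjoint) auto
    ultimately show "card (?C i) = ?n i" by simp
  qed
  finally show ?thesis .
qed

lemma card_new_ceq:
  assumes sub: "diagram alpha \<subseteq> diagram lam" and R: "R \<subseteq> corner_rows alpha" and i: "1 \<le> i"
  shows "card {j. (i, j) \<in> new_boxes lam alpha R \<and> (Suc i, j) \<in> diagram lam - diagram alpha}
     = (part lam (Suc i) - part alpha i) + (if i \<in> R \<and> part alpha i \<le> part lam (Suc i) then 1 else 0)"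
proof -
  have le: "part alpha i \<le> part lam i" using sub i diagram_subset_iff by blast
  have "{j. (i, j) \<in> new_boxes lam alpha R \<and> (Suc i, j) \<in> diagram lam - diagram alpha}
     = {part alpha i<..part lam (Suc i)} \<union> (if i \<in> R \<and> part alpha i \<le> part lam (Suc i) then {part alpha i} else {})"
    using R le i part_Suc_le[OF i, of lam] part_Suc_le[OF i, of alpha]
    by (auto simp: new_boxes_def diagram_iff row_ends_iff corner_rows_def)
  moreover have "card ({part alpha i<..part lam (Suc i)} \<union> (if i \<in> R \<and> part alpha i \<le> part lam (Suc i) then {part alpha i} else {}))
     = (part lam (Suc i) - part alpha i) + (if i \<in> R \<and> part alpha i \<le> part lam (Suc i) then 1 else 0)"
    by (subst card_Un_disjoint) auto
  ultimately show ?thesis by simp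
qed

lemma sv_weight_add_letter:
  assumes "1 \<le> N" "diagram alpha \<subseteq> diagram lam" "R \<subseteq> corner_rows alpha"
    "T \<in> SVRPP alpha" "\<forall>b\<in>diagram alpha. \<forall>k\<in>T b. k < N"
  shows "sv_weight t w l lam (add_letter N lam alpha R T) = sv_weight t w l alpha T * strip_weight t w l lam alpha R"
  unfolding sv_weight_def strip_weight_def prod.distrib[symmetric]
proof (rule prod.cong[OF refl])
  fix i assume "i \<in> {1..l}"
  then have i: "1 \<le> i" by simp
  show "t i ^ ceq lam (add_letter N lam alpha R T) i * w i ^ excess lam (add_letter N lam alpha R T) i
    = t i ^ ceq alpha T i * w i ^ excess alpha T i * (t i ^ ((part lam (Suc i) - part alpha i) + (if i \<in> R \<and> part alpha i \<le> part lam (Suc i) then 1 else 0))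
     * w i ^ (if i \<in> R then 1 else 0))"
    unfolding ceq_add_letter[OF assms] excess_add_letter[OF assms] card_new_ceq[OF assms(2,3) i] power_add
    by (simp only: mult_ac)
qed

lemma branch_coeff_rows:
  assumes "f (Suc l) = 0" "g (Suc l) = 0"
  shows "branch_coeff x t w (rows f l) (rows g l) = (\<Prod>i=1..l. if g i \<le> f i then
      x ^ (f i - max (g i) (f (Suc i))) * t i ^ (f (Suc i) - g i) * corner x (t i) (w i) (g i) (g (Suc i)) (f (Suc i)) else 0)"
  using assms
proof (induction l arbitrary: f g t w)
  case (Suc l)
  have hd: "hd0 (rows (\<lambda>i. h (Suc i)) l) = h 2" if "h (Suc (Suc l)) = 0" for h :: "nat \<Rightarrow> nat"
    using that by (cases l) (simp_all add: rows_Suc numeral_2_eq_2)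
  have IH: "branch_coeff x (t \<circ> Suc) (w \<circ> Suc) (rows (\<lambda>i. f (Suc i)) l) (rows (\<lambda>i. g (Suc i)) l)
     = (\<Prod>i=1..l. if g (Suc i) \<le> f (Suc i) then x ^ (f (Suc i) - max (g (Suc i)) (f (Suc (Suc i)))) * t (Suc i) ^ (f (Suc (Suc i)) - g (Suc i))
          * corner x (t (Suc i)) (w (Suc i)) (g (Suc i)) (g (Suc (Suc i))) (f (Suc (Suc i))) else 0)"
    by (rule trans[OF Suc.IH]) (auto simp: Suc.prems intro!: prod.cong)
  have split: "(\<Prod>i=1..Suc l. h i) = h 1 * (\<Prod>i=1..l. h (Suc i))" for h :: "nat \<Rightarrow> 'a"
    by (subst prod.atLeast_Suc_atMost) (simp_all add: prod.shift_bounds_cl_Suc_ivl del: prod.cl_ivl_Suc)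
  show ?case
    unfolding rows_Suc split by (simp add: hd Suc.prems IH numeral_2_eq_2)
qed simp

lemma prod_one_plus:
  fixes y :: "'b \<Rightarrow> 'a::comm_ring_1"
  assumes "finite A" "C \<subseteq> A"
  shows "(\<Prod>i\<in>A. if i \<in> C then 1 + y i else 1) = (\<Sum>R\<in>Pow C. \<Prod>i\<in>A. if i \<in> R then y i else 1)"
proof -
  have C: "finite C" using assms finite_subset by blast
  have "(\<Prod>i\<in>A. if i \<in> C then 1 + y i else 1) = (\<Prod>i\<in>C. y i + 1)"
    using assms by (subst prod.mono_neutral_cong_right[of A C]) (auto simp: add.commute)
  also have "\<dots> = (\<Sum>R\<in>Pow C. (\<Prod>i\<in>R. y i) * (\<Prod>i\<in>C - R. 1))" by (rule prod_add[OF C])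
  also have "\<dots> = (\<Sum>R\<in>Pow C. \<Prod>i\<in>A. if i \<in> R then y i else 1)"
  proof (rule sum.cong[OF refl])
    fix R assume "R \<in> Pow C"
    then have "(\<Prod>i\<in>A. if i \<in> R then y i else 1) = (\<Prod>i\<in>R. y i)"
      using assms by (intro prod.mono_neutral_cong_right) auto
    then show "(\<Prod>i\<in>R. y i) * (\<Prod>i\<in>C - R. 1) = (\<Prod>i\<in>A. if i \<in> R then y i else 1)" by simp
  qed
  finally show ?thesis .
qed

abbreviation branch_poly :: "(nat \<Rightarrow> 'a::comm_ring_1) \<Rightarrow> (nat \<Rightarrow> 'a) \<Rightarrow> nat \<Rightarrow> integer_partition \<Rightarrow> integer_partition \<Rightarrow> 'a poly" where
  "branch_poly t w l lam alpha \<equiv> branch_coeff [:0, 1:] (\<lambda>i. [:t i:]) (\<lambda>i. [:w i:]) (rows (part lam) l) (rows (part alpha) l)"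

text \<open>Expanding the corner factors of \<open>L(x)\<close> as a sum over sets \<open>R\<close> of corner rows yields one monomial for
  each way to add the largest letter; \<open>x\<close> is the polynomial variable and marks the occupied columns.\<close>
lemma coeff_branch_coeff:
  fixes t w :: "nat \<Rightarrow> 'a::comm_ring_1"
  assumes l: "\<forall>i>l. part lam i = 0" "\<forall>i>l. part alpha i = 0"
  shows "coeff (branch_poly t w l lam alpha) k
    = (\<Sum>R | (alpha, R) \<in> strips lam k. strip_weight t w l lam alpha R)"
proof (cases "diagram alpha \<subseteq> diagram lam")
  case False
  then obtain i where i: "1 \<le> i" "\<not> part alpha i \<le> part lam i" using diagram_subset_iff by blast
  then have "i \<in> {1..l}" using row_le[OF l(2), of i] by simp
  then have "branch_poly t w l lam alpha = 0"
    using i l by (subst branch_coeff_rows) (auto intro!: prod_zero)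
  then show ?thesis using False by (simp add: strips_def)
next
  case True
  let ?C = "corner_rows alpha"
  let ?a = "\<lambda>i. part lam i - max (part alpha i) (part lam (Suc i))"
  let ?b = "\<lambda>i. part lam (Suc i) - part alpha i"
  let ?x = "[:0, 1:] :: 'a poly"
  let ?y = "\<lambda>i. if part alpha i \<le> part lam (Suc i) then [:w i:] * [:t i:] else [:w i:] * ?x"
  have le: "part alpha i \<le> part lam i" if "1 \<le> i" for i using True that diagram_subset_iff by blast
  have C: "?C \<subseteq> {1..l}"
  proof
    fix i assume "i \<in> ?C"
    then have "1 \<le> i" "part alpha i \<noteq> 0" by (auto simp: corner_rows_def)
    then show "i \<in> {1..l}" using row_le[OF l(2)] by simp
  qed
  have "branch_coeff ?x (\<lambda>i. [:t i:]) (\<lambda>i. [:w i:]) (rows (part lam) l) (rows (part alpha) l)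
     = (\<Prod>i=1..l. ?x ^ ?a i * [:t i:] ^ ?b i * (if i \<in> ?C then 1 + ?y i else 1))"
    using l le part_Suc_le[of _ alpha]
    by (subst branch_coeff_rows) (auto intro!: prod.cong simp: corner_def corner_rows_def nat_less_le)
  also have "\<dots> = (\<Prod>i=1..l. ?x ^ ?a i * [:t i:] ^ ?b i) * (\<Sum>R\<in>Pow ?C. \<Prod>i=1..l. if i \<in> R then ?y i else 1)"
    unfolding prod.distrib by (subst prod_one_plus[OF _ C]) simp_all
  also have "\<dots> = (\<Sum>R\<in>Pow ?C. \<Prod>i=1..l. ?x ^ ?a i * [:t i:] ^ ?b i * (if i \<in> R then ?y i else 1))"
    by (simp add: sum_distrib_left prod.distrib)
  also have "\<dots> = (\<Sum>R\<in>Pow ?C. monom (strip_weight t w l lam alpha R) (card (snd ` new_boxes lam alpha R)))"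
  proof (rule sum.cong[OF refl])
    fix R assume R: "R \<in> Pow ?C"
    let ?e = "\<lambda>i. ?a i + (if i \<in> R \<and> part lam (Suc i) < part alpha i then 1 else 0)"
    let ?c = "\<lambda>i. t i ^ (?b i + (if i \<in> R \<and> part alpha i \<le> part lam (Suc i) then 1 else 0)) * w i ^ (if i \<in> R then 1 else 0)"
    have "(\<Prod>i=1..l. ?x ^ ?a i * [:t i:] ^ ?b i * (if i \<in> R then ?y i else 1)) = (\<Prod>i=1..l. ?x ^ ?e i * [:?c i:])"
      by (rule prod.cong[OF refl]) (auto simp: poly_const_pow mult_ac not_le)
    also have "\<dots> = ?x ^ (\<Sum>i=1..l. ?e i) * [:\<Prod>i=1..l. ?c i:]"
      by (simp only: prod.distrib power_sum prod_to_poly)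
    also have "\<dots> = monom (strip_weight t w l lam alpha R) (card (snd ` new_boxes lam alpha R))"
      unfolding card_new_columns[OF True R[unfolded Pow_iff] l(1)] strip_weight_def
      by (simp add: monom_altdef mult.commute)
    finally show "(\<Prod>i=1..l. ?x ^ ?a i * [:t i:] ^ ?b i * (if i \<in> R then ?y i else 1))
      = monom (strip_weight t w l lam alpha R) (card (snd ` new_boxes lam alpha R))" .
  qed
  finally have "coeff (branch_coeff ?x (\<lambda>i. [:t i:]) (\<lambda>i. [:w i:]) (rows (part lam) l) (rows (part alpha) l)) k
    = (\<Sum>R\<in>Pow ?C. if card (snd ` new_boxes lam alpha R) = k then strip_weight t w l lam alpha R else 0)"
    by (simp add: coeff_sum)
  also have "\<dots> = (\<Sum>R | (alpha, R) \<in> strips lam k. strip_weight t w l lam alpha R)"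
  proof -
    have "finite (Pow ?C)" using C finite_subset by blast
    then show ?thesis using True by (intro sum.mono_neutral_cong_right) (auto simp: strips_def)
  qed
  finally show ?thesis .
qed

lemma finite_strips: "finite (strips lam k)"
proof -
  obtain n where n: "\<forall>i>n. part lam i = 0" using ex_in_box by blast
  have "strips lam k \<subseteq> in_box (part lam 1) n \<times> Pow {..n}"
  proof
    fix p assume "p \<in> strips lam k"
    then obtain alpha R where p: "p = (alpha, R)" "diagram alpha \<subseteq> diagram lam" "R \<subseteq> corner_rows alpha"
      by (auto simp: strips_def)
    have le: "part alpha i \<le> part lam i" if "1 \<le> i" for i using p(2) that diagram_subset_iff by blast
    have z: "part alpha i = 0" if "i > n" for i using le[of i] n that by simp
    have "corner_rows alpha \<subseteq> {..n}"
    proof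
      fix i assume "i \<in> corner_rows alpha"
      then have "part alpha i \<noteq> 0" by (auto simp: corner_rows_def)
      then show "i \<in> {..n}" using z[of i] by (meson atMost_iff not_le)
    qed
    then show "p \<in> in_box (part lam 1) n \<times> Pow {..n}" using p z le[of 1] by (auto simp: in_box_def)
  qed
  then show ?thesis by (rule finite_subset) simp
qed

text \<open>The branching rule \<open>H\<^sub>\<lambda>(x\<^sub>1..x\<^sub>n) = \<Sum>\<alpha>. L(x\<^sub>n) \<lambda> \<alpha> * H\<^sub>\<alpha>(x\<^sub>1..x\<^bsub>n-1\<^esub>)\<close>, read off at one exponent of
  \<open>x\<^sub>n\<close>.\<close>
lemma svrpps_branching:
  fixes t w :: "nat \<Rightarrow> 'a::comm_ring_1"
  assumes c: "\<forall>k>Suc n. c k = 0" and l: "lam \<in> in_box q l"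
  shows "(\<Sum>T\<in>svrpps lam c. sv_weight t w l lam T) = (\<Sum>alpha\<in>in_box q l.
      coeff (branch_poly t w l lam alpha) (c (Suc n))
      * (\<Sum>T\<in>svrpps alpha (c(Suc n := 0)). sv_weight t w l alpha T))"
proof -
  let ?c = "c(Suc n := 0)"
  let ?S = "strips lam (c (Suc n))"
  have c': "\<forall>k>n. ?c k = 0" using c by (auto simp: less_Suc_eq_le Suc_le_eq nat_less_le)
  have "(\<Sum>T\<in>svrpps lam c. sv_weight t w l lam T)
     = (\<Sum>p\<in>(SIGMA (alpha, R) : ?S. svrpps alpha ?c). sv_weight t w l lam ((\<lambda>((alpha, R), T). add_letter (Suc n) lam alpha R T) p))"
    by (rule sum.reindex_bij_betw[OF bij_add_letter[OF c], symmetric])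
  also have "\<dots> = (\<Sum>(s, T)\<in>(SIGMA (alpha, R) : ?S. svrpps alpha ?c). sv_weight t w l (fst s) T * strip_weight t w l lam (fst s) (snd s))"
  proof (rule sum.cong[OF refl])
    fix p assume p: "p \<in> (SIGMA (alpha, R) : ?S. svrpps alpha ?c)"
    obtain alpha R T where e: "p = ((alpha, R), T)" by (cases p) auto
    have T: "T \<in> svrpps alpha ?c" and s: "diagram alpha \<subseteq> diagram lam" "R \<subseteq> corner_rows alpha"
      using p by (auto simp: e strips_def)
    have TS: "T \<in> SVRPP alpha" using T by (simp add: svrpps_def)
    have "\<forall>b\<in>diagram alpha. \<forall>k\<in>T b. k < Suc n"
      using svrpps_le[OF T _ c'] by (simp add: less_Suc_eq_le)
    from sv_weight_add_letter[OF _ s TS this, of t w l]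
    show "sv_weight t w l lam ((\<lambda>((alpha, R), T). add_letter (Suc n) lam alpha R T) p)
       = (case p of (s, T) \<Rightarrow> sv_weight t w l (fst s) T * strip_weight t w l lam (fst s) (snd s))"
      by (simp add: e)
  qed
  also have "\<dots> = (\<Sum>s\<in>?S. \<Sum>T\<in>svrpps (fst s) ?c. sv_weight t w l (fst s) T * strip_weight t w l lam (fst s) (snd s))"
    using finite_strips finite_svrpps[OF c'] by (subst sum.Sigma) (auto simp: case_prod_unfold simp del: fun_upd_apply)
  also have "\<dots> = (\<Sum>s\<in>?S. strip_weight t w l lam (fst s) (snd s) * (\<Sum>T\<in>svrpps (fst s) ?c. sv_weight t w l (fst s) T))"
    by (simp only: sum_distrib_left mult.commute)
  also have "\<dots> = (\<Sum>s\<in>(SIGMA alpha : in_box q l. {R. (alpha, R) \<in> ?S}). strip_weight t w l lam (fst s) (snd s) * (\<Sum>T\<in>svrpps (fst s) ?c. sv_weight t w l (fst s) T))"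
  proof (rule sum.cong[OF _ refl])
    have "alpha \<in> in_box q l" if "(alpha, R) \<in> ?S" for alpha R
    proof -
      have le: "part alpha i \<le> part lam i" if "1 \<le> i" for i
        using \<open>(alpha, R) \<in> ?S\<close> that diagram_subset_iff unfolding strips_def by blast
      show ?thesis unfolding in_box_def
      proof (intro CollectI conjI allI impI)
        show "part alpha 1 \<le> q" using le[of 1] l by (simp add: in_box_def)
        show "part alpha i = 0" if "l < i" for i using le[of i] l that by (simp add: in_box_def)
      qed
    qed
    then show "?S = (SIGMA alpha : in_box q l. {R. (alpha, R) \<in> ?S})" by auto
  qed
  also have "\<dots> = (\<Sum>alpha\<in>in_box q l. \<Sum>R | (alpha, R) \<in> ?S. strip_weight t w l lam alpha R * (\<Sum>T\<in>svrpps alpha ?c. sv_weight t w l alpha T))"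
  proof -
    have "finite {R. (alpha, R) \<in> ?S}" for alpha
      by (rule finite_subset[of _ "snd ` ?S"]) (force simp: finite_strips)+
    then show ?thesis by (subst sum.Sigma) (auto simp: case_prod_unfold)
  qed
  also have "\<dots> = (\<Sum>alpha\<in>in_box q l.
      coeff (branch_poly t w l lam alpha) (c (Suc n))
      * (\<Sum>T\<in>svrpps alpha ?c. sv_weight t w l alpha T))"
    using l by (intro sum.cong refl) (simp add: coeff_branch_coeff in_box_def sum_distrib_right)
  finally show ?thesis .
qed

section \<open>The Schur expansion\<close>

lemma hstep_const: "hstep [:x:] xs ys = [:hstep x xs ys:]"
  by (induction x xs ys rule: hstep.induct) (auto simp: poly_const_pow)

lemma vstep_const: "vstep [:x:] xs ys = [:vstep x xs ys:]"
  by (induction x xs ys rule: vstep.induct) auto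

text \<open>\<open>osc_sum_branching\<close> will be applied over polynomials in \<open>x\<close>, whose constants are the actual
  coefficient ring.\<close>
lemma osc_sum_const: "osc_sum (\<lambda>i. [:t i:]) (\<lambda>i. [:w i:]) xs ys = [:osc_sum t w xs ys:]"
proof (induction t w xs ys rule: osc_sum.induct)
  case (3 t w a xs b ys)
  have "osc_sum ((\<lambda>i. [:t i:]) \<circ> Suc) ((\<lambda>i. [:w i:]) \<circ> Suc) xs us = [:osc_sum (t \<circ> Suc) (w \<circ> Suc) xs us:]"
    if "a = b" "us \<in> boxed a (Suc (length ys))" for us
    using 3[OF that] zero_boxed[of "length ys" a] by (auto simp: comp_def)
  then show ?case by (simp add: hstep_const vstep_const sum_to_poly mult_ac del: boxed.simps cong: sum.cong)
qed auto

lemma in_box_0: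
  obtains e where "in_box q 0 = {e}" "part e = (\<lambda>_. 0)" "diagram e = {}"
proof -
  have "card (in_box q 0) = 1" using bij_betw_same_card[OF bij_rows[where n = 0 and q = q]] by simp
  then obtain e where e: "in_box q 0 = {e}" by (rule card_1_singletonE)
  then have "e \<in> in_box q 0" by simp
  then have "part e i = 0" for i by (cases "i = 0") (simp_all add: in_box_def)
  then have "part e = (\<lambda>_. 0)" by auto
  moreover from this have "diagram e = {}" by (auto simp: diagram_def)
  ultimately show thesis using that[OF e] by blast
qed

lemma ssyts_pos: "T \<in> ssyts mu c \<Longrightarrow> c 0 = 0"
  unfolding ssyts_def ssyt_content_def using SSYT_pos[of T mu] by (force simp: card_eq_0_iff)

lemma svrpps_pos: "T \<in> svrpps lam c \<Longrightarrow> c 0 = 0"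
proof -
  assume T: "T \<in> svrpps lam c"
  have "{j. \<exists>i. (i, j) \<in> diagram lam \<and> 0 \<in> T (i, j)} = {}"
    using SVRPP_box(3)[of T lam] T by (fastforce simp: svrpps_def)
  then have "ircont lam T 0 = 0" unfolding ircont_def by (simp only: card.empty)
  then show ?thesis using T by (auto simp: svrpps_def)
qed

lemma svrpps_zero:
  "(\<Sum>T\<in>svrpps lam (\<lambda>_. 0). sv_weight t w l lam T) = (if diagram lam = {} then 1 else 0)"
proof (cases "diagram lam = {}")
  case True
  have "svrpps lam (\<lambda>_. 0) = {\<lambda>_. undefined}"
    unfolding svrpps_def SVRPP_def ircont_def True by auto
  then show ?thesis using True by (simp add: sv_weight_def ceq_def excess_def)
next
  case False
  then obtain b where b: "b \<in> diagram lam" by blast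
  have "svrpps lam (\<lambda>_. 0) = {}"
  proof (rule equals0I)
    fix T assume T: "T \<in> svrpps lam (\<lambda>_. 0)"
    then have "T \<in> SVRPP lam" by (simp add: svrpps_def)
    then obtain k where "k \<in> T b" "1 \<le> k" using SVRPP_box[OF _ b] by fastforce
    then show False using svrpps_le[OF T b, of 0 k] by simp
  qed
  then show ?thesis using False by simp
qed

lemma rows_zero_iff: "\<forall>i>l. part lam i = 0 \<Longrightarrow> rows (part lam) l = replicate l 0 \<longleftrightarrow> diagram lam = {}"
proof -
  assume l: "\<forall>i>l. part lam i = 0"
  have r: "replicate l 0 = rows (\<lambda>_. 0) l" by (simp add: rows_def map_replicate_const del: upt_Suc)
  show ?thesis
  proof
    assume "rows (part lam) l = replicate l 0"
    then have "part lam i = 0" if "1 \<le> i" for i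
      using rows_eqD[of "part lam" l "\<lambda>_. 0" i] l that unfolding r by (cases "i \<le> l") auto
    then show "diagram lam = {}" by (auto simp: diagram_def)
  next
    assume d: "diagram lam = {}"
    have "part lam i = 0" if "1 \<le> i" for i
    proof (rule ccontr)
      assume "part lam i \<noteq> 0"
      then have "(i, 1) \<in> diagram lam" using that by (simp add: diagram_iff)
      then show False using d by simp
    qed
    then show "rows (part lam) l = replicate l 0" unfolding r by (intro rows_cong) simp
  qed
qed

lemma coeff_mult_const: "coeff (p * [:a:]) k = coeff p k * a" "coeff ([:a:] * p) k = a * coeff p k"
  for a :: "'a::comm_ring_1"
  by (simp_all add: mult.commute)

text \<open>The Schur expansion of the coefficient of \<open>x^c\<close>, by induction on the number \<open>n\<close> of letters: both
  sides branch at the largest letter, and \<open>osc_sum_branching\<close> matches the two branching rules.\<close>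
lemma sum_svrpps:
  fixes t w :: "nat \<Rightarrow> 'a::comm_ring_1"
  assumes "lam \<in> in_box q l" "\<forall>k>n. c k = 0"
  shows "(\<Sum>T\<in>svrpps lam c. sv_weight t w l lam T)
    = (\<Sum>mu\<in>in_box q n. osc_sum t w (rows (part lam) l) (rows (part mu) n) * of_nat (card (ssyts mu c)))"
  using assms
proof (induction n arbitrary: lam c)
  case 0
  obtain e where e: "in_box q 0 = {e}" "part e = (\<lambda>_. 0)" "diagram e = {}" by (rule in_box_0)
  show ?case
  proof (cases "c 0 = 0")
    case True
    then have "c k = 0" for k using 0(2) by (cases "k = 0") auto
    then have c: "c = (\<lambda>_. 0)" by auto
    have "card (ssyts e (\<lambda>_. 0)) = 1" using ssyts_part_self[of e] e(2) by simp
    moreover have "\<forall>i>l. part lam i = 0" using 0 by (simp add: in_box_def)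
    ultimately show ?thesis unfolding e(1) c svrpps_zero by (simp add: osc_sum_Nil_right rows_zero_iff)
  next
    case False
    have "svrpps lam c = {}" by (rule equals0I) (use False svrpps_pos[of _ lam c] in auto)
    moreover have "ssyts e c = {}" by (rule equals0I) (use False ssyts_pos[of _ e c] in auto)
    ultimately show ?thesis by (simp add: e(1))
  qed
next
  case (Suc n)
  let ?N = "Suc n" and ?c = "c(Suc n := 0)"
  have c': "\<forall>k>n. ?c k = 0" using Suc.prems by (auto simp: less_Suc_eq_le Suc_le_eq nat_less_le)
  let ?L = "\<lambda>alpha. branch_poly t w l lam alpha"
  let ?K = "\<lambda>lam n mu. osc_sum t w (rows (part lam) l) (rows (part mu) n)"
  let ?h = "\<lambda>mu nu. hstep [:0, 1:] (rows (part mu) ?N) (rows (part nu) n)"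
  let ?s = "\<lambda>nu. of_nat (card (ssyts nu ?c)) :: 'a"
  have xs: "rows (part lam) l \<in> boxed q l" using Suc.prems(1) by (rule rows_in_boxed)
  have branch: "(\<Sum>alpha\<in>in_box q l. ?L alpha * [:?K alpha n nu:])
     = (\<Sum>mu\<in>in_box q ?N. [:?K lam ?N mu:] * ?h mu nu)"
    if nu: "nu \<in> in_box q n" for nu
  proof -
    have zs: "rows (part nu) n \<in> boxed q n" using nu by (rule rows_in_boxed)
    have "(\<Sum>ys\<in>boxed q ?N. osc_sum (\<lambda>i. [:t i:]) (\<lambda>i. [:w i:]) (rows (part lam) l) ys * hstep [:0, 1:] ys (rows (part nu) n))
      = (\<Sum>us\<in>boxed q l. branch_coeff [:0, 1:] (\<lambda>i. [:t i:]) (\<lambda>i. [:w i:]) (rows (part lam) l) us * osc_sum (\<lambda>i. [:t i:]) (\<lambda>i. [:w i:]) us (rows (part nu) n))"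
      by (rule osc_sum_branching[OF xs zs hd0_boxed[OF xs] hd0_boxed[OF zs]])
    then show ?thesis unfolding osc_sum_const sum_in_box[symmetric] ..
  qed
  have "(\<Sum>T\<in>svrpps lam c. sv_weight t w l lam T)
     = (\<Sum>alpha\<in>in_box q l. coeff (?L alpha) (c ?N) * (\<Sum>T\<in>svrpps alpha ?c. sv_weight t w l alpha T))"
    by (rule svrpps_branching[OF Suc.prems(2,1)])
  also have "\<dots> = (\<Sum>alpha\<in>in_box q l. coeff (?L alpha) (c ?N) * (\<Sum>nu\<in>in_box q n. ?K alpha n nu * ?s nu))"
    by (intro sum.cong refl arg_cong2[where f = times] Suc.IH c')
  also have "\<dots> = (\<Sum>alpha\<in>in_box q l. \<Sum>nu\<in>in_box q n. ?s nu * coeff (?L alpha * [:?K alpha n nu:]) (c ?N))"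
    unfolding coeff_mult_const sum_distrib_left by (simp only: mult_ac)
  also have "\<dots> = (\<Sum>nu\<in>in_box q n. \<Sum>alpha\<in>in_box q l. ?s nu * coeff (?L alpha * [:?K alpha n nu:]) (c ?N))"
    by (rule sum.swap)
  also have "\<dots> = (\<Sum>nu\<in>in_box q n. ?s nu * coeff (\<Sum>alpha\<in>in_box q l. ?L alpha * [:?K alpha n nu:]) (c ?N))"
    by (simp only: coeff_sum sum_distrib_left)
  also have "\<dots> = (\<Sum>nu\<in>in_box q n. ?s nu * coeff (\<Sum>mu\<in>in_box q ?N. [:?K lam ?N mu:] * ?h mu nu) (c ?N))"
    by (rule sum.cong[OF refl]) (simp only: branch)
  also have "\<dots> = (\<Sum>nu\<in>in_box q n. \<Sum>mu\<in>in_box q ?N. ?s nu * coeff ([:?K lam ?N mu:] * ?h mu nu) (c ?N))"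
    by (simp only: coeff_sum sum_distrib_left)
  also have "\<dots> = (\<Sum>mu\<in>in_box q ?N. \<Sum>nu\<in>in_box q n. ?s nu * coeff ([:?K lam ?N mu:] * ?h mu nu) (c ?N))"
    by (rule sum.swap)
  also have "\<dots> = (\<Sum>mu\<in>in_box q ?N. ?K lam ?N mu * (\<Sum>nu\<in>in_box q n. coeff (?h mu nu) (c ?N) * ?s nu))"
    unfolding coeff_mult_const sum_distrib_left by (simp only: mult_ac)
  also have "\<dots> = (\<Sum>mu\<in>in_box q ?N. ?K lam ?N mu * of_nat (card (ssyts mu c)))"
  proof (rule sum.cong[OF refl])
    fix mu assume mu: "mu \<in> in_box q ?N"
    have "coeff (?h mu nu) (c ?N) * ?s nu
        = of_nat (if falling_pair 0 mu nu \<and> card (skew mu nu) = c ?N then card (ssyts nu ?c) else 0)"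
      if "nu \<in> in_box q n" for nu
    proof -
      have h: "?h mu nu = (if falling_pair 0 mu nu then monom (1::'a) (card (skew mu nu)) else 0)"
        using mu that by (simp add: hstep_rows in_box_def monom_altdef)
      show ?thesis unfolding h by simp
    qed
    then show "?K lam ?N mu * (\<Sum>nu\<in>in_box q n. coeff (?h mu nu) (c ?N) * ?s nu)
      = ?K lam ?N mu * of_nat (card (ssyts mu c))"
      unfolding ssyts_branching[OF Suc.prems(2) mu] by (simp del: fun_upd_apply)
  qed
  finally show ?case .
qed

lemma part_num_parts: "num_parts lam < i \<Longrightarrow> part lam i = 0"
proof (rule ccontr)
  assume i: "num_parts lam < i" "part lam i \<noteq> 0"
  have "{1..i} \<subseteq> {j. part lam j \<noteq> 0}"
  proof
    fix j assume "j \<in> {1..i}"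
    then have "part lam i \<le> part lam j" by (intro part_antimono) auto
    then show "j \<in> {j. part lam j \<noteq> 0}" using i(2) by auto
  qed
  from card_mono[OF finite_part this] show False using i(1) by (simp add: num_parts_def)
qed

lemma num_parts_ge_1:
  assumes "diagram lam \<noteq> {}"
  shows "1 \<le> num_parts lam"
proof (rule ccontr)
  assume "\<not> 1 \<le> num_parts lam"
  then have "part lam i = 0" if "1 \<le> i" for i using that by (intro part_num_parts) simp
  then show False using assms by (auto simp: diagram_def)
qed

lemma mon_eq_prod: "finite A \<Longrightarrow> (\<And>i. i \<notin> A \<Longrightarrow> a i = 0) \<Longrightarrow> mon y a = (\<Prod>i\<in>A. y i ^ a i)"
  unfolding mon_def by (rule Prod_any.expand_superset) (assumption, rule subsetI, rule ccontr, simp)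

lemma hybrid_eq:
  assumes l: "\<forall>i>l. part lam i = 0"
  shows "hybrid_groth lam g = (\<Sum>T\<in>svrpps lam (Poly_Mapping.lookup g). sv_weight tvar wvar l lam T)"
proof -
  have "mon tvar (ceq lam T) * mon wvar (excess lam T) = sv_weight tvar wvar l lam T" for T
  proof -
    have "(i, j) \<notin> diagram lam" if "i \<notin> {1..l}" for i j using that l by (auto simp: diagram_iff)
    then have "ceq lam T i = 0" "excess lam T i = 0" if "i \<notin> {1..l}" for i
      using that by (simp_all add: ceq_def excess_def)
    then have "mon tvar (ceq lam T) = (\<Prod>i\<in>{1..l}. tvar i ^ ceq lam T i)"
      "mon wvar (excess lam T) = (\<Prod>i\<in>{1..l}. wvar i ^ excess lam T i)"
      by (intro mon_eq_prod; blast)+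
    then show ?thesis by (simp only: sv_weight_def prod.distrib)
  qed
  then show ?thesis by (simp add: hybrid_groth_def svrpps_def)
qed

lemma wt_osc_weight: "wt l S = osc_weight tvar wvar l S"
  by (simp add: wt_def osc_weight_def)

text \<open>A partition \<open>\<mu>\<close> outside the box of \<open>sum_svrpps\<close> contributes nothing: if it has too many rows, its Schur
  function has no such monomial, and if its first row differs from that of \<open>\<lambda>\<close>, no oscillating
  sequence ends in it.\<close>
lemma hybrid_expansion:
  assumes ne: "diagram lam \<noteq> {}"
  shows "schur_expansion (hybrid_groth lam) (\<lambda>mu. \<Sum>S\<in>OS (num_parts lam) lam mu. wt (num_parts lam) S)"
  unfolding schur_expansion_def
proof
  fix g :: "nat \<Rightarrow>\<^sub>0 nat"
  define l where "l = num_parts lam"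
  define q where "q = part lam 1"
  have lz: "\<forall>i>l. part lam i = 0" unfolding l_def using part_num_parts by blast
  have l1: "1 \<le> l" unfolding l_def using ne by (rule num_parts_ge_1)
  have lam: "lam \<in> in_box q l" using lz by (simp add: in_box_def q_def)
  obtain n where "Poly_Mapping.keys g \<subseteq> {..n}" using finite_nat_iff_bounded_le finite_keys by blast
  then have c: "\<forall>k>Suc n. Poly_Mapping.lookup g k = 0"
    by (auto simp: in_keys_iff subset_iff)
  let ?K = "\<lambda>mu. \<Sum>S\<in>OS l lam mu. wt l S"
  have osc: "?K mu = osc_sum tvar wvar (rows (part lam) l) (rows (part mu) (Suc n))" if "mu \<in> in_box q (Suc n)" for mu
  proof -
    have "\<forall>i>Suc n. part mu i = 0" using that by (simp add: in_box_def)
    from sum_OS[OF l1 lz this, of tvar wvar] show ?thesis by (simp add: wt_osc_weight)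
  qed
  have "hybrid_groth lam g = (\<Sum>mu\<in>in_box q (Suc n). ?K mu * schur mu g)"
    unfolding hybrid_eq[OF lz] sum_svrpps[OF lam c] by (intro sum.cong refl) (simp only: osc schur_ssyts)
  also have "\<dots> = Sum_any (\<lambda>mu. ?K mu * schur mu g)"
  proof (rule Sum_any.expand_superset[symmetric])
    show "{mu. ?K mu * schur mu g \<noteq> 0} \<subseteq> in_box q (Suc n)"
    proof
      fix mu assume "mu \<in> {mu. ?K mu * schur mu g \<noteq> 0}"
      then have nz: "?K mu \<noteq> 0" "schur mu g \<noteq> 0" by auto
      then obtain S where "S \<in> OS l lam mu" by (metis sum.empty ex_in_conv)
      then have "part mu 1 = q" using OS_first_eq[OF l1] by (simp add: q_def)
      moreover have "part mu (Suc (Suc n)) = 0"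
      proof (rule ccontr)
        assume "part mu (Suc (Suc n)) \<noteq> 0"
        with c have "ssyts mu (Poly_Mapping.lookup g) = {}" by (rule ssyts_empty)
        then show False using nz(2) by (simp add: schur_ssyts)
      qed
      then have "part mu i = 0" if "i > Suc n" for i
        using part_antimono[of "Suc (Suc n)" i mu] that by simp
      ultimately show "mu \<in> in_box q (Suc n)" by (simp add: in_box_def)
    qed
  qed simp
  finally show "hybrid_groth lam g = Sum_any (\<lambda>mu. (\<Sum>S\<in>OS (num_parts lam) lam mu. wt (num_parts lam) S) * schur mu g)"
    by (simp add: l_def)
qed

section \<open>Collecting equal weights\<close>

lemma single_power: "Poly_Mapping.single (Poly_Mapping.single v 1) (1::int) ^ k = Poly_Mapping.single (Poly_Mapping.single v k) 1"
  for v :: tw_var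
  by (induction k) (simp_all add: mult_single single_add[symmetric])

lemma prod_single: "finite A \<Longrightarrow> (\<Prod>i\<in>A. Poly_Mapping.single (m i) (1::int)) = Poly_Mapping.single (\<Sum>i\<in>A. m i) 1"
  for m :: "'a \<Rightarrow> tw_var \<Rightarrow>\<^sub>0 nat"
  by (induction A rule: finite_induct) (simp_all add: mult_single)

lemma mon_single:
  assumes y: "\<And>i. y i = Poly_Mapping.single (Poly_Mapping.single (V i) 1) 1"
  shows "mon y (Poly_Mapping.lookup a) = Poly_Mapping.single (\<Sum>i\<in>Poly_Mapping.keys a. Poly_Mapping.single (V i) (Poly_Mapping.lookup a i)) 1"
proof -
  have "mon y (Poly_Mapping.lookup a) = (\<Prod>i\<in>Poly_Mapping.keys a. y i ^ Poly_Mapping.lookup a i)"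
    by (rule mon_eq_prod) (auto simp: in_keys_iff)
  then show ?thesis by (simp only: y single_power prod_single finite_keys)
qed

text \<open>Monomials in \<open>w\<close> and \<open>t\<close> determine their exponents, so each oscillating sequence is counted for
  exactly one pair of exponents.\<close>
lemma mon_inject:
  assumes "mon wvar (Poly_Mapping.lookup a) * mon tvar (Poly_Mapping.lookup b)
     = mon wvar (Poly_Mapping.lookup a') * mon tvar (Poly_Mapping.lookup b')"
  shows "a = a' \<and> b = b'"
proof -
  define W where "W a = (\<Sum>i\<in>Poly_Mapping.keys a. Poly_Mapping.single (W_var i) (Poly_Mapping.lookup a i))" for a :: "nat \<Rightarrow>\<^sub>0 nat"
  define U where "U a = (\<Sum>i\<in>Poly_Mapping.keys a. Poly_Mapping.single (T_var i) (Poly_Mapping.lookup a i))" for a :: "nat \<Rightarrow>\<^sub>0 nat"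
  have m: "mon wvar (Poly_Mapping.lookup a) * mon tvar (Poly_Mapping.lookup b) = Poly_Mapping.single (W a + U b) 1" for a b
    unfolding W_def U_def by (simp add: mon_single[OF wvar_def] mon_single[OF tvar_def] mult_single)
  have eq: "W a + U b = W a' + U b'"
    using assms unfolding m by (metis lookup_single_eq lookup_single_not_eq zero_neq_one)
  have "Poly_Mapping.lookup (W a + U b) (W_var i) = Poly_Mapping.lookup a i" for a b i
    by (auto simp: W_def U_def lookup_add lookup_sum lookup_single when_def in_keys_iff sum.delta')
  moreover have "Poly_Mapping.lookup (W a + U b) (T_var i) = Poly_Mapping.lookup b i" for a b i
    by (auto simp: W_def U_def lookup_add lookup_sum lookup_single when_def in_keys_iff sum.delta')
  ultimately show ?thesis using eq by (metis poly_mapping_eqI)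
qed

lemma wt_monomial: "\<exists>a b. wt l S = mon wvar (Poly_Mapping.lookup a) * mon tvar (Poly_Mapping.lookup b)"
proof -
  have *: "\<exists>a. (\<Prod>i\<in>{1..n}. y (m - i) ^ e i) = mon y (Poly_Mapping.lookup a)" if "n \<le> m" for y :: "nat \<Rightarrow> tw_poly" and m n e
  proof -
    \<comment> \<open>the weight numbers the variables backwards\<close>
    define f where "f k = (if k \<in> {m - n..m - 1} \<and> k < m then e (m - k) else 0)" for k
    have "{k. f k \<noteq> 0} \<subseteq> {..m}" by (auto simp: f_def)
    then have "finite {k. f k \<noteq> 0}" by (rule finite_subset) simp
    then have f: "Poly_Mapping.lookup (Abs_poly_mapping f) = f" by (rule lookup_Abs_poly_mapping)
    have "mon y f = (\<Prod>k\<in>{k. m - n \<le> k \<and> k < m}. y k ^ f k)"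
      by (rule mon_eq_prod) (auto simp: f_def)
    also have "\<dots> = (\<Prod>i\<in>{1..n}. y (m - i) ^ e i)"
      by (rule prod.reindex_bij_witness[of _ "\<lambda>i. m - i" "\<lambda>k. m - k"]) (use that in \<open>auto simp: f_def\<close>)
    finally show ?thesis using f by metis
  qed
  have "(\<Prod>i\<in>{1..l}. wvar (l - i + 1) ^ e i) = (\<Prod>i\<in>{1..l}. wvar (Suc l - i) ^ e i)" for e
    by (rule prod.cong) (auto simp: Suc_diff_le)
  moreover obtain a where "(\<Prod>i\<in>{1..l}. wvar (Suc l - i) ^ card (skew (S ! (2 * i - 1)) (S ! (2 * i - 2)))) = mon wvar (Poly_Mapping.lookup a)"
    using *[of l "Suc l" wvar] by fastforce
  moreover obtain b where "(\<Prod>i\<in>{1..l - 1}. tvar (l - i) ^ card (skew (S ! (2 * i - 1)) (S ! (2 * i)))) = mon tvar (Poly_Mapping.lookup b)"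
    using *[of "l - 1" l tvar] by fastforce
  ultimately show ?thesis unfolding wt_def by metis
qed

lemma sum_wt_f_coeff:
  assumes fin: "finite (OS (num_parts lam) lam mu)"
  shows "(\<Sum>S\<in>OS (num_parts lam) lam mu. wt (num_parts lam) S) =
    Sum_any (\<lambda>a :: nat \<Rightarrow>\<^sub>0 nat. Sum_any (\<lambda>b :: nat \<Rightarrow>\<^sub>0 nat.
      of_nat (f_coeff lam mu a b) * (mon wvar (Poly_Mapping.lookup a) * mon tvar (Poly_Mapping.lookup b))))"
proof -
  let ?O = "OS (num_parts lam) lam mu"
  let ?M = "\<lambda>a b. mon wvar (Poly_Mapping.lookup a) * mon tvar (Poly_Mapping.lookup b)"
  have "\<forall>S. \<exists>p. wt (num_parts lam) S = ?M (fst p) (snd p)" using wt_monomial by simp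
  then obtain X where X: "\<And>S. wt (num_parts lam) S = ?M (fst (X S)) (snd (X S))" by metis
  have eq: "wt (num_parts lam) S = ?M a b \<longleftrightarrow> X S = (a, b)" for S a b
    unfolding X using mon_inject by (metis fst_conv snd_conv prod.collapse)
  have f: "f_coeff lam mu a b = card {S \<in> ?O. X S = (a, b)}" for a b
    unfolding f_coeff_def eq ..
  define A where "A = fst ` X ` ?O"
  define B where "B = snd ` X ` ?O"
  have finAB: "finite A" "finite B" using fin by (simp_all add: A_def B_def)
  have f0: "f_coeff lam mu a b = 0" if "a \<notin> A \<or> b \<notin> B" for a b
  proof -
    have *: "{S \<in> ?O. X S = (a, b)} = {}" using that unfolding A_def B_def by force
    show ?thesis unfolding f * by simp
  qed
  have inner: "Sum_any (\<lambda>b. of_nat (f_coeff lam mu a b) * ?M a b) = (\<Sum>b\<in>B. of_nat (f_coeff lam mu a b) * ?M a b)" for a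
    by (rule Sum_any.expand_superset[OF finAB(2)]) (rule subsetI, rule ccontr, simp add: f0)
  have "Sum_any (\<lambda>a. Sum_any (\<lambda>b. of_nat (f_coeff lam mu a b) * ?M a b)) = (\<Sum>a\<in>A. \<Sum>b\<in>B. of_nat (f_coeff lam mu a b) * ?M a b)"
    unfolding inner
  proof (rule Sum_any.expand_superset[OF finAB(1)])
    show "{a. (\<Sum>b\<in>B. of_nat (f_coeff lam mu a b) * ?M a b) \<noteq> 0} \<subseteq> A"
      by (rule subsetI, rule ccontr) (simp add: f0)
  qed
  also have "\<dots> = (\<Sum>p\<in>A \<times> B. of_nat (f_coeff lam mu (fst p) (snd p)) * ?M (fst p) (snd p))"
    by (simp add: sum.cartesian_product case_prod_unfold)
  also have "\<dots> = (\<Sum>p\<in>A \<times> B. \<Sum>S\<in>{S \<in> ?O. X S = p}. wt (num_parts lam) S)"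
    by (rule sum.cong[OF refl]) (simp add: f X)
  also have "\<dots> = (\<Sum>S\<in>?O. wt (num_parts lam) S)"
  proof (rule sum.group[OF fin])
    show "X ` ?O \<subseteq> A \<times> B" unfolding A_def B_def by (rule subset_fst_snd)
  qed (use finAB in simp)
  finally show ?thesis ..
qed

theorem corollary3p5:
  fixes lam mu :: integer_partition
  assumes "diagram lam \<noteq> {}"
  shows "K_coeff lam mu =
    Sum_any (\<lambda>a :: nat \<Rightarrow>\<^sub>0 nat. Sum_any (\<lambda>b :: nat \<Rightarrow>\<^sub>0 nat.
      of_nat (f_coeff lam mu a b) * (mon wvar (Poly_Mapping.lookup a) * mon tvar (Poly_Mapping.lookup b))))"
proof -
  define l where "l = num_parts lam"
  have lz: "\<forall>i>l. part lam i = 0" unfolding l_def using part_num_parts by blast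
  have l1: "1 \<le> l" unfolding l_def using assms by (rule num_parts_ge_1)
  obtain n where n: "\<forall>i>n. part mu i = 0" using ex_in_box by blast
  then have "\<forall>i>Suc n. part mu i = 0" by simp
  from sum_OS[OF l1 lz this, of tvar wvar] have fin: "finite (OS (num_parts lam) lam mu)" by (simp add: l_def)
  have "K_coeff lam = (\<lambda>mu. \<Sum>S\<in>OS (num_parts lam) lam mu. wt (num_parts lam) S)"
    unfolding K_coeff_def
  proof (rule the_equality)
    show "schur_expansion (hybrid_groth lam) (\<lambda>mu. \<Sum>S\<in>OS (num_parts lam) lam mu. wt (num_parts lam) S)"
      using assms by (rule hybrid_expansion)
  next
    fix c assume "schur_expansion (hybrid_groth lam) c"
    then show "c = (\<lambda>mu. \<Sum>S\<in>OS (num_parts lam) lam mu. wt (num_parts lam) S)"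
      using hybrid_expansion[OF assms] by (rule schur_expansion_unique)
  qed
  then show ?thesis using sum_wt_f_coeff[OF fin] by simp
qed

end
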